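(* Let $w$ be a cyclically reduced word in the letters $g_1,g_1^{-1},\ldots,g_k,g_k^{-1}$, and let $\sigma_n=w(s_1(n),\ldots,s_k(n))$. Suppose that all the sets $A_1,\ldots,A_k$ are infinite, that the length $|w|$ of $w$ satisfies $|w|>1$, and that $w$ is not a power of another word. Then, as $n$ goes to infinity, for all $l\geq1$, the law of $(N_1(\sigma_n),\ldots,N_l(\sigma_n))$ converges weakly to $$\operatorname{Poisson}(1/1)\otimes\cdots\otimes\operatorname{Poisson}(1/l).$$
   Context: Notation: $[n]=\{1,\ldots,n\}$; $\mathfrak{S}_n$ is the group of permutations of $[n]$; for a set $A$ of positive integers, $\mathfrak{S}_n(A)$ is the set of permutations of $[n]$ all of whose cycles have length in $A$; for a permutation $\sigma$ and $l\ge 1$, $N_l(\sigma)$ is the number of cycles of length $l$ of $\sigma$ (fixed points are cycles of length 1). $\operatorname{Poisson}(\lambda)$ is the Poisson distribution with parameter $\lambda$. Random permutations. Fix $k\ge1$ and nonempty sets $A_1,\ldots,A_k$ of positive integers, none of them equal to $\{1\}$, such that each $A_i$ is either finite or satisfies $\sum_{j\geq1,\,j\notin A_i}\frac1j<\infty$. Only integers $n$ such that $\mathfrak{S}_n(A_1),\ldots,\mathfrak{S}_n(A_k)$ are all nonempty are considered, and limits as $n\to\infty$ are along such $n$. For such $n$, $s_1(n),\ldots,s_k(n)$ are independent random permutations, $s_i(n)$ being uniformly distributed on $\mathfrak{S}_n(A_i)$. For a word $w$, $w(s_1(n),\ldots,s_k(n))$ is the permutation obtained by replacing each letter $g_i^{\pm1}$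 of $w$ by $s_i(n)^{\pm1}$ and composing. Words. A word in the letters $g_1,g_1^{-1},\ldots,g_k,g_k^{-1}$ is reduced if no letter is followed by its inverse, and cyclically reduced if moreover its first and last letters are not inverses of each other. "Not a power of another word" means that $w$ is not the concatenation of $d\ge2$ copies of the same word. *)

theory Defs
  imports "HOL-Probability.Probability" "HOL-Combinatorics.Combinatorics"
begin

text \<open>
  Permutations of \<open>{1..n}\<close> are functions \<open>nat \<Rightarrow> nat\<close> that fix everything outside \<open>{1..n}\<close>.
  Cycles are orbits of elements of \<open>{1..n}\<close>, so that fixed points in \<open>{1..n}\<close> count as cycles
  of length 1 and the points outside \<open>{1..n}\<close> do not count.
\<close>

definition cycles :: "nat \<Rightarrow> (nat \<Rightarrow> nat) \<Rightarrow> nat set set" where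
  "cycles n p = orbit p ` {1..n}"

definition perms_with_cycle_lengths :: "nat \<Rightarrow> nat set \<Rightarrow> (nat \<Rightarrow> nat) set" where
  "perms_with_cycle_lengths n A = {p. p permutes {1..n} \<and> (\<forall>c\<in>cycles n p. card c \<in> A)}"

definition num_cycles :: "nat \<Rightarrow> nat \<Rightarrow> (nat \<Rightarrow> nat) \<Rightarrow> nat" where
  "num_cycles n l p = card {c \<in> cycles n p. card c = l}"

datatype letter = Gen (gen_index: nat) | InvGen (gen_index: nat)

fun inv_letter :: "letter \<Rightarrow> letter" where
  "inv_letter (Gen i) = InvGen i"
| "inv_letter (InvGen i) = Gen i"

definition word_on :: "nat \<Rightarrow> letter list \<Rightarrow> bool" where
  "word_on k w \<longleftrightarrow> (\<forall>x\<in>set w. gen_index x \<in> {1..k})"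

definition reduced :: "letter list \<Rightarrow> bool" where
  "reduced w \<longleftrightarrow> successively (\<lambda>x y. y \<noteq> inv_letter x) w"

definition cyclically_reduced :: "letter list \<Rightarrow> bool" where
  "cyclically_reduced w \<longleftrightarrow> reduced w \<and> (w \<noteq> [] \<longrightarrow> hd w \<noteq> inv_letter (last w))"

definition is_power :: "letter list \<Rightarrow> bool" where
  "is_power w \<longleftrightarrow> (\<exists>d v. d \<ge> 2 \<and> w = concat (replicate d v))"

fun letter_perm :: "(nat \<Rightarrow> nat \<Rightarrow> nat) \<Rightarrow> letter \<Rightarrow> nat \<Rightarrow> nat" where
  "letter_perm s (Gen i) = s i"
| "letter_perm s (InvGen i) = inv (s i)"

text \<open>The word \<open>x\<^sub>1 \<dots> x\<^sub>m\<close> is sent to the composition \<open>x\<^sub>1 \<circ> \<dots> \<circ> x\<^sub>m\<close> (rightmost letter applied first).\<close>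

definition word_perm :: "(nat \<Rightarrow> nat \<Rightarrow> nat) \<Rightarrow> letter list \<Rightarrow> nat \<Rightarrow> nat" where
  "word_perm s w = foldr (\<circ>) (map (letter_perm s) w) id"

definition admissible_sizes :: "nat \<Rightarrow> (nat \<Rightarrow> nat set) \<Rightarrow> nat set" where
  "admissible_sizes k A = {n. \<forall>i\<in>{1..k}. perms_with_cycle_lengths n (A i) \<noteq> {}}"

text \<open>
  The joint law of independent \<open>s\<^sub>1(n), \<dots>, s\<^sub>k(n)\<close>, with \<open>s\<^sub>i(n)\<close> uniform; it is meaningful only for
  \<open>n \<in> admissible_sizes k A\<close>, and \<open>id\<close> is a dummy value at indices outside \<open>{1..k}\<close>.
\<close>

definition random_perms :: "nat \<Rightarrow> (nat \<Rightarrow> nat set) \<Rightarrow> nat \<Rightarrow> (nat \<Rightarrow> nat \<Rightarrow> nat) pmf" where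
  "random_perms k A n =
     Pi_pmf {1..k} id (\<lambda>i. pmf_of_set (perms_with_cycle_lengths n (A i)))"

definition random_word_perm ::
    "nat \<Rightarrow> (nat \<Rightarrow> nat set) \<Rightarrow> letter list \<Rightarrow> nat \<Rightarrow> (nat \<Rightarrow> nat) pmf" where
  "random_word_perm k A w n = map_pmf (\<lambda>s. word_perm s w) (random_perms k A n)"

text \<open>
  A tuple \<open>(m\<^sub>1, \<dots>, m\<^sub>l)\<close> of natural numbers is represented by the function \<open>nat \<Rightarrow> nat\<close> with these
  values on \<open>{1..l}\<close> and the value 0 elsewhere. In the product topology on \<open>nat \<Rightarrow> nat\<close>, these
  functions form a closed subspace with the discrete topology.
\<close>

definition cycle_counts :: "nat \<Rightarrow> nat \<Rightarrow> (nat \<Rightarrow> nat) \<Rightarrow> nat \<Rightarrow> nat" where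
  "cycle_counts n l p = (\<lambda>j. if j \<in> {1..l} then num_cycles n j p else 0)"

definition poisson_product :: "nat \<Rightarrow> (nat \<Rightarrow> nat) pmf" where
  "poisson_product l = Pi_pmf {1..l} 0 (\<lambda>j. poisson_pmf (1 / real j))"

definition converges_weakly ::
    "('i \<Rightarrow> 'a::topological_space measure) \<Rightarrow> 'a measure \<Rightarrow> 'i filter \<Rightarrow> bool" where
  "converges_weakly M L F \<longleftrightarrow>
     (\<forall>f :: 'a \<Rightarrow> real. continuous_on UNIV f \<and> bounded (range f) \<longrightarrow>
        ((\<lambda>i. \<integral>x. f x \<partial>M i) \<longlongrightarrow> (\<integral>x. f x \<partial>L)) F)"

end

theory Submission
  imports Defs "HOL-Real_Asymp.Real_Asymp"
begin

text \<open>
  Since \<open>\<Sum>1/j\<close> over the forbidden lengths \<open>j \<notin> A i\<close> converges, the permutations all of whose cycle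
  lengths lie in \<open>A i\<close> form a set of positive asymptotic density in the symmetric group. So the
  random tuple is a uniform tuple \<open>s\<close> of permutations of \<open>{1..n}\<close>, conditioned on an event whose
  probability stays away from 0. Up to a small probability this event only says that no \<open>s i\<close> has a
  cycle of forbidden length at most \<open>M\<close>, because for uniform \<open>s\<close> the expected number of cycles of
  length \<open>r\<close> of \<open>s i\<close> is exactly \<open>1/r\<close> (\<open>card_only_long_forbidden_cycles\<close>). It remains to see that,
  for uniform \<open>s\<close>, the numbers of short cycles of \<open>w(s)\<close> are asymptotically independent Poisson
  variables and independent of the short cycles of the \<open>s i\<close>.

  This is done by a Stein argument for the Poisson distribution. Write \<open>p(m)\<close> for the probability
  that \<open>w(s)\<close> has \<open>m j\<close> cycles of length \<open>j\<close> for all \<open>j \<le> l\<close> and that no \<open>s i\<close> has a forbidden cycle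
  of length at most \<open>M\<close>. The recursion \<open>j * (m j + 1) * p(m + 1\<^sub>j) - p(m) \<longlonglongrightarrow> 0\<close>
  (\<open>joint_event_recursion\<close>) together with the boundedness of the expected number of cycles determines
  \<open>p(m)\<close> up to the probability of the second condition: \<open>p(m)\<close> is asymptotically that probability
  times the Poisson weight of \<open>m\<close> (\<open>joint_event_limit\<close>). Applied to words with a single letter, this
  also gives the positive density claimed above: the probability that \<open>s i\<close> avoids the forbidden
  lengths \<open>r \<le> M\<close> tends to \<open>exp (- \<Sum>1/r)\<close>, which is bounded below independently of \<open>M\<close>.

  The recursion comes from a bijection. Read \<open>w\<close> periodically and walk along it from a point \<open>x\<close> for
  \<open>L = j * |w|\<close> steps. If the \<open>L + 1\<close> points visited are distinct, the last step can be redirected to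
  \<open>x\<close> by composing one of the permutations with a transposition; this closes the walk to a cycle of
  length \<open>j\<close> of \<open>w(s)\<close>. Together with the old end point the new tuple determines the old one
  (\<open>bij_betw_close_up\<close>). For all but boundedly many points \<open>x\<close> on average, every short reduced walk
  near \<open>x\<close> and near the end point is injective (\<open>card_not_tree_like\<close>), and then closing the walk
  changes nothing else: it creates exactly one short cycle of \<open>w(s)\<close>, destroys none, and does not
  touch the short cycles of the \<open>s i\<close> (\<open>num_cycles_closing\<close>, \<open>num_cycles_closing_generator\<close>). Here it
  matters that \<open>w\<close> is no proper power, is not conjugate to its inverse, and, having more than one
  letter, is not conjugate to a power of a letter. Conversely, almost every point on a cycle of
  length \<open>j\<close> of \<open>w(s)\<close> lies on such a simple closed walk: otherwise its walk has two independent
  coincidences, and this happens only for \<open>O(1/n)\<close> points on average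
  (\<open>two_collisions_of_not_simple\<close>, \<open>card_period_not_simple\<close>).

  All these estimates rest on one counting principle (\<open>collision_card_le\<close>): if a step of a walk uses
  an unused edge and hits a visited point, it can be redirected to about \<open>n\<close> other points, and the
  outcome still determines the original tuple, so such a coincidence has probability \<open>O(1/n)\<close>.
\<close>

section \<open>Tuples of permutations and rerouting of one arrow\<close>

lemma inv_letter_inv_letter [simp]: "inv_letter (inv_letter e) = e"
  by (cases e) auto

lemma inv_letter_neq [simp]: "inv_letter e \<noteq> e" "e \<noteq> inv_letter e"
  by (cases e; simp)+

lemma gen_index_inv_letter [simp]: "gen_index (inv_letter e) = gen_index e"
  by (cases e) auto

lemma inv_letter_eq_iff [simp]: "inv_letter a = inv_letter b \<longleftrightarrow> a = b"
  by (metis inv_letter_inv_letter)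

definition perm_tuples :: "nat \<Rightarrow> nat \<Rightarrow> (nat \<Rightarrow> nat \<Rightarrow> nat) set" where
  "perm_tuples k n = PiE_dflt {1..k} id (\<lambda>_. {p. p permutes {1..n}})"

lemma perm_tuples_permutes: "s \<in> perm_tuples k n \<Longrightarrow> s i permutes {1..n}"
  by (cases "i \<in> {1..k}") (auto simp: perm_tuples_def PiE_dflt_def permutes_id)

lemma finite_perm_tuples [simp]: "finite (perm_tuples k n)"
  unfolding perm_tuples_def by (intro finite_PiE_dflt) (auto intro: finite_permutations)

lemma perm_tuples_nonempty: "perm_tuples k n \<noteq> {}"
proof -
  have "(\<lambda>_. id) \<in> perm_tuples k n"
    by (auto simp: perm_tuples_def PiE_dflt_def permutes_id)
  thus ?thesis by blast
qed

lemma card_perm_tuples_pos: "card (perm_tuples k n) > 0"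
  using perm_tuples_nonempty by (simp add: card_gt_0_iff)

lemma letter_perm_permutes:
  assumes "s \<in> perm_tuples k n" shows "letter_perm s e permutes {1..n}"
  using perm_tuples_permutes[OF assms] by (cases e) (auto intro: permutes_inv)

lemma letter_perm_bij:
  assumes "s \<in> perm_tuples k n" shows "bij (letter_perm s e)"
  using letter_perm_permutes[OF assms] by (rule permutes_bij)

lemma letter_perm_in:
  assumes "s \<in> perm_tuples k n" shows "letter_perm s e x \<in> {1..n} \<longleftrightarrow> x \<in> {1..n}"
  using letter_perm_permutes[OF assms] by (rule permutes_in_image)

lemma letter_perm_inv_letter:
  assumes "s \<in> perm_tuples k n" shows "letter_perm s (inv_letter e) = inv (letter_perm s e)"
  using permutes_inv_inv[OF perm_tuples_permutes[OF assms]] by (cases e) auto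

lemma letter_perm_cancel:
  assumes "s \<in> perm_tuples k n"
  shows "letter_perm s (inv_letter e) (letter_perm s e x) = x"
    and "letter_perm s e (letter_perm s (inv_letter e) x) = x"
  using letter_perm_permutes[OF assms, of e] 
  by (simp_all add: letter_perm_inv_letter[OF assms] permutes_inverses)

text \<open>
  Letters are treated as labelled arrows \<open>z \<rightarrow> letter_perm s e z\<close>, the arrow of \<open>inv_letter e\<close> being the
  reversed one. Rerouting exchanges the targets \<open>a\<close> and \<open>b\<close> of the two arrows of \<open>e\<close> that end there;
  depending on the sign of \<open>e\<close> this composes the permutation with a transposition on the left or
  on the right.
\<close>
definition reroute ::
  "(nat \<Rightarrow> nat \<Rightarrow> nat) \<Rightarrow> letter \<Rightarrow> nat \<Rightarrow> nat \<Rightarrow> (nat \<Rightarrow> nat \<Rightarrow> nat)" where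
  "reroute s e a b = s(gen_index e :=
     (case e of Gen i \<Rightarrow> Transposition.transpose a b \<circ> s i | InvGen i \<Rightarrow> s i \<circ> Transposition.transpose a b))"

lemma reroute_in_perm_tuples:
  assumes "s \<in> perm_tuples k n" "gen_index e \<in> {1..k}" "a \<in> {1..n}" "b \<in> {1..n}"
  shows "reroute s e a b \<in> perm_tuples k n"
proof -
  have t: "Transposition.transpose a b permutes {1..n}"
    using assms by (intro permutes_swap_id) auto
  show ?thesis
    using assms perm_tuples_permutes[OF assms(1)] t
    by (cases e) (auto simp: reroute_def perm_tuples_def PiE_dflt_def intro!: permutes_compose)
qed

lemma reroute_reroute: "reroute (reroute s e a b) e a b = s"
  by (cases e) (auto simp: reroute_def fun_eq_iff)

lemma letter_perm_reroute:
  assumes "s \<in> perm_tuples k n"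
  shows "letter_perm (reroute s e a b) e z = Transposition.transpose a b (letter_perm s e z)"
proof (cases e)
  case (InvGen i)
  have b: "bij (s i)" using perm_tuples_permutes[OF assms] permutes_bij by blast
  have "inv (s i \<circ> Transposition.transpose a b) = inv (Transposition.transpose a b) \<circ> inv (s i)"
    by (rule o_inv_distrib) (use b in auto)
  thus ?thesis by (simp add: InvGen reroute_def inv_transpose_eq)
qed (simp add: reroute_def)

lemma letter_perm_reroute_inv:
  assumes "s \<in> perm_tuples k n"
  shows "letter_perm (reroute s e a b) (inv_letter e) z = letter_perm s (inv_letter e) (Transposition.transpose a b z)"
proof (cases e)
  case (Gen i)
  have b: "bij (s i)" using perm_tuples_permutes[OF assms] permutes_bij by blast
  have "inv (Transposition.transpose a b \<circ> s i) = inv (s i) \<circ> inv (Transposition.transpose a b)"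
    by (rule o_inv_distrib) (use b in auto)
  thus ?thesis by (simp add: Gen reroute_def inv_transpose_eq)
qed (simp add: reroute_def)

lemma letter_perm_reroute_other:
  assumes "d \<noteq> e" "d \<noteq> inv_letter e"
  shows "letter_perm (reroute s e a b) d = letter_perm s d"
proof -
  have "gen_index d \<noteq> gen_index e"
    using assms by (cases d; cases e) auto
  thus ?thesis by (cases d) (auto simp: reroute_def)
qed

text \<open>
  The step from \<open>z\<close> along \<open>d\<close> uses, in one of the two directions, an arrow of \<open>e\<close> ending in \<open>V\<close>.
\<close>
definition affected ::
    "(nat \<Rightarrow> nat \<Rightarrow> nat) \<Rightarrow> letter \<Rightarrow> nat set \<Rightarrow> letter \<Rightarrow> nat \<Rightarrow> bool" where
  "affected s e V d z \<longleftrightarrow> d = e \<and> letter_perm s e z \<in> V \<or> d = inv_letter e \<and> z \<in> V"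

lemma letter_perm_reroute_unaffected:
  assumes "s \<in> perm_tuples k n" "\<not> affected s e {a, b} d z"
  shows "letter_perm (reroute s e a b) d z = letter_perm s d z"
proof -
  consider "d = e" | "d = inv_letter e" | "d \<noteq> e" "d \<noteq> inv_letter e" by blast
  thus ?thesis
  proof cases
    case 1
    with assms show ?thesis by (auto simp: affected_def letter_perm_reroute[OF assms(1)])
  next
    case 2
    with assms show ?thesis by (auto simp: affected_def letter_perm_reroute_inv[OF assms(1)])
  qed (simp add: letter_perm_reroute_other)
qed

lemma affected_reroute:
  assumes "s \<in> perm_tuples k n"
  shows "affected (reroute s e a b) e {a, b} d z \<longleftrightarrow> affected s e {a, b} d z"
  by (auto simp: affected_def letter_perm_reroute[OF assms] transpose_eq_iff split: if_splits)

section \<open>Walks and collisions\<close>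
primrec walk :: "(nat \<Rightarrow> nat \<Rightarrow> nat) \<Rightarrow> (nat \<Rightarrow> letter) \<Rightarrow> nat \<Rightarrow> nat \<Rightarrow> nat" where
  "walk s f x 0 = x"
| "walk s f x (Suc t) = letter_perm s (f t) (walk s f x t)"

lemma walk_add: "walk s f x (a + t) = walk s (\<lambda>i. f (a + i)) (walk s f x a) t"
  by (induction t) auto

lemma walk_cong: "(\<And>r. r < t \<Longrightarrow> f r = g r) \<Longrightarrow> walk s f x t = walk s g x t"
  by (induction t) auto

lemma walk_in:
  assumes "s \<in> perm_tuples k n" shows "walk s f x t \<in> {1..n} \<longleftrightarrow> x \<in> {1..n}"
  by (induction t) (simp_all only: walk.simps letter_perm_in[OF assms])

lemma bij_walk:
  assumes "s \<in> perm_tuples k n" shows "bij (\<lambda>x. walk s f x t)"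
proof (induction t)
  case (Suc t)
  have "bij (letter_perm s (f t) \<circ> (\<lambda>x. walk s f x t))"
    using Suc letter_perm_bij[OF assms] by (rule bij_comp)
  thus ?case by (simp add: o_def)
qed (simp add: bij_def inj_on_def)

lemma walk_reroute:
  assumes "s \<in> perm_tuples k n"
    and "\<And>r. r < t \<Longrightarrow> \<not> affected s e {a, b} (f r) (walk s f x r)"
  shows "walk (reroute s e a b) f x t = walk s f x t"
  using assms(2)
  by (induction t) (auto simp: letter_perm_reroute_unaffected[OF assms(1)])

lemma walk_reroute_le:
  assumes "s \<in> perm_tuples k n" "r \<le> t"
    and "\<And>r. r < t \<Longrightarrow> \<not> affected s e {a, b} (f r) (walk s f x r)"
  shows "walk (reroute s e a b) f x r = walk s f x r"
  using assms by (intro walk_reroute) auto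

lemma walk_back:
  assumes "s \<in> perm_tuples k n" "t \<le> L"
  shows "walk s (\<lambda>i. inv_letter (f (L - 1 - i))) (walk s f x L) t = walk s f x (L - t)"
  using assms(2)
proof (induction t)
  case (Suc t)
  hence "L - t = Suc (L - Suc t)" by simp
  with Suc show ?case by (simp add: letter_perm_cancel[OF assms(1)])
qed simp

text \<open>
  Step \<open>t\<close> of the walk uses an arrow that no earlier step has used in either direction.
\<close>
definition fresh ::
    "(nat \<Rightarrow> nat \<Rightarrow> nat) \<Rightarrow> (nat \<Rightarrow> letter) \<Rightarrow> nat \<Rightarrow> nat \<Rightarrow> bool" where
  "fresh s f x t \<longleftrightarrow> (\<forall>r<t. \<not> (f r = f t \<and> walk s f x r = walk s f x t) \<and>
      \<not> (f r = inv_letter (f t) \<and> walk s f x (Suc r) = walk s f x t))"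

definition collision ::
    "(nat \<Rightarrow> nat \<Rightarrow> nat) \<Rightarrow> (nat \<Rightarrow> letter) \<Rightarrow> nat \<Rightarrow> nat \<Rightarrow> bool" where
  "collision s f x t \<longleftrightarrow> fresh s f x t \<and> walk s f x (Suc t) \<in> walk s f x ` {..t}"

lemma fresh_unaffected:
  assumes "s \<in> perm_tuples k n" "fresh s f x t" "y \<notin> walk s f x ` {..t}" "r < t"
  shows "\<not> affected s (f t) {walk s f x (Suc t), y} (f r) (walk s f x r)"
proof
  assume "affected s (f t) {walk s f x (Suc t), y} (f r) (walk s f x r)"
  then consider "f r = f t" "walk s f x (Suc r) \<in> {walk s f x (Suc t), y}"
    | "f r = inv_letter (f t)" "walk s f x r \<in> {walk s f x (Suc t), y}"
    by (auto simp: affected_def)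
  thus False
  proof cases
    case 1
    have "walk s f x (Suc r) \<noteq> y" using assms(3,4) by (auto simp del: walk.simps)
    with 1 have "letter_perm s (f t) (walk s f x r) = letter_perm s (f t) (walk s f x t)" by simp
    hence "walk s f x r = walk s f x t"
      using letter_perm_bij[OF assms(1)] by (metis bij_pointE)
    with assms(2,4) 1 show False by (auto simp: fresh_def)
  next
    case 2
    have "walk s f x r \<noteq> y" using assms(3,4) by auto
    with 2 have "walk s f x r = letter_perm s (f t) (walk s f x t)" by simp
    hence "walk s f x (Suc r) = walk s f x t" using 2 letter_perm_cancel(1)[OF assms(1)] by simp
    with assms(2,4) 2 show False by (auto simp: fresh_def simp del: walk.simps)
  qed
qed

text \<open>
  Whether a pair belongs to \<open>X\<close> is decided by the first \<open>t\<close> steps of its walk. In a pair with a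
  collision at step \<open>t\<close> with the vertex visited at time \<open>a\<close>, that step can be rerouted to any
  unvisited \<open>y\<close>. No earlier step notices this, the result stays in \<open>X\<close>, and both \<open>y\<close> (the new vertex
  at time \<open>t + 1\<close>) and the original tuple can be read off from it. So each such pair accounts for at
  least \<open>n - (t + 1)\<close> elements of \<open>X\<close>, for each of the \<open>t + 1\<close> values of \<open>a\<close>.
\<close>
lemma collision_card_le:
  assumes X: "X \<subseteq> perm_tuples k n \<times> {1..n}"
    and det: "\<And>s s' x. (s, x) \<in> X \<Longrightarrow> s' \<in> perm_tuples k n \<Longrightarrow>
       (\<And>r. r \<le> t \<Longrightarrow> walk s' f x r = walk s f x r) \<Longrightarrow> (s', x) \<in> X"
    and ft: "gen_index (f t) \<in> {1..k}"
  shows "card {(s, x) \<in> X. collision s f x t} * (n - Suc t) \<le> Suc t * card X"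
proof -
  have finX: "finite X" using X by (rule finite_subset) auto
  define Y where "Y a = {(s, x) \<in> X. fresh s f x t \<and> walk s f x (Suc t) = walk s f x a}" for a
  have finY: "finite (Y a)" for a unfolding Y_def by (rule finite_subset[OF _ finX]) auto
  have one: "card (Y a) * (n - Suc t) \<le> card X" if a: "a \<le> t" for a
  proof -
    define S where "S = (SIGMA p:Y a. {1..n} - walk (fst p) f (snd p) ` {..t})"
    define \<phi> where "\<phi> = (\<lambda>(p, y). (reroute (fst p) (f t) (walk (fst p) f (snd p) a) y, snd p))"
    have "inj_on \<phi> S \<and> \<phi> ` S \<subseteq> X"
    proof -
      have key: "s \<in> perm_tuples k n \<and> x \<in> {1..n} \<and> (s', x) \<in> X \<and> y = walk s' f x (Suc t) \<and>
          s = reroute s' (f t) (walk s' f x a) (walk s' f x (Suc t))"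
        if "((s, x), y) \<in> S" "s' = reroute s (f t) (walk s f x a) y" for s x y s'
      proof -
        from that have sx: "(s, x) \<in> X" "fresh s f x t" "walk s f x (Suc t) = walk s f x a"
          and y: "y \<in> {1..n}" "y \<notin> walk s f x ` {..t}"
          by (auto simp: S_def Y_def simp del: walk.simps)
        have s: "s \<in> perm_tuples k n" "x \<in> {1..n}" using sx X by auto
        have s': "s' = reroute s (f t) (walk s f x (Suc t)) y" using that sx by simp
        have w: "walk s' f x r = walk s f x r" if "r \<le> t" for r
          unfolding s' using fresh_unaffected[OF s(1) sx(2) y(2)] that
          by (intro walk_reroute_le[OF s(1), where t = t]) (auto simp del: walk.simps)
        have w': "walk s' f x (Suc t) = y"
          using w[of t] letter_perm_reroute[OF s(1)] unfolding s' by simp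
        have s'': "s' \<in> perm_tuples k n"
          unfolding s' using s ft y walk_in[OF s(1), of f x "Suc t"] by (intro reroute_in_perm_tuples) blast+
        have "s = reroute s' (f t) (walk s' f x a) (walk s' f x (Suc t))"
          using w[OF a] w' that(2) reroute_reroute by metis
        with s s'' w w' det[OF sx(1) s''] show ?thesis by blast
      qed
      have "inj_on \<phi> S"
      proof (rule inj_onI)
        fix p q assume pq: "p \<in> S" "q \<in> S" "\<phi> p = \<phi> q"
        obtain s x y s2 x2 y2 where e: "p = ((s, x), y)" "q = ((s2, x2), y2)"
          by (metis surj_pair)
        show "p = q" using key[of s x y] key[of s2 x2 y2] pq unfolding e \<phi>_def 
          by (metis (no_types, lifting) case_prod_conv fst_conv snd_conv)
      qed
      moreover have "\<phi> ` S \<subseteq> X"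
        using key by (force simp: \<phi>_def)
      ultimately show ?thesis by blast
    qed
    hence "card S \<le> card X" using finX by (metis card_inj_on_le)
    moreover have "card S = (\<Sum>p\<in>Y a. card ({1..n} - walk (fst p) f (snd p) ` {..t}))"
      unfolding S_def using finY by (intro card_SigmaI) auto
    moreover have "\<dots> \<ge> (\<Sum>p\<in>Y a. n - Suc t)"
    proof (rule sum_mono)
      fix p assume "p \<in> Y a"
      have "card (walk (fst p) f (snd p) ` {..t}) \<le> Suc t"
        using card_image_le[of "{..t}"] by fastforce
      thus "n - Suc t \<le> card ({1..n} - walk (fst p) f (snd p) ` {..t})"
        using diff_card_le_card_Diff[of "walk (fst p) f (snd p) ` {..t}" "{1..n}"] by simp
    qed
    ultimately show ?thesis by simp
  qed
  have "{(s, x) \<in> X. collision s f x t} \<subseteq> (\<Union>a\<in>{..t}. Y a)"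
    by (auto simp: collision_def Y_def)
  hence "card {(s, x) \<in> X. collision s f x t} \<le> card (\<Union>a\<in>{..t}. Y a)"
    using finY by (intro card_mono) auto
  also have "\<dots> \<le> (\<Sum>a\<in>{..t}. card (Y a))" by (rule card_UN_le) auto
  finally have "card {(s, x) \<in> X. collision s f x t} * (n - Suc t)
      \<le> (\<Sum>a\<in>{..t}. card (Y a) * (n - Suc t))" by (simp add: sum_distrib_right[symmetric])
  also have "\<dots> \<le> (\<Sum>a\<in>{..t}. card X)" by (intro sum_mono one) auto
  finally show ?thesis by simp
qed

lemma collision_cong:
  assumes "\<And>r. r \<le> t \<Longrightarrow> f r = g r" "\<And>r. r \<le> Suc t \<Longrightarrow> walk s' g x r = walk s f x r"
  shows "collision s' g x t \<longleftrightarrow> collision s f x t"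
proof -
  have "walk s' g x ` {..t} = walk s f x ` {..t}"
    by (intro image_cong) (use assms in auto)
  thus ?thesis
    using assms by (auto simp: collision_def fresh_def simp del: walk.simps)
qed

text \<open>
  The constant is uniform in \<open>n\<close>: for \<open>n < 2 * (t + 1)\<close> the bound already holds for the number
  of all pairs.
\<close>
lemma card_collision:
  assumes "gen_index (f t) \<in> {1..k}"
  shows "card {(s, x) \<in> perm_tuples k n \<times> {1..n}. collision s f x t}
    \<le> 2 * Suc t * card (perm_tuples k n)" (is "?c \<le> _")
proof (cases "n \<ge> 2 * Suc t")
  case True
  hence "?c * n \<le> ?c * (2 * (n - Suc t))" by (intro mult_left_mono) auto
  also have "\<dots> \<le> 2 * (Suc t * card (perm_tuples k n \<times> {1..n}))"
    using collision_card_le[of "perm_tuples k n \<times> {1..n}" k n t f, OF _ _ assms] 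
    by (auto simp: mult.assoc mult.left_commute[of _ 2] simp del: mult_Suc card_cartesian_product)
  also have "\<dots> = 2 * Suc t * card (perm_tuples k n) * n" by (simp add: algebra_simps)
  finally show ?thesis using True by simp
next
  case False
  have "?c \<le> card (perm_tuples k n \<times> {1..n})" by (intro card_mono) auto
  also have "\<dots> = card (perm_tuples k n) * n" by simp
  also have "\<dots> \<le> card (perm_tuples k n) * (2 * Suc t)" using False by (intro mult_left_mono) auto
  finally show ?thesis by (simp add: mult_ac)
qed

text \<open>
  The earlier collision is decided by the walk up to the later one, so the counting principle applies
  twice and gains a factor \<open>1/n\<close> each time.
\<close>
lemma card_two_collisions:
  assumes "gen_index (f a) \<in> {1..k}" "gen_index (f b) \<in> {1..k}" "a < b"
  shows "card {(s, x) \<in> perm_tuples k n \<times> {1..n}. collision s f x a \<and> collision s f x b} * n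
    \<le> 4 * Suc a * Suc b * card (perm_tuples k n)" (is "?c * n \<le> _")
proof -
  define X where "X = {(s, x) \<in> perm_tuples k n \<times> {1..n}. collision s f x a}"
  have eq: "{(s, x) \<in> perm_tuples k n \<times> {1..n}. collision s f x a \<and> collision s f x b}
      = {(s, x) \<in> X. collision s f x b}" by (auto simp: X_def)
  have X: "card X \<le> 2 * Suc a * card (perm_tuples k n)"
    unfolding X_def by (rule card_collision) fact
  have finX: "finite X" unfolding X_def by (rule finite_subset[of _ "perm_tuples k n \<times> {1..n}"]) auto
  show ?thesis
  proof (cases "n \<ge> 2 * Suc b")
    case True
    have c: "?c * (n - Suc b) \<le> Suc b * card X"
      unfolding eq
    proof (rule collision_card_le)
      fix s s' x
      assume sx: "(s, x) \<in> X" "s' \<in> perm_tuples k n" "\<And>r. r \<le> b \<Longrightarrow> walk s' f x r = walk s f x r"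
      have "collision s' f x a \<longleftrightarrow> collision s f x a"
        using sx(3) assms by (intro collision_cong) auto
      thus "(s', x) \<in> X" using sx by (auto simp: X_def)
    qed (use assms in \<open>auto simp: X_def\<close>)
    have "?c * n \<le> ?c * (2 * (n - Suc b))" using True by (intro mult_left_mono) auto
    also have "\<dots> \<le> 2 * (Suc b * card X)" using c by simp
    also have "\<dots> \<le> 2 * (Suc b * (2 * Suc a * card (perm_tuples k n)))"
      using X by (intro mult_left_mono) auto
    also have "\<dots> = 4 * Suc a * Suc b * card (perm_tuples k n)" by (simp add: algebra_simps)
    finally show ?thesis .
  next
    case False
    have "?c \<le> card X" unfolding eq using finX by (intro card_mono) auto
    hence "?c * n \<le> (2 * Suc a * card (perm_tuples k n)) * (2 * Suc b)"
      using False X by (intro mult_mono) auto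
    also have "\<dots> = 4 * Suc a * Suc b * card (perm_tuples k n)" by (simp add: algebra_simps)
    finally show ?thesis .
  qed
qed

definition reduced_seq :: "(nat \<Rightarrow> letter) \<Rightarrow> bool" where
  "reduced_seq f \<longleftrightarrow> (\<forall>t. f (Suc t) \<noteq> inv_letter (f t))"

definition seq_on :: "nat \<Rightarrow> (nat \<Rightarrow> letter) \<Rightarrow> bool" where
  "seq_on k f \<longleftrightarrow> (\<forall>t. gen_index (f t) \<in> {1..k})"

section \<open>Neighbourhoods without short cycles\<close>

text \<open>
  In essence, the arrows within distance about \<open>R/2\<close> of \<open>x\<close> form a tree. Stating it for infinite
  reduced sequences loses nothing, since every finite reduced word extends to one.
\<close>
definition tree_like :: "nat \<Rightarrow> nat \<Rightarrow> (nat \<Rightarrow> nat \<Rightarrow> nat) \<Rightarrow> nat \<Rightarrow> bool" where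
  "tree_like k R s x \<longleftrightarrow> (\<forall>f. reduced_seq f \<and> seq_on k f \<longrightarrow> inj_on (walk s f x) {..R})"

lemma inj_fresh:
  assumes "reduced_seq f" "inj_on (walk s f x) {..t}"
  shows "fresh s f x t"
  unfolding fresh_def
proof (intro allI impI conjI notI; elim conjE)
  fix r assume "r < t" "walk s f x r = walk s f x t"
  thus False using inj_onD[OF assms(2), of r t] by auto
next
  fix r assume r: "r < t" "walk s f x (Suc r) = walk s f x t" "f r = inv_letter (f t)"
  hence "Suc r = t" using inj_onD[OF assms(2), of "Suc r" t] by auto
  thus False using r assms(1) unfolding reduced_seq_def by (metis inv_letter_inv_letter)
qed

lemma not_inj_first_return:
  assumes "\<not> inj_on g {..R::nat}"
  shows "\<exists>t<R. inj_on g {..t} \<and> g (Suc t) \<in> g ` {..t}"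
  using assms
proof (induction R)
  case (Suc R)
  show ?case
  proof (cases "inj_on g {..R}")
    case True
    have "g (Suc R) \<in> g ` {..R}"
    proof (rule ccontr)
      assume "g (Suc R) \<notin> g ` {..R}"
      with True have "inj_on g (insert (Suc R) {..R})" by (simp add: inj_on_insert)
      with Suc.prems show False by (simp add: atMost_Suc)
    qed
    with True show ?thesis by blast
  qed (use Suc.IH less_SucI in blast)
qed auto

text \<open>
  The first return of a reduced walk to a visited vertex uses a fresh arrow: the only used arrow at a
  vertex just discovered is the one by which it was entered, and a reduced walk does not go back.
\<close>
lemma not_inj_collision:
  assumes "reduced_seq f" "\<not> inj_on (walk s f x) {..R}"
  shows "\<exists>t<R. inj_on (walk s f x) {..t} \<and> collision s f x t"
  using not_inj_first_return[OF assms(2)] inj_fresh[OF assms(1)]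
  by (auto simp: collision_def simp del: walk.simps)

lemma card_not_tree_like:
  "\<exists>C. \<forall>n. card {(s, x) \<in> perm_tuples k n \<times> {1..n}. \<not> tree_like k R s x}
     \<le> C * card (perm_tuples k n)"
proof -
  define L where "L = Gen ` {1..k} \<union> InvGen ` {1..k}"
  have L: "e \<in> L \<longleftrightarrow> gen_index e \<in> {1..k}" for e by (cases e) (auto simp: L_def)
  define F where "F = PiE_dflt {..<R} (Gen 1) (\<lambda>_. L)"
  have finF: "finite F" unfolding F_def L_def by (intro finite_PiE_dflt) auto
  define D where "D n f t = {(s, x) \<in> perm_tuples k n \<times> {1..n}. collision s f x t}" for n f t
  have finD: "finite (D n f t)" for n f t
    unfolding D_def by (rule finite_subset[of _ "perm_tuples k n \<times> {1..n}"]) auto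
  have "card {(s, x) \<in> perm_tuples k n \<times> {1..n}. \<not> tree_like k R s x}
      \<le> (\<Sum>f\<in>F. \<Sum>t<R. 2 * Suc t) * card (perm_tuples k n)" for n
  proof -
    have "{(s, x) \<in> perm_tuples k n \<times> {1..n}. \<not> tree_like k R s x} \<subseteq> (\<Union>f\<in>F. \<Union>t\<in>{..<R}. D n f t)"
    proof (clarify)
      fix s x assume s: "s \<in> perm_tuples k n" "x \<in> {1..n}" "\<not> tree_like k R s x"
      then obtain f where f: "reduced_seq f" "seq_on k f" "\<not> inj_on (walk s f x) {..R}"
        by (auto simp: tree_like_def)
      obtain t where t: "t < R" "collision s f x t"
        using not_inj_collision[OF f(1,3)] by blast
      define f' where "f' = (\<lambda>i. if i < R then f i else Gen 1)"
      have "collision s f' x t \<longleftrightarrow> collision s f x t"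
        by (intro collision_cong walk_cong) (use t in \<open>auto simp: f'_def\<close>)
      moreover have "f' \<in> F" using f(2) by (auto simp: F_def PiE_dflt_def f'_def L seq_on_def)
      ultimately show "(s, x) \<in> (\<Union>f\<in>F. \<Union>t\<in>{..<R}. D n f t)"
        using s t by (auto simp: D_def)
    qed
    hence "card {(s, x) \<in> perm_tuples k n \<times> {1..n}. \<not> tree_like k R s x}
        \<le> card (\<Union>f\<in>F. \<Union>t\<in>{..<R}. D n f t)"
      using finF finD by (intro card_mono) auto
    also have "\<dots> \<le> (\<Sum>f\<in>F. card (\<Union>t\<in>{..<R}. D n f t))" by (rule card_UN_le) fact
    also have "\<dots> \<le> (\<Sum>f\<in>F. \<Sum>t<R. card (D n f t))" by (intro sum_mono card_UN_le) auto
    also have "\<dots> \<le> (\<Sum>f\<in>F. \<Sum>t<R. 2 * Suc t * card (perm_tuples k n))"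
      unfolding D_def by (intro sum_mono card_collision) (auto simp: F_def PiE_dflt_def L)
    finally show ?thesis by (simp only: sum_distrib_right)
  qed
  thus ?thesis by blast
qed

section \<open>Closing an open walk\<close>

declare walk.simps(2) [simp del]

lemma affected_walk:
  "affected s e V (f r) (walk s f x r) \<longleftrightarrow>
    f r = e \<and> walk s f x (Suc r) \<in> V \<or> f r = inv_letter e \<and> walk s f x r \<in> V"
  by (auto simp: affected_def walk.simps(2))

lemma walk_periodic:
  assumes "\<And>t. g (t + P) = g t" "walk s g p P = p"
  shows "walk s g p (t + P) = walk s g p t"
proof -
  have "(\<lambda>i. g (P + i)) = g" using assms(1) by (auto simp: add.commute)
  thus ?thesis using walk_add[of s g p P t] assms(2) by (simp add: add.commute)
qed

lemma walk_periodic_mult: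
  assumes "\<And>t. g (t + P) = g t" "walk s g p P = p"
  shows "walk s g p (t + m * P) = walk s g p t"
proof (induction m)
  case (Suc m)
  have "walk s g p (t + Suc m * P) = walk s g p ((t + m * P) + P)" by (simp add: algebra_simps)
  with Suc show ?case by (simp only: walk_periodic[OF assms])
qed simp

lemma seq_periodic_mult:
  fixes P :: nat
  assumes "\<And>t. g (t + P) = g t" shows "g (t + m * P) = g t"
proof (induction m)
  case (Suc m)
  have "g (t + Suc m * P) = g ((t + m * P) + P)" by (simp add: algebra_simps)
  with Suc show ?case by (simp only: assms)
qed simp

text \<open>
  A closed walk of length \<open>P\<close> along \<open>g\<close>, traversed backwards, reads this periodic sequence.
\<close>
definition reverse_seq :: "nat \<Rightarrow> (nat \<Rightarrow> letter) \<Rightarrow> nat \<Rightarrow> letter" where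
  "reverse_seq P g i = inv_letter (g (P - 1 - i mod P))"

lemma reverse_seq_periodic: "reverse_seq P g (t + P) = reverse_seq P g t"
  by (simp add: reverse_seq_def)

lemma seq_on_reverse_seq: "seq_on k g \<Longrightarrow> seq_on k (reverse_seq P g)"
  by (auto simp: seq_on_def reverse_seq_def)

lemma reduced_reverse_seq:
  assumes "reduced_seq g" "\<And>t. g (t + P) = g t" "0 < P"
  shows "reduced_seq (reverse_seq P g)"
  unfolding reduced_seq_def
proof
  fix t
  have red: "g (Suc i) \<noteq> inv_letter (g i)" for i using assms(1) by (auto simp: reduced_seq_def)
  show "reverse_seq P g (Suc t) \<noteq> inv_letter (reverse_seq P g t)"
  proof (cases "Suc (t mod P) = P")
    case True
    hence "Suc t mod P = 0" by (metis mod_Suc)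
    moreover have "g P = g 0" using assms(2)[of 0] by simp
    ultimately show ?thesis
      using red[of "P - 1"] True assms(3) by (auto simp: reverse_seq_def dest: sym)
  next
    case False
    hence "Suc t mod P = Suc (t mod P)" by (metis mod_Suc)
    moreover have "P - 1 - t mod P = Suc (P - 1 - Suc (t mod P))"
      using False mod_less_divisor[OF assms(3), of t] by linarith
    ultimately show ?thesis
      using red[of "P - 1 - Suc (t mod P)"] by (auto simp: reverse_seq_def)
  qed
qed

lemma walk_reverse_seq:
  assumes "s \<in> perm_tuples k n" "walk s g p P = p" "t \<le> P"
  shows "walk s (reverse_seq P g) p t = walk s g p (P - t)"
proof -
  have "walk s (reverse_seq P g) p t = walk s (\<lambda>i. inv_letter (g (P - 1 - i))) p t"
    using assms(3) by (intro walk_cong) (auto simp: reverse_seq_def)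
  also have "\<dots> = walk s g p (P - t)"
    using walk_back[OF assms(1,3), of g p] assms(2) by simp
  finally show ?thesis .
qed

lemma reduced_seq_append:
  assumes "reduced_seq f" "reduced_seq g" "0 < L" "g 0 \<noteq> inv_letter (f (L - 1))"
  shows "reduced_seq (\<lambda>i. if i < L then f i else g (i - L))"
  unfolding reduced_seq_def
proof
  fix t
  consider "Suc t < L" | "Suc t = L" | "L \<le> t" by linarith
  thus "(if Suc t < L then f (Suc t) else g (Suc t - L)) \<noteq> inv_letter (if t < L then f t else g (t - L))"
    by cases (use assms in \<open>auto simp: reduced_seq_def Suc_diff_le\<close>)
qed

lemma walk_append:
  assumes "walk s f x L = y"
  shows "walk s (\<lambda>i. if i < L then f i else g (i - L)) x (L + t) = walk s g y t"
proof -
  have "walk s (\<lambda>i. if i < L then f i else g (i - L)) x L = y"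
    using assms walk_cong[of L "\<lambda>i. if i < L then f i else g (i - L)" f] by simp
  thus ?thesis by (simp add: walk_add)
qed

text \<open>
  The next two lemmas serve both directions of the closing bijection: \<open>y\<close> is the end point of an open
  walk which is to be closed, or the new end point of a closed walk which is to be opened. That step
  0 is unaffected needs the first letter not to be the inverse of the last one.
\<close>
lemma closing_unaffected:
  assumes "s \<in> perm_tuples k n" "reduced_seq f" "\<And>t. f (t + L) = f t" "0 < L"
    and "inj_on (walk s f x) {..<L}" "y \<notin> walk s f x ` {..<L}" "r < L - 1"
  shows "\<not> affected s (f (L - 1)) {y, x} (f r) (walk s f x r)"
proof
  have r: "Suc r < L" using assms(7) by linarith
  assume "affected s (f (L - 1)) {y, x} (f r) (walk s f x r)"
  then consider "walk s f x (Suc r) \<in> {y, x}"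
    | "f r = inv_letter (f (L - 1))" "walk s f x r \<in> {y, x}"
    by (auto simp: affected_walk)
  thus False
  proof cases
    case 1
    moreover have "walk s f x (Suc r) \<noteq> y" using assms(6) r by blast
    ultimately have "walk s f x (Suc r) = walk s f x 0" by simp
    thus False using inj_onD[OF assms(5), of "Suc r" 0] r by simp
  next
    case 2
    moreover have "walk s f x r \<noteq> y" using assms(6) r by auto
    ultimately have "walk s f x r = walk s f x 0" by simp
    hence "r = 0" using inj_onD[OF assms(5), of r 0] r by simp
    hence "f (Suc (L - 1)) = inv_letter (f (L - 1))" using 2 assms(3)[of 0] assms(4) by simp
    thus False using assms(2) by (auto simp: reduced_seq_def)
  qed
qed

lemma walk_reroute_closing:
  assumes "s \<in> perm_tuples k n" "reduced_seq f" "\<And>t. f (t + L) = f t" "0 < L"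
    and "inj_on (walk s f x) {..<L}" "y \<notin> walk s f x ` {..<L}"
  shows "t < L \<Longrightarrow> walk (reroute s (f (L - 1)) y x) f x t = walk s f x t"
    and "walk (reroute s (f (L - 1)) y x) f x L = Transposition.transpose y x (walk s f x L)"
proof -
  show A: "walk (reroute s (f (L - 1)) y x) f x t = walk s f x t" if "t < L" for t
    using that closing_unaffected[OF assms]
    by (intro walk_reroute_le[OF assms(1), where t = "L - 1"]) auto
  show "walk (reroute s (f (L - 1)) y x) f x L = Transposition.transpose y x (walk s f x L)"
    using A[of "L - 1"] assms(4) letter_perm_reroute[OF assms(1)]
    by (cases L) (auto simp: walk.simps(2))
qed

text \<open>
  An open walk of length \<open>L\<close> from \<open>x\<close> to \<open>y\<close> whose last letter is \<open>e\<close> is closed by rerouting its last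
  step to \<open>x\<close>; \<open>s'\<close> is the new tuple. Only two arrows change. The aim is to determine all short
  closed reduced walks of \<open>s'\<close>.
\<close>
locale closing_walk =
  fixes k n L R :: nat and s :: "nat \<Rightarrow> nat \<Rightarrow> nat" and x :: nat and f :: "nat \<Rightarrow> letter"
  assumes s: "s \<in> perm_tuples k n" and x: "x \<in> {1..n}"
    and f: "reduced_seq f" "seq_on k f" "\<And>t. f (t + L) = f t" and L: "0 < L" "L \<le> R"
    and tree: "tree_like k R s x" "tree_like k R s (walk s f x L)"
begin

definition "y = walk s f x L"
definition "e = f (L - 1)"
definition "s' = reroute s e y x"

lemma inj_x: "reduced_seq g \<Longrightarrow> seq_on k g \<Longrightarrow> inj_on (walk s g x) {..R}"
  using tree(1) by (auto simp: tree_like_def)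

lemma inj_y: "reduced_seq g \<Longrightarrow> seq_on k g \<Longrightarrow> inj_on (walk s g y) {..R}"
  using tree(2) by (auto simp: tree_like_def y_def)

lemma inj_v: "inj_on (walk s f x) {..R}"
  by (intro inj_x f)

lemma s'_in: "s' \<in> perm_tuples k n"
  unfolding s'_def e_def y_def
  using s x f(2) walk_in[OF s, of f x L] by (intro reroute_in_perm_tuples) (blast | simp add: seq_on_def)+

lemma y_notin: "y \<notin> walk s f x ` {..<L}"
proof
  assume "y \<in> walk s f x ` {..<L}"
  then obtain t where "t < L" "walk s f x L = walk s f x t" by (auto simp: y_def)
  thus False using inj_onD[OF inj_v, of L t] L by auto
qed

lemma inj_v_less: "inj_on (walk s f x) {..<L}"
  using inj_v by (rule inj_on_subset) (use L in auto)

lemma closed_s': "walk s' f x L = x" "t < L \<Longrightarrow> walk s' f x t = walk s f x t"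
  using walk_reroute_closing[OF s f(1,3) L(1) inj_v_less y_notin]
  by (auto simp: s'_def e_def y_def)

lemma affected_s'_iff: "affected s' e {y, x} d z \<longleftrightarrow> affected s e {y, x} d z"
  unfolding s'_def by (rule affected_reroute[OF s])

lemma walk_s'_eq:
  assumes "\<And>r. r < t \<Longrightarrow> \<not> affected s' e {y, x} (g r) (walk s' g z r)" "i \<le> t"
  shows "walk s' g z i = walk s g z i"
proof -
  have "walk (reroute s' e y x) g z i = walk s' g z i"
    by (rule walk_reroute_le[OF s'_in, where t = t]) (use assms in auto)
  thus ?thesis by (simp add: s'_def reroute_reroute)
qed

lemma first_affected:
  assumes "affected s' e {y, x} (g t) (walk s' g z t)"
  obtains \<tau> where "\<tau> \<le> t" "affected s e {y, x} (g \<tau>) (walk s g z \<tau>)"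
    "\<And>r. r < \<tau> \<Longrightarrow> \<not> affected s e {y, x} (g r) (walk s g z r)"
proof -
  define \<tau> where "\<tau> = (LEAST t. affected s' e {y, x} (g t) (walk s' g z t))"
  have 1: "affected s' e {y, x} (g \<tau>) (walk s' g z \<tau>)"
    unfolding \<tau>_def using assms by (rule LeastI)
  have 2: "\<not> affected s' e {y, x} (g r) (walk s' g z r)" if "r < \<tau>" for r
    using not_less_Least that unfolding \<tau>_def by blast
  have 3: "walk s' g z r = walk s g z r" if "r \<le> \<tau>" for r
    using walk_s'_eq[OF 2] that by blast
  show ?thesis
  proof (rule that)
    show "\<tau> \<le> t" unfolding \<tau>_def using assms by (rule Least_le)
  qed (use 1 2 3 in \<open>auto simp: affected_s'_iff\<close>)
qed

text \<open>
  A short closed walk of \<open>s\<close> through a changed arrow would pass through \<open>x\<close> or \<open>y\<close>, where \<open>s\<close> has no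
  short closed walks. So closing destroys no short closed walk.
\<close>
lemma closed_unaffected:
  assumes g: "reduced_seq g" "seq_on k g" "\<And>t. g (t + P) = g t" "0 < P" "P \<le> R"
    and "walk s g p P = p"
  shows "\<not> affected s e {y, x} (g t) (walk s g p t)"
proof
  assume "affected s e {y, x} (g t) (walk s g p t)"
  then obtain b where b: "walk s g p b \<in> {y, x}"
    by (auto simp: affected_walk)
  define g' where "g' = (\<lambda>i. g (b + i))"
  have g': "reduced_seq g'" "seq_on k g'" using g by (auto simp: g'_def reduced_seq_def seq_on_def)
  have "walk s g' (walk s g p b) P = walk s g p b"
    using walk_add[of s g p b P] walk_periodic[OF g(3) assms(6), of b] by (simp add: g'_def)
  moreover have "inj_on (walk s g' (walk s g p b)) {..R}"
    using b inj_x[OF g'] inj_y[OF g'] by auto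
  ultimately show False
    using inj_onD[of "walk s g' (walk s g p b)" "{..R}" P 0] g by auto
qed

text \<open>
  The arrow of \<open>s'\<close> that enters \<open>y\<close> starts where \<open>s\<close> has the arrow into \<open>x\<close>. A closed walk of \<open>s'\<close>
  ending with it follows arrows of \<open>s\<close> until it first meets a changed arrow. Appended to the walk from
  \<open>x\<close> to \<open>y\<close>, this piece is a reduced walk of \<open>s\<close> that comes back to \<open>x\<close> or \<open>y\<close>, which is impossible.
\<close>
lemma no_return_to_end:
  assumes g: "reduced_seq g" "seq_on k g" "0 < P" "L + P \<le> R"
    and "g (P - 1) = e" "g 0 \<noteq> inv_letter e" "walk s' g y P = y"
  shows False
proof -
  have "affected s' e {y, x} (g (P - 1)) (walk s' g y (P - 1))"
    unfolding affected_walk using assms by simp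
  from first_affected[OF this] obtain \<tau> where \<tau>: "\<tau> \<le> P - 1" "affected s e {y, x} (g \<tau>) (walk s g y \<tau>)"
    by blast
  define F where "F = (\<lambda>i. if i < L then f i else g (i - L))"
  have "reduced_seq F" unfolding F_def
    using f g L assms by (intro reduced_seq_append) (auto simp: e_def)
  moreover have "seq_on k F" using f g by (auto simp: F_def seq_on_def)
  ultimately have inj: "inj_on (walk s F x) {..R}" by (rule inj_x)
  have w: "walk s F x (L + i) = walk s g y i" for i
    unfolding F_def by (rule walk_append) (simp add: y_def)
  have avoid: "walk s g y i \<notin> {y, x}" if "0 < i" "i \<le> P" for i
  proof -
    have "walk s F x (L + i) \<noteq> walk s F x L" "walk s F x (L + i) \<noteq> walk s F x 0"
      using that g L inj_onD[OF inj, of "L + i" L] inj_onD[OF inj, of "L + i" 0] by auto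
    thus ?thesis using w[of 0] by (simp add: w)
  qed
  have \<tau>P: "Suc \<tau> \<le> P" using \<tau>(1) g(3) by linarith
  show False
  proof (cases "g \<tau> = e")
    case True
    hence "walk s g y (Suc \<tau>) \<in> {y, x}" using \<tau> unfolding affected_walk by auto
    thus False using avoid[of "Suc \<tau>"] \<tau>P by auto
  next
    case False
    hence "g \<tau> = inv_letter e" "walk s g y \<tau> \<in> {y, x}" using \<tau> unfolding affected_walk by auto
    thus False using avoid[of \<tau>] \<tau>P assms by (cases "\<tau> = 0") auto
  qed
qed

text \<open>
  Now consider a closed walk of \<open>s'\<close> that ends with the arrow entering \<open>x\<close>. Until it first meets a
  changed arrow it is a reduced walk of \<open>s\<close>. If it follows \<open>f\<close> up to there, it has gone once around
  the new cycle. If it leaves \<open>f\<close> at time \<open>q\<close>, then going back from \<open>y\<close> to the branching point and on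
  along \<open>g\<close> is a reduced walk of \<open>s\<close>; it never comes back to \<open>y\<close>, nor does the walk along \<open>g\<close> come
  back to \<open>x\<close>, so that no changed arrow is met, a contradiction to the last step.
\<close>
lemma one_turn:
  assumes g: "reduced_seq g" "seq_on k g" "0 < P" "L + P \<le> R"
    and "g (P - 1) = e" "g 0 \<noteq> inv_letter e" "walk s' g x P = x" "t < L"
  shows "g t = f t"
proof -
  have "affected s' e {y, x} (g (P - 1)) (walk s' g x (P - 1))"
    unfolding affected_walk using assms by simp
  from first_affected[OF this] obtain \<tau> where \<tau>: "\<tau> \<le> P - 1" "affected s e {y, x} (g \<tau>) (walk s g x \<tau>)"
    "\<And>r. r < \<tau> \<Longrightarrow> \<not> affected s e {y, x} (g r) (walk s g x r)"
    by blast
  have avoid_x: "walk s g x i \<noteq> x" if "0 < i" "i \<le> P" for i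
    using that g L inj_onD[OF inj_x[OF g(1,2)], of i 0] by auto
  have last: "affected s e {y, x} (g (L - 1)) (walk s g x (L - 1))"
    if "\<And>i. i < L \<Longrightarrow> g i = f i"
  proof -
    have "walk s g x (L - 1) = walk s f x (L - 1)" using that by (intro walk_cong) auto
    moreover have "walk s f x L = letter_perm s (f (L - 1)) (walk s f x (L - 1))"
      using L(1) walk.simps(2)[of s f x "L - 1"] by simp
    ultimately have "letter_perm s e (walk s g x (L - 1)) = y" by (simp add: e_def y_def)
    moreover have "g (L - 1) = e" using that[of "L - 1"] L by (simp add: e_def)
    ultimately show ?thesis unfolding affected_def by blast
  qed
  have \<tau>P: "Suc \<tau> \<le> P" using \<tau>(1) g(3) by linarith
  show ?thesis
  proof (cases "\<forall>i\<le>\<tau>. g i = f i")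
    case True
    have w: "walk s g x i = walk s f x i" if "i \<le> Suc \<tau>" for i
      using True that by (intro walk_cong) auto
    have "\<tau> < L"
    proof (rule ccontr)
      assume "\<not> \<tau> < L"
      hence "L - 1 < \<tau>" "\<And>i. i < L \<Longrightarrow> g i = f i" using True L by auto
      thus False using last \<tau>(3) by blast
    qed
    have "Suc \<tau> = L"
    proof (cases "g \<tau> = e")
      case True
      hence "walk s g x (Suc \<tau>) \<in> {y, x}" using \<tau> unfolding affected_walk by auto
      hence "walk s f x (Suc \<tau>) = walk s f x L"
        using avoid_x[of "Suc \<tau>"] \<tau>P w[of "Suc \<tau>"] by (auto simp: y_def)
      thus ?thesis using inj_onD[OF inj_v, of "Suc \<tau>" L] \<open>\<tau> < L\<close> L by auto
    next
      case False
      hence *: "g \<tau> = inv_letter e" "walk s g x \<tau> \<in> {y, x}" using \<tau> unfolding affected_walk by auto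
      have "\<tau> \<noteq> 0" using * assms(6) by metis
      hence "walk s f x \<tau> = walk s f x L"
        using avoid_x[of \<tau>] \<tau>P w[of \<tau>] * by (auto simp: y_def)
      thus ?thesis using inj_onD[OF inj_v, of "\<tau>" L] \<open>\<tau> < L\<close> L by auto
    qed
    thus ?thesis using True assms(8) by auto
  next
    case False
    define q where "q = (LEAST i. g i \<noteq> f i)"
    from False obtain i0 where i0: "i0 \<le> \<tau>" "g i0 \<noteq> f i0" by auto
    have q: "g q \<noteq> f q" "q \<le> i0" unfolding q_def using i0(2) by (rule LeastI, rule Least_le)
    have qless: "g i = f i" if "i < q" for i using that not_less_Least unfolding q_def by blast
    have q\<tau>: "q \<le> \<tau>" using q(2) i0(1) by linarith
    have "q < L"
    proof (rule ccontr)
      assume "\<not> q < L"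
      hence "L - 1 < \<tau>" "\<And>i. i < L \<Longrightarrow> g i = f i" using qless q i0 L by auto
      thus False using last \<tau>(3) by blast
    qed
    define b where "b = (\<lambda>i. reverse_seq L f i)"
    define g' where "g' = (\<lambda>i. g (q + i))"
    define F where "F = (\<lambda>i. if i < L - q then b i else g' (i - (L - q)))"
    have "inv_letter (b (L - q - 1)) = f q"
      using \<open>q < L\<close> by (simp add: b_def reverse_seq_def)
    hence "reduced_seq F" unfolding F_def
      using q \<open>q < L\<close> f g L
      by (intro reduced_seq_append) (auto simp: b_def g'_def intro: reduced_reverse_seq, auto simp: reduced_seq_def)
    moreover have "seq_on k F"
      using f g seq_on_reverse_seq[of k f L] by (auto simp: F_def b_def g'_def seq_on_def)
    ultimately have inj: "inj_on (walk s F y) {..R}" by (rule inj_y)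
    have "walk s b y (L - q) = walk s f x (L - (L - q))"
    proof -
      have "walk s b y (L - q) = walk s (\<lambda>i. inv_letter (f (L - 1 - i))) (walk s f x L) (L - q)"
        by (auto simp: b_def reverse_seq_def y_def \<open>q < L\<close> intro!: walk_cong)
      also have "\<dots> = walk s f x (L - (L - q))" by (rule walk_back[OF s]) auto
      finally show ?thesis .
    qed
    also have "\<dots> = walk s g x q" using \<open>q < L\<close> qless by (auto intro!: walk_cong)
    finally have b: "walk s b y (L - q) = walk s g x q" .
    have w: "walk s F y (L - q + i) = walk s g x (q + i)" for i
      unfolding F_def using walk_append[OF b, of g' i] walk_add[of s g x q i] by (simp add: g'_def)
    have avoid_y: "walk s g x (q + i) \<noteq> y" if "q + i \<le> P" for i
    proof -
      have "L - q + i \<le> R" "L - q + i \<noteq> 0" using that g(4) \<open>q < L\<close> by linarith+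
      hence "walk s F y (L - q + i) \<noteq> walk s F y 0"
        using inj_onD[OF inj, of "L - q + i" 0] by auto
      thus ?thesis by (simp add: w)
    qed
    show ?thesis
    proof (cases "g \<tau> = e")
      case True
      hence "walk s g x (Suc \<tau>) \<in> {y, x}" using \<tau> unfolding affected_walk by auto
      thus ?thesis using avoid_x[of "Suc \<tau>"] avoid_y[of "Suc \<tau> - q"] \<tau>P q\<tau> by auto
    next
      case False
      hence *: "g \<tau> = inv_letter e" "walk s g x \<tau> \<in> {y, x}" using \<tau> unfolding affected_walk by auto
      have "\<tau> \<noteq> 0" using * assms(6) by metis
      thus ?thesis using avoid_x[of \<tau>] avoid_y[of "\<tau> - q"] \<tau>P q\<tau> * by auto
    qed
  qed
qed

lemma all_turns:
  assumes "reduced_seq g" "seq_on k g" "\<And>t. g (t + P) = g t" "0 < P" "L + P \<le> R"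
    and "g (P - 1) = e" "walk s' g x P = x"
  shows "g t = f t"
  using assms
proof (induction t arbitrary: g rule: less_induct)
  case (less t)
  have g0: "g 0 \<noteq> inv_letter e"
    using less.prems(1) less.prems(3)[of 0] less.prems(4,6) unfolding reduced_seq_def
    by (metis Suc_pred' add_0)
  have one: "g i = f i" if "i < L" for i
    using one_turn[of g P i] less.prems g0 that by blast
  show ?case
  proof (cases "t < L")
    case False
    define g' where "g' = (\<lambda>i. g (L + i))"
    have xL: "walk s' g x L = x"
      using walk_cong[of L g f s' x] one closed_s'(1) by simp
    have "g' (t - L) = f (t - L)"
    proof (rule less.IH)
      show "t - L < t" using False L by simp
      show "reduced_seq g'" "seq_on k g'" 
        using less.prems(1,2) by (auto simp: g'_def reduced_seq_def seq_on_def)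
      show "g' (i + P) = g' i" for i using less.prems(3)[of "L + i"] by (simp add: g'_def add_ac)
      show "g' (P - 1) = e"
        using less.prems(3)[of "L - 1"] one[of "L - 1"] L less.prems(4) by (simp add: g'_def e_def add.commute)
      show "walk s' g' x P = x"
        using walk_add[of s' g x L P] walk_periodic[OF less.prems(3,7), of L] xL
        by (simp add: g'_def)
    qed (use less.prems in auto)
    thus ?thesis using False f(3)[of "t - L"] by (simp add: g'_def)
  qed (use one in auto)
qed

text \<open>
  Rotate the closed walk so that it starts just after the changed arrow.
\<close>
lemma affected_forward:
  assumes g: "reduced_seq g" "seq_on k g" "\<And>t. g (t + P) = g t" "0 < P" "L + P \<le> R"
    and "walk s' g p P = p" "g t = e" "walk s' g p (Suc t) \<in> {y, x}"
  shows "\<exists>b. walk s' g p b = x \<and> (\<forall>t. g (b + t) = f t)"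
proof -
  define z where "z = walk s' g p (Suc t)"
  define g' where "g' = (\<lambda>i. g (Suc t + i))"
  have g': "reduced_seq g'" "seq_on k g'" "\<And>t. g' (t + P) = g' t"
    using g(1,2) g(3)[of "Suc t + i" for i] by (auto simp: g'_def reduced_seq_def seq_on_def add_ac)
  have g'e: "g' (P - 1) = e" using g(3)[of t] g(4) assms(7) by (simp add: g'_def)
  have g'0: "g' 0 \<noteq> inv_letter e" using g(1) assms(7) by (metis g'_def add_0_right reduced_seq_def)
  have z: "walk s' g' z P = z"
    using walk_add[of s' g p "Suc t" P] walk_periodic[OF g(3) assms(6), of "Suc t"]
    by (simp add: g'_def z_def )
  have "z \<noteq> y" using no_return_to_end[OF g'(1,2) g(4,5) g'e g'0] z by auto
  hence "z = x" using assms(8) by (auto simp: z_def)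
  moreover have "g' i = f i" for i
    using all_turns[OF g' g(4,5) g'e] z \<open>z = x\<close> by auto
  ultimately show ?thesis by (auto simp: g'_def z_def)
qed

lemma closed_walk_persists:
  assumes "reduced_seq g" "seq_on k g" "\<And>t. g (t + P) = g t" "0 < P" "P \<le> R" "walk s g p P = p"
  shows "walk (reroute s (f (L - 1)) (walk s f x L) x) g p P = p"
  using walk_reroute[OF s, of P e y x g p] closed_unaffected[OF assms] assms(6)
  by (simp add: e_def y_def)

text \<open>
  A short closed walk of \<open>s'\<close> that was not closed before winds around the new cycle, either forwards
  or backwards: its label, or the reversed inverse of its label, is a shift of \<open>f\<close>.
\<close>
lemma new_closed_walk:
  assumes g: "reduced_seq g" "seq_on k g" "\<And>t. g (t + P) = g t" "0 < P" "L + P \<le> R"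
    and "walk (reroute s (f (L - 1)) (walk s f x L) x) g p P = p" "walk s g p P \<noteq> p"
  shows "(\<exists>b. walk (reroute s (f (L - 1)) (walk s f x L) x) g p b = x \<and> (\<forall>t. g (b + t) = f t)) \<or>
    (\<exists>b. \<forall>t. reverse_seq P g (b + t) = f t)"
proof -
  have s'_eq: "reroute s (f (L - 1)) (walk s f x L) x = s'" by (simp add: s'_def e_def y_def)
  have cl: "walk s' g p P = p" using assms(6) unfolding s'_eq .
  obtain t where t: "t < P" "affected s' e {y, x} (g t) (walk s' g p t)"
    using walk_s'_eq[of P g p P] cl assms(7) by auto
  show ?thesis
  proof (cases "g t = e")
    case True
    hence "walk s' g p (Suc t) \<in> {y, x}" using t unfolding affected_walk by auto
    thus ?thesis using affected_forward[OF g cl True] unfolding s'_eq by blast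
  next
    case False
    hence *: "g t = inv_letter e" "walk s' g p t \<in> {y, x}" using t unfolding affected_walk by auto
    define h where "h = reverse_seq P g"
    have "h (P - 1 - t) = e" using t * by (simp add: h_def reverse_seq_def)
    moreover have "walk s' h p (Suc (P - 1 - t)) = walk s' g p t"
      using walk_reverse_seq[OF s'_in cl, of "P - t"] t by (simp add: h_def Suc_diff_Suc )
    moreover have "walk s' h p P = p" using walk_reverse_seq[OF s'_in cl, of P] by (simp add: h_def)
    ultimately have "\<exists>b. walk s' h p b = x \<and> (\<forall>t. h (b + t) = f t)"
      using g reduced_reverse_seq[OF g(1,3,4)] seq_on_reverse_seq[OF g(2)] * 
      by (intro affected_forward[where P = P]) (auto simp: h_def reverse_seq_periodic)
    thus ?thesis unfolding h_def by blast
  qed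
qed

lemma closing_closed:
  shows "walk (reroute s (f (L - 1)) (walk s f x L) x) f x L = x"
    and "t < L \<Longrightarrow> walk (reroute s (f (L - 1)) (walk s f x L) x) f x t = walk s f x t"
  using closed_s' by (auto simp: s'_def e_def y_def)

end

section \<open>Periodic reading of a word\<close>

text \<open>
  The reversal makes the rightmost letter, which acts first, the first letter of the walk.
\<close>
definition word_seq :: "letter list \<Rightarrow> nat \<Rightarrow> letter" where
  "word_seq w t = rev w ! (t mod length w)"

lemma word_seq_periodic: "word_seq w (t + length w) = word_seq w t"
  by (simp add: word_seq_def)

lemma word_seq_periodic_mult: "word_seq w (t + m * length w) = word_seq w t"
  by (simp add: word_seq_def)

lemma seq_on_word_seq:
  assumes "word_on k w" "w \<noteq> []" shows "seq_on k (word_seq w)"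
proof -
  have "word_seq w t \<in> set w" for t
    using assms(2) nth_mem[of "t mod length w" "rev w"] by (simp add: word_seq_def)
  thus ?thesis using assms(1) by (auto simp: seq_on_def word_on_def)
qed

lemma reduced_word_seq:
  assumes "cyclically_reduced w" "w \<noteq> []" shows "reduced_seq (word_seq w)"
  unfolding reduced_seq_def
proof
  fix t
  define N where "N = length w"
  have N: "0 < N" using assms(2) by (simp add: N_def)
  show "word_seq w (Suc t) \<noteq> inv_letter (word_seq w t)"
  proof (cases "Suc (t mod N) = N")
    case True
    hence "Suc t mod N = 0" by (metis mod_Suc)
    moreover have "t mod N = N - 1" using True by simp
    ultimately have "word_seq w (Suc t) = last w" "word_seq w t = hd w"
      using N assms(2) by (auto simp: word_seq_def N_def rev_nth last_conv_nth hd_conv_nth)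
    thus ?thesis using assms by (auto simp: cyclically_reduced_def)
  next
    case False
    hence m: "Suc t mod N = Suc (t mod N)" by (metis mod_Suc)
    have lt: "Suc (t mod N) < N" using False mod_less_divisor[OF N, of t] by linarith
    define i where "i = N - 1 - Suc (t mod N)"
    have "word_seq w (Suc t) = w ! i" "word_seq w t = w ! Suc i"
      using m lt by (auto simp: word_seq_def rev_nth i_def simp flip: N_def intro!: arg_cong[of _ _ "(!) w"])
    moreover have "w ! Suc i \<noteq> inv_letter (w ! i)"
      using assms(1) lt by (auto simp: cyclically_reduced_def reduced_def successively_conv_nth i_def simp flip: N_def)
    ultimately show ?thesis by auto
  qed
qed

lemma concat_replicate_periodic:
  assumes "length w = q * d" "\<And>i. i + d < length w \<Longrightarrow> w ! (i + d) = w ! i"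
  shows "w = concat (replicate q (take d w))"
  using assms
proof (induction q arbitrary: w)
  case (Suc q)
  show ?case
  proof (cases q)
    case (Suc q')
    have len: "length w = d + q * d" using Suc.prems(1) by simp
    have "drop d w = concat (replicate q (take d (drop d w)))"
      by (rule Suc.IH) (use len Suc.prems(2)[of "d + i" for i] in \<open>auto simp: add_ac\<close>)
    moreover have "take d (drop d w) = take d w"
      by (rule nth_equalityI) (use len Suc Suc.prems(2) in \<open>auto simp: add_ac\<close>)
    ultimately have "take d w @ drop d w = take d w @ concat (replicate q (take d w))" by simp
    thus ?thesis by simp
  qed (use Suc.prems in auto)
qed auto

text \<open>
  If \<open>b\<close> and \<open>|w|\<close> are periods of the periodic reading of \<open>w\<close>, then by Bezout so is their greatest
  common divisor \<open>d\<close>, and \<open>w\<close> is the power of a word of length \<open>d\<close>.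
\<close>
lemma primitive_period:
  assumes "\<not> is_power w" "w \<noteq> []" "\<And>t. word_seq w (b + t) = word_seq w t"
  shows "length w dvd b"
proof (cases "b = 0")
  case False
  define N where "N = length w"
  define d where "d = gcd b N"
  have N: "0 < N" using assms(2) by (simp add: N_def)
  have per_b: "word_seq w (t + b) = word_seq w t" for t using assms(3)[of t] by (simp add: add.commute)
  obtain u v where uv: "b * u = N * v + d" using bezout_nat[OF False] d_def by blast
  have d: "word_seq w (t + d) = word_seq w t" for t
  proof -
    have "word_seq w (t + d) = word_seq w (t + d + v * N)"
      unfolding N_def by (rule word_seq_periodic_mult[symmetric])
    also have "t + d + v * N = t + u * b" using uv by (simp add: mult.commute)
    also have "word_seq w \<dots> = word_seq w t" by (rule seq_periodic_mult) (rule per_b)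
    finally show ?thesis .
  qed
  have dN: "d dvd N" by (simp add: d_def)
  then obtain q where q: "N = q * d" by (metis dvd_def mult.commute)
  have "w = concat (replicate q (take d w))"
  proof (rule concat_replicate_periodic)
    fix i assume i: "i + d < length w"
    have "w ! (i + d) = word_seq w (N - 1 - (i + d))" "w ! i = word_seq w (N - 1 - (i + d) + d)"
      using i by (auto simp: word_seq_def N_def rev_nth)
    thus "w ! (i + d) = w ! i" using d by simp
  qed (use q in \<open>simp add: N_def\<close>)
  hence "\<not> q \<ge> 2" using assms(1) by (auto simp: is_power_def)
  hence "q = 1" using q N by (cases q) auto
  hence "N = d" using q by simp
  thus ?thesis unfolding N_def d_def by (metis gcd_dvd1)
qed simp

text \<open>
  The hypothesis of the negated statement means \<open>f t = inv_letter (f (K - t))\<close> for a suitable \<open>K\<close>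
  and all \<open>t \<le> K\<close>. The centre of this reflection yields a letter that is its own inverse if \<open>K\<close> is
  even, and two adjacent letters that cancel if \<open>K\<close> is odd.
\<close>
lemma not_conjugate_to_inverse:
  assumes "reduced_seq f" "\<And>t. f (t + P) = f t" "0 < P"
  shows "\<not> (\<forall>t. reverse_seq P f (b + t) = f t)"
proof
  assume *: "\<forall>t. reverse_seq P f (b + t) = f t"
  \<comment> \<open>a large multiple of the period, so that no index below becomes negative\<close>
  define X where "X = 2 * Suc b * P"
  define K where "K = X - 1 - b"
  have "2 * Suc b \<le> X" using assms(3) mult_le_mono2[of 1 P "2 * Suc b"] unfolding X_def by simp
  hence KP: "b + 2 \<le> X" by simp
  have rev: "reverse_seq P f (b + t) = inv_letter (f (K - t))" if "t \<le> K" for t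
  proof -
    define m where "m = (b + t) div P"
    have bt: "b + t = m * P + (b + t) mod P" by (simp add: m_def)
    have lt: "b + t < X" using that KP unfolding K_def by linarith
    have "m < 2 * Suc b" using lt by (simp only: m_def X_def less_mult_imp_div_less)
    define m' where "m' = 2 * Suc b - 1 - m"
    have "2 * Suc b = m + m' + 1" using \<open>m < 2 * Suc b\<close> unfolding m'_def by simp
    hence "X = m * P + m' * P + P" unfolding X_def by (metis add_mult_distrib nat_mult_1)
    hence "K - t = (P - 1 - (b + t) mod P) + m' * P"
      using bt mod_less_divisor[OF assms(3), of "b + t"] that unfolding K_def by linarith
    hence "f (K - t) = f (P - 1 - (b + t) mod P)" by (simp add: seq_periodic_mult[of f, OF assms(2)])
    thus ?thesis by (simp add: reverse_seq_def)
  qed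
  show False
  proof (cases "even K")
    case True
    hence "K - K div 2 = K div 2" "K div 2 \<le> K" by auto
    hence "inv_letter (f (K div 2)) = f (K div 2)" using rev[of "K div 2"] * by auto
    thus False by simp
  next
    case False
    hence "K - K div 2 = Suc (K div 2)" "K div 2 \<le> K" by (auto elim: oddE)
    hence "f (K div 2) = inv_letter (f (Suc (K div 2)))" using rev[of "K div 2"] * by auto
    thus False using assms(1) unfolding reduced_seq_def by (metis inv_letter_inv_letter)
  qed
qed

lemma word_perm_Cons: "word_perm s (a # w) = letter_perm s a \<circ> word_perm s w"
  by (simp add: word_perm_def)

lemma walk_rev_word: "walk s (\<lambda>i. rev w ! i) x (length w) = word_perm s w x"
proof (induction w)
  case (Cons a w)
  have "walk s (\<lambda>i. rev (a # w) ! i) x (length w) = walk s (\<lambda>i. rev w ! i) x (length w)"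
    by (rule walk_cong) (auto simp: nth_append)
  thus ?case using Cons by (simp add: walk.simps(2) word_perm_Cons nth_append)
qed (simp add: word_perm_def)

lemma walk_word_seq: "walk s (word_seq w) x (j * length w) = (word_perm s w ^^ j) x"
proof (induction j)
  case (Suc j)
  have "walk s (word_seq w) x (Suc j * length w) =
      walk s (\<lambda>i. word_seq w (j * length w + i)) (walk s (word_seq w) x (j * length w)) (length w)"
    using walk_add[of s "word_seq w" x "j * length w" "length w"] by (simp add: add.commute)
  also have "\<dots> = walk s (\<lambda>i. rev w ! i) (walk s (word_seq w) x (j * length w)) (length w)"
    by (rule walk_cong) (auto simp: word_seq_def)
  finally show ?case using Suc by (simp add: walk_rev_word)
qed simp

lemma word_perm_permutes:
  assumes "s \<in> perm_tuples k n" shows "word_perm s w permutes {1..n}"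
  using letter_perm_permutes[OF assms]
  by (induction w) (auto simp: word_perm_Cons permutes_compose word_perm_def permutes_id)

section \<open>Cycles and points of a given period\<close>
lemma card_orbit_eq_iff:
  assumes "p permutes {1..n::nat}"
  shows "card (orbit p x) = r \<longleftrightarrow> 0 < r \<and> (p ^^ r) x = x \<and> (\<forall>i. 0 < i \<and> i < r \<longrightarrow> (p ^^ i) x \<noteq> x)"
proof -
  have perm: "permutation p" using assms by (intro permutes_imp_permutation[of "{1..n}"]) auto
  hence x: "x \<in> orbit p x" by (rule permutation_self_in_orbit)
  define d where "d = funpow_dist1 p x x"
  have "orbit p x = (\<lambda>m. (p ^^ m) x) ` {0..<d}"
    unfolding d_def by (rule orbit_conv_funpow_dist1[OF x])
  moreover have "inj_on (\<lambda>m. (p ^^ m) x) {0..<d}"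
    unfolding d_def by (rule inj_on_funpow_dist1[OF x])
  ultimately have c: "card (orbit p x) = d" by (simp add: card_image)
  have d1: "(p ^^ d) x = x" unfolding d_def by (rule funpow_dist1_prop[OF x])
  have d2: "(p ^^ i) x \<noteq> x" if "0 < i" "i < d" for i
    using that unfolding d_def by (intro funpow_dist1_least)
  have d3: "0 < d" by (simp add: d_def)
  show ?thesis unfolding c using d1 d2 d3 by (metis linorder_neqE_nat)
qed

lemma orbit_eq_of_mem:
  assumes "p permutes {1..n::nat}" "y \<in> orbit p x"
  shows "orbit p y = orbit p x"
proof -
  have "permutation p" using assms by (intro permutes_imp_permutation[of "{1..n}"]) auto
  thus ?thesis using assms(2) by (metis cyclic_on_orbit' orbit_cyclic_eq3)
qed

definition points_of_period :: "nat \<Rightarrow> nat \<Rightarrow> (nat \<Rightarrow> nat) \<Rightarrow> nat set" where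
  "points_of_period n r p = {x \<in> {1..n}. card (orbit p x) = r}"

lemma card_points_of_period:
  assumes "p permutes {1..n}"
  shows "card (points_of_period n r p) = r * num_cycles n r p"
proof -
  define C where "C = {c \<in> cycles n p. card c = r}"
  have self: "x \<in> orbit p x" for x 
    using assms by (intro permutation_self_in_orbit permutes_imp_permutation[of "{1..n}"]) auto
  have sub: "orbit p x \<subseteq> {1..n}" if "x \<in> {1..n}" for x
    using permutes_orbit_subset[OF assms that] .
  have C: "\<exists>x\<in>{1..n}. c = orbit p x \<and> card c = r" if "c \<in> C" for c
    using that unfolding C_def cycles_def by (elim CollectE conjE imageE) (intro bexI conjI)
  have un: "\<Union>C = points_of_period n r p"
  proof (intro equalityI subsetI)
    fix z assume "z \<in> \<Union>C"
    then obtain c where c: "c \<in> C" "z \<in> c" by (rule UnionE)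
    obtain x where "x \<in> {1..n}" "c = orbit p x" "card c = r" using C[OF c(1)] by (elim bexE conjE)
    thus "z \<in> points_of_period n r p"
      using orbit_eq_of_mem[OF assms, of z x] subsetD[OF sub, of x z] c by (simp add: points_of_period_def)
  next
    fix z assume "z \<in> points_of_period n r p"
    hence "orbit p z \<in> C" by (simp add: points_of_period_def C_def cycles_def)
    thus "z \<in> \<Union>C" using self by (rule UnionI)
  qed
  have "r * card C = card (\<Union>C)"
  proof (rule card_partition)
    show "finite C" by (simp add: C_def cycles_def)
    show "finite (\<Union>C)" unfolding un by (simp add: points_of_period_def)
    show "c1 \<inter> c2 = {}" if "c1 \<in> C" "c2 \<in> C" "c1 \<noteq> c2" for c1 c2
    proof (rule ccontr)
      assume "c1 \<inter> c2 \<noteq> {}"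
      then obtain z where "z \<in> c1" "z \<in> c2" by (metis disjoint_iff)
      moreover from C that obtain x1 x2 where "c1 = orbit p x1" "c2 = orbit p x2" by metis
      ultimately show False using orbit_eq_of_mem[OF assms] that(3) by metis
    qed
  qed (simp add: C_def)
  thus ?thesis unfolding un by (simp add: num_cycles_def C_def)
qed

text \<open>
  The walk from \<open>x\<close> closes up after \<open>L = j * |w|\<close> steps but visits some vertex twice before. Start it
  at the first repeated vertex, so that it begins with a simple cycle of length \<open>c < L\<close>; closing this
  cycle is the first collision. The walk cannot go around this cycle forever: then \<open>c\<close> would be a
  period of \<open>w\<close>, hence a multiple \<open>d * |w|\<close> with \<open>d < j\<close>, and \<open>x\<close> would have period \<open>d\<close>. When the walk
  leaves the cycle it does so along a fresh arrow, and since it has to come back, there is a second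
  collision.
\<close>
lemma two_collisions_of_not_simple:
  assumes s: "s \<in> perm_tuples k n" and w: "cyclically_reduced w" "w \<noteq> []" "\<not> is_power w"
    and j: "card (orbit (word_perm s w) x) = j"
    and not_inj: "\<not> inj_on (walk s (word_seq w) x) {..<j * length w}"
  shows "\<exists>a<j * length w. \<exists>c b. c < b \<and> b < 2 * (j * length w) \<and>
     collision s (\<lambda>i. word_seq w (a + i)) (walk s (word_seq w) x a) c \<and>
     collision s (\<lambda>i. word_seq w (a + i)) (walk s (word_seq w) x a) b"
proof -
  define f where "f = word_seq w"
  define N where "N = length w"
  define L where "L = j * N"
  define v where "v = walk s f x"
  have perm: "word_perm s w permutes {1..n}" by (rule word_perm_permutes[OF s])
  note orb = card_orbit_eq_iff[OF perm, of x j, THEN iffD1, OF j]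
  have N: "0 < N" using w(2) by (simp add: N_def)
  have L: "0 < L" using N orb by (simp add: L_def)
  have red: "reduced_seq f" unfolding f_def by (rule reduced_word_seq[OF w(1,2)])
  have perL: "f (t + L) = f t" for t unfolding f_def L_def N_def by (rule word_seq_periodic_mult)
  have vL: "v L = x" using orb unfolding v_def L_def f_def N_def by (simp add: walk_word_seq)
  have "\<not> inj_on v {..L - 1}"
  proof -
    have "{..<L} = {..L - 1}" using L by auto
    thus ?thesis using not_inj by (simp add: v_def f_def L_def N_def)
  qed
  from not_inj_first_return[OF this] obtain t a where
    t: "t < L - 1" "inj_on v {..t}" "a \<le> t" "v a = v (Suc t)" by auto
  define g where "g = (\<lambda>i. f (a + i))"
  define u where "u = walk s g (v a)"
  define c where "c = Suc t - a"
  have u: "u i = v (a + i)" for i by (simp add: u_def g_def v_def walk_add)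
  have redg: "reduced_seq g" using red by (auto simp: g_def reduced_seq_def)
  have c: "0 < c" "c < L" using t by (auto simp: c_def)
  have aL: "a < L" using t by linarith
  have uc: "u c = u 0" using t by (simp add: u c_def)
  have inj_c: "inj_on u {..<c}"
  proof (rule inj_onI)
    fix i i' assume "i \<in> {..<c}" "i' \<in> {..<c}" "u i = u i'"
    hence "v (a + i) = v (a + i')" "a + i \<le> t" "a + i' \<le> t" by (auto simp: u c_def)
    thus "i = i'" using inj_onD[OF t(2), of "a + i" "a + i'"] by auto
  qed
  have perg: "g (i + m * L) = g i" for i m
    using seq_periodic_mult[of f L "a + i" m, OF perL] by (simp add: g_def add.assoc)
  have per_u: "u (i + m * L) = u i" for i m
    using walk_periodic_mult[of f L s x "a + i" m, OF perL] vL by (simp add: u v_def add.assoc)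
  have coll_c: "collision s g (v a) (c - 1)"
  proof -
    have "{..c - 1} = {..<c}" using c by auto
    hence "fresh s g (v a) (c - 1)"
      using inj_c by (intro inj_fresh redg) (simp add: u_def)
    moreover have "walk s g (v a) (Suc (c - 1)) = u 0" using uc c by (simp add: u_def)
    ultimately show ?thesis by (force simp: collision_def u_def)
  qed
  \<comment> \<open>the first cycle is left within the next \<open>N\<close> steps\<close>
  have "\<exists>q<N. g (c + q) \<noteq> g q"
  proof (rule ccontr)
    assume "\<not> ?thesis"
    hence lessN: "g (c + q) = g q" if "q < N" for q using that by blast
    have gN: "g (i + m * N) = g i" for i m
      using word_seq_periodic_mult[of w "a + i" m] by (simp add: g_def f_def N_def add.assoc)
    have perc: "g (i + c) = g i" for i
    proof -
      have "g (i + c) = g (c + i mod N + (i div N) * N)" by (simp add: algebra_simps)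
      also have "\<dots> = g (i mod N + (i div N) * N)" unfolding gN using N by (intro lessN) auto
      finally show ?thesis by simp
    qed
    have shift: "a + (i + (a * L - a)) = i + a * L" for i
      using L by (cases L) auto
    have "f (c + i) = f i" for i
    proof -
      have "f (i + c + a * L) = f (i + a * L)"
        using perc[of "i + (a * L - a)"] unfolding g_def 
        by (metis (no_types, opaque_lifting) add.assoc add.commute shift)
      thus ?thesis by (simp add: seq_periodic_mult[of f, OF perL] add.commute)
    qed
    hence "N dvd c" unfolding N_def f_def by (intro primitive_period w)
    then obtain d where d: "c = d * N" by (metis dvd_def mult.commute)
    have "u (i + c) = u i" for i
      using walk_periodic[of g c s "v a" i, OF perc] uc by (simp add: u_def)
    from this[of "0 + (a * L - a)"] have "v (a * L + c) = v (a * L)"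
      using shift[of 0] shift[of c] by (simp add: u add_ac)
    hence "v c = v 0"
      using walk_periodic_mult[of f L s x c a, OF perL] walk_periodic_mult[of f L s x 0 a, OF perL] vL
      by (simp add: v_def add_ac)
    hence "(word_perm s w ^^ d) x = x" by (simp add: v_def f_def d N_def walk_word_seq)
    moreover have "0 < d" "d < j" using c d by (auto simp: L_def)
    ultimately show False using orb by blast
  qed
  then obtain q0 where q0: "q0 < N" "g (c + q0) \<noteq> g q0" by blast
  define q where "q = (LEAST i. g (c + i) \<noteq> g i)"
  have q: "g (c + q) \<noteq> g q" "q \<le> q0" unfolding q_def using q0(2) by (rule LeastI, rule Least_le)
  have qless: "g (c + i) = g i" if "i < q" for i using that not_less_Least unfolding q_def by blast
  define D where "D = c + q"
  have "N \<le> L" using orb by (simp add: L_def)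
  hence D: "D < 2 * L" using q q0 c by (simp add: D_def)
  have follow: "u (c + i) = u i" if "i \<le> q" for i
  proof -
    have "u (c + i) = walk s (\<lambda>r. g (c + r)) (u c) i" by (simp add: u_def walk_add)
    also have "\<dots> = walk s g (u c) i" using that qless by (intro walk_cong) auto
    finally show ?thesis using uc by (simp add: u_def)
  qed
  have u_mod: "u r = u (r mod c)" if "r \<le> D" for r
    using that
  proof (induction r rule: less_induct)
    case (less r)
    show ?case
    proof (cases "r < c")
      case False
      hence "u r = u (r - c)" using follow[of "r - c"] less.prems by (simp add: D_def)
      also have "\<dots> = u ((r - c) mod c)" using False c less.prems by (intro less.IH) auto
      finally show ?thesis using False by (simp add: le_mod_geq)
    qed simp
  qed
  have g_mod: "g r = g (r mod c)" if "r < D" for r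
    using that
  proof (induction r rule: less_induct)
    case (less r)
    show ?case
    proof (cases "r < c")
      case False
      hence "g r = g (r - c)" using qless[of "r - c"] less.prems by (simp add: D_def)
      also have "\<dots> = g ((r - c) mod c)" using False c less.prems by (intro less.IH) auto
      finally show ?thesis using False by (simp add: le_mod_geq)
    qed simp
  qed
  have same_mod: "r mod c = r' mod c" if "r \<le> D" "r' \<le> D" "u r = u r'" for r r'
    using inj_onD[OF inj_c, of "r mod c" "r' mod c"] that u_mod[of r] u_mod[of r'] c by auto
  have fresh_D: "fresh s g (v a) D"
    unfolding fresh_def
  proof (intro allI impI conjI notI; elim conjE)
    fix r assume r: "r < D" "g r = g D" "walk s g (v a) r = walk s g (v a) D"
    have "r mod c = D mod c" using r by (intro same_mod) (auto simp: u_def)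
    also have "\<dots> = q mod c" by (simp add: D_def)
    finally have "g r = g q" using g_mod[of r] g_mod[of q] r c by (simp add: D_def)
    thus False using r q by (simp add: D_def)
  next
    fix r assume r: "r < D" "g r = inv_letter (g D)" "walk s g (v a) (Suc r) = walk s g (v a) D"
    have "Suc r mod c = D mod c" using r by (intro same_mod) (auto simp: u_def)
    hence "Suc r mod c = Suc (D - 1) mod c" using c by (simp add: D_def)
    hence "r mod c = (D - 1) mod c" using mod_Suc by (metis Zero_not_Suc diff_Suc_1 mod_Suc)
    hence "g r = g (D - 1)" using g_mod[of r] g_mod[of "D - 1"] r by simp
    moreover have "Suc (D - 1) = D" using r by simp
    ultimately have "g (Suc (D - 1)) = inv_letter (g (D - 1))" using r(2) by (metis inv_letter_inv_letter)
    thus False using redg unfolding reduced_seq_def by blast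
  qed
  \<comment> \<open>From step \<open>D\<close> on, wait for the first return to a visited vertex; it happens by time \<open>2 * L\<close>,
    when the walk is back at its starting point.\<close>
  define Q where "Q = (\<lambda>i. D \<le> i \<and> u (Suc i) \<in> u ` {..i})"
  have "Q (2 * L - 1)"
  proof -
    have "u (2 * L) = u 0" using per_u[of 0 2] by simp
    thus ?thesis using D L by (auto simp: Q_def)
  qed
  define \<tau> where "\<tau> = (LEAST i. Q i)"
  have \<tau>: "Q \<tau>" "\<tau> \<le> 2 * L - 1" unfolding \<tau>_def using \<open>Q (2 * L - 1)\<close> by (rule LeastI, rule Least_le)
  have \<tau>_less: "\<not> Q i" if "i < \<tau>" for i using that not_less_Least unfolding \<tau>_def by blast
  have "fresh s g (v a) \<tau>"
  proof (cases "\<tau> = D")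
    case False
    hence "D \<le> \<tau> - 1" "0 < \<tau>" using \<tau>(1) by (auto simp: Q_def)
    hence new: "u \<tau> \<notin> u ` {..\<tau> - 1}" using \<tau>_less[of "\<tau> - 1"] by (auto simp: Q_def)
    show ?thesis unfolding fresh_def
    proof (intro allI impI conjI notI; elim conjE)
      fix r assume r: "r < \<tau>" "walk s g (v a) r = walk s g (v a) \<tau>"
      hence "r \<in> {..\<tau> - 1}" by simp
      hence "u r \<in> u ` {..\<tau> - 1}" by (rule imageI)
      thus False using new r(2) by (simp add: u_def)
    next
      fix r assume r: "r < \<tau>" "g r = inv_letter (g \<tau>)" "walk s g (v a) (Suc r) = walk s g (v a) \<tau>"
      have "Suc r = \<tau>"
      proof (rule ccontr)
        assume "Suc r \<noteq> \<tau>"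
        hence "Suc r \<in> {..\<tau> - 1}" using r(1) by simp
        hence "u (Suc r) \<in> u ` {..\<tau> - 1}" by (rule imageI)
        thus False using new r(3) by (simp add: u_def)
      qed
      hence "g (Suc r) = inv_letter (g r)" using r by auto
      thus False using redg unfolding reduced_seq_def by blast
    qed
  qed (use fresh_D in simp)
  hence "collision s g (v a) \<tau>" using \<tau>(1) by (auto simp: collision_def Q_def u_def)
  moreover have "c - 1 < \<tau>" using \<tau>(1) c by (auto simp: Q_def D_def)
  moreover have "\<tau> < 2 * L" using \<tau>(2) L by linarith
  ultimately show ?thesis
    using coll_c aL unfolding g_def v_def f_def L_def N_def by blast
qed

lemma walk_const_seq: "walk s (\<lambda>_. Gen i) x r = (s i ^^ r) x"
  by (induction r) (auto simp: walk.simps(2))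

lemma card_orbit_eq_cong:
  assumes "p permutes {1..n::nat}" "p' permutes {1..n}"
    and "\<And>q. 0 < q \<Longrightarrow> q \<le> r \<Longrightarrow> (p ^^ q) x = x \<longleftrightarrow> (p' ^^ q) x = x"
  shows "card (orbit p x) = r \<longleftrightarrow> card (orbit p' x) = r"
  unfolding card_orbit_eq_iff[OF assms(1)] card_orbit_eq_iff[OF assms(2)]
  using assms(3) by auto

section \<open>Effect of closing on the cycle counts\<close>

text \<open>
  Closing the walk that reads \<open>w\<close> exactly \<open>j\<close> times. The radius \<open>R\<close> is large enough for cycles of
  \<open>w(s)\<close> of length at most \<open>l\<close> and for cycles of the single permutations of length at most \<open>M\<close>.
\<close>
locale closing_word =
  fixes k n l M j R :: nat and s :: "nat \<Rightarrow> nat \<Rightarrow> nat" and x :: nat and w :: "letter list"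
  assumes s: "s \<in> perm_tuples k n" and x: "x \<in> {1..n}"
    and w: "word_on k w" "cyclically_reduced w" "w \<noteq> []" "\<not> is_power w"
    and j: "0 < j" and R: "j * length w + l * length w \<le> R" "j * length w + M \<le> R"
    and tree: "tree_like k R s x" "tree_like k R s (walk s (word_seq w) x (j * length w))"
begin

definition "N = length w"
definition "f = word_seq w"
definition "L = j * N"
definition "s' = reroute s (f (L - 1)) (walk s f x L) x"

lemma N: "0 < N" using w by (simp add: N_def)
lemma L: "0 < L" "L \<le> R" using N j R by (auto simp: L_def N_def)
lemma f: "reduced_seq f" "seq_on k f" "f (t + N) = f t" "f (t + m * N) = f t"
  using w by (auto simp: f_def N_def reduced_word_seq seq_on_word_seq word_seq_periodic word_seq_periodic_mult)
lemma fL: "f (t + L) = f t" unfolding L_def by (rule f)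
lemma tree': "tree_like k R s x" "tree_like k R s (walk s f x L)"
  using tree by (auto simp: f_def L_def N_def)

lemma closing_walk: "closing_walk k n L R s x f"
  using s x f fL L tree' by unfold_locales

lemma s'_in: "s' \<in> perm_tuples k n"
  unfolding s'_def using s x f(2) walk_in[OF s, of f x L] 
  by (intro reroute_in_perm_tuples) (blast | simp add: seq_on_def)+

lemma walk_pow: "walk t f p (r * N) = (word_perm t w ^^ r) p"
  unfolding f_def N_def by (rule walk_word_seq)

lemma inj_v: "inj_on (walk s f x) {..R}"
  using tree'(1) f by (auto simp: tree_like_def)

lemma closed: "walk s' f x L = x" "t < L \<Longrightarrow> walk s' f x t = walk s f x t"
  unfolding s'_def using closing_walk.closing_closed[OF closing_walk] by blast+

definition "Orb = orbit (word_perm s' w) x"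

lemma perms: "word_perm s w permutes {1..n}" "word_perm s' w permutes {1..n}"
  using s s'_in by (simp_all only: word_perm_permutes)

lemma card_O: "card Orb = j"
  unfolding Orb_def card_orbit_eq_iff[OF perms(2)]
proof (intro conjI allI impI)
  show "(word_perm s' w ^^ j) x = x" using closed(1) by (simp add: L_def walk_pow)
  fix i assume i: "0 < i \<and> i < j"
  hence iL: "0 < i * N" "i * N < L" using N by (auto simp: L_def)
  show "(word_perm s' w ^^ i) x \<noteq> x"
  proof
    assume "(word_perm s' w ^^ i) x = x"
    hence "walk s f x (i * N) = walk s f x 0" using closed(2)[OF iL(2)] by (simp add: walk_pow)
    thus False using inj_onD[OF inj_v, of "i * N" 0] iL L by simp
  qed
qed (rule j)

lemma O_memD:
  assumes "p \<in> Orb" shows "\<exists>c<j. p = walk s f x (c * N)"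
proof -
  have "(word_perm s' w ^^ j) x = x" using closed(1) by (simp add: L_def walk_pow)
  from assms obtain m where m: "p = (word_perm s' w ^^ m) x" by (auto simp: Orb_def orbit_altdef)
  have "p = walk s' f x (m * N)" using m by (simp add: walk_pow)
  also have "m * N = (m mod j) * N + (m div j) * L"
    by (simp add: L_def mult.assoc[symmetric] flip: distrib_right)
  also have "walk s' f x \<dots> = walk s' f x ((m mod j) * N)"
    by (rule walk_periodic_mult[OF fL closed(1)])
  also have "\<dots> = walk s f x ((m mod j) * N)"
    using j N by (intro closed(2)) (simp add: L_def)
  finally show ?thesis using j by (intro exI[of _ "m mod j"]) simp
qed

lemma O_not_fixed:
  assumes "p \<in> Orb" "0 < r" "r \<le> l" shows "(word_perm s w ^^ r) p \<noteq> p"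
proof
  assume *: "(word_perm s w ^^ r) p = p"
  obtain c where c: "c < j" "p = walk s f x (c * N)" using O_memD[OF assms(1)] by blast
  have "walk s f x (c * N + r * N) = walk s f p (r * N)"
    unfolding walk_add c(2) using f(4)[of i c for i] by (simp add: add.commute)
  also have "\<dots> = walk s f x (c * N)" using * c by (simp add: walk_pow)
  finally have eq: "walk s f x (c * N + r * N) = walk s f x (c * N)" .
  have "c * N \<le> j * N" "r * N \<le> l * N" using c assms by auto
  hence "c * N + r * N \<le> R" using R(1) unfolding N_def by linarith
  thus False using inj_onD[OF inj_v eq] N assms by simp
qed

text \<open>
  A new fixed point of the power \<open>r\<close> belongs to a closed walk winding around the new cycle. It does not
  run backwards because \<open>w\<close> is not conjugate to its inverse, and because \<open>w\<close> is no proper power it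
  meets \<open>x\<close> after reading \<open>w\<close> a whole number of times, so the point lies on the new cycle.
\<close>
lemma fixed_iff:
  assumes "0 < r" "r \<le> l" "p \<notin> Orb"
  shows "(word_perm s' w ^^ r) p = p \<longleftrightarrow> (word_perm s w ^^ r) p = p"
proof
  have "r * N \<le> l * N" using assms(2) by (rule mult_le_mono1)
  hence rN: "0 < r * N" "r * N \<le> R" "L + r * N \<le> R"
    using assms(1) N R(1) unfolding L_def N_def by (simp, linarith, linarith)
  note g = f(1,2) f(4)[where m = r] rN(1)
  show "(word_perm s' w ^^ r) p = p" if "(word_perm s w ^^ r) p = p"
    using closing_walk.closed_walk_persists[OF closing_walk g rN(2), of p] that
    by (simp only: walk_pow s'_def[symmetric])
  show "(word_perm s w ^^ r) p = p" if *: "(word_perm s' w ^^ r) p = p"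
  proof (rule ccontr)
    assume "(word_perm s w ^^ r) p \<noteq> p"
    hence "(\<exists>b. walk s' f p b = x \<and> (\<forall>t. f (b + t) = f t)) \<or>
        (\<exists>b. \<forall>t. reverse_seq (r * N) f (b + t) = f t)"
      using closing_walk.new_closed_walk[OF closing_walk g rN(3), of p] *
      by (simp only: walk_pow s'_def[symmetric]) simp
    moreover have "\<not> (\<forall>t. reverse_seq (r * N) f (b + t) = f t)" for b
      by (rule not_conjugate_to_inverse[OF g(1,3,4)])
    ultimately obtain b where b: "walk s' f p b = x" "\<forall>t. f (b + t) = f t" by blast
    hence "N dvd b" using primitive_period[OF w(4,3), of b] by (simp add: f_def N_def)
    then obtain d where "b = d * N" by (metis dvd_def mult.commute)
    hence x_eq: "x = (word_perm s' w ^^ d) p" using b by (simp add: walk_pow)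
    have perm: "permutation (word_perm s' w)"
      using perms(2) by (intro permutes_imp_permutation[of "{1..n}"]) auto
    have "p \<in> orbit (word_perm s' w) p" by (rule permutation_self_in_orbit[OF perm])
    hence "(word_perm s' w ^^ d) p \<in> orbit (word_perm s' w) p" by (rule funpow_in_orbit)
    hence "x \<in> orbit (word_perm s' w) p" by (simp only: x_eq[symmetric])
    hence "orbit (word_perm s' w) x = orbit (word_perm s' w) p"
      by (rule orbit_eq_of_mem[OF perms(2)])
    thus False using assms(3) permutation_self_in_orbit[OF perm, of p] by (simp add: Orb_def)
  qed
qed

lemma period_iff:
  assumes "0 < r" "r \<le> l"
  shows "card (orbit (word_perm s' w) p) = r \<longleftrightarrow>
    card (orbit (word_perm s w) p) = r \<or> (r = j \<and> p \<in> Orb)"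
proof (cases "p \<in> Orb")
  case True
  hence "orbit (word_perm s' w) p = Orb" unfolding Orb_def by (rule orbit_eq_of_mem[OF perms(2)])
  moreover have "card (orbit (word_perm s w) p) \<noteq> r"
    using O_not_fixed[OF True assms] by (auto simp: card_orbit_eq_iff[OF perms(1)])
  ultimately show ?thesis using card_O True by auto
next
  case False
  have "card (orbit (word_perm s' w) p) = r \<longleftrightarrow> card (orbit (word_perm s w) p) = r"
    by (rule card_orbit_eq_cong[OF perms(2,1)]) (use fixed_iff[OF _ _ False] assms in auto)
  thus ?thesis using False by blast
qed

lemma num_cycles_closing:
  assumes "0 < r" "r \<le> l"
  shows "num_cycles n r (word_perm (reroute s (word_seq w (j * length w - 1))
      (walk s (word_seq w) x (j * length w)) x) w) =
    num_cycles n r (word_perm s w) + (if r = j then 1 else 0)"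
proof -
  have Osub: "Orb \<subseteq> {1..n}" unfolding Orb_def by (rule permutes_orbit_subset[OF perms(2) x])
  have eq: "points_of_period n r (word_perm s' w) =
      points_of_period n r (word_perm s w) \<union> (if r = j then Orb else {})"
    using Osub by (auto simp: points_of_period_def period_iff[OF assms])
  have "points_of_period n r (word_perm s w) \<inter> Orb = {}"
    using O_not_fixed[OF _ assms] by (auto simp: points_of_period_def card_orbit_eq_iff[OF perms(1)])
  hence "card (points_of_period n r (word_perm s' w)) =
      card (points_of_period n r (word_perm s w)) + (if r = j then r else 0)"
    unfolding eq using Osub card_O finite_subset[OF Osub]
    by (auto simp: points_of_period_def card_Un_disjoint)
  hence "r * num_cycles n r (word_perm s' w) = r * (num_cycles n r (word_perm s w) + (if r = j then 1 else 0))"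
    by (simp add: card_points_of_period[OF perms(1)] card_points_of_period[OF perms(2)])
  hence "num_cycles n r (word_perm s' w) = num_cycles n r (word_perm s w) + (if r = j then 1 else 0)"
    using assms by (simp only: mult_cancel1) simp
  thus ?thesis by (simp add: s'_def f_def L_def N_def)
qed

text \<open>
  A new short cycle of \<open>s i\<close> would make all letters of the periodic reading of \<open>w\<close> equal.
\<close>
lemma num_cycles_closing_generator:
  assumes "0 < r" "r \<le> M" "i \<in> {1..k}" "length w \<ge> 2"
  shows "num_cycles n r (reroute s (word_seq w (j * length w - 1))
      (walk s (word_seq w) x (j * length w)) x i) = num_cycles n r (s i)"
proof -
  have pi: "t i permutes {1..n}" if "t \<in> perm_tuples k n" for t
    using that by (rule perm_tuples_permutes)
  have iff: "(s' i ^^ q) p = p \<longleftrightarrow> (s i ^^ q) p = p" if q: "0 < q" "q \<le> M" for q p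
  proof
    define g where "g = (\<lambda>_::nat. Gen i)"
    have g: "reduced_seq g" "seq_on k g" "g (t + q) = g t" for t
      using assms(3) by (auto simp: g_def reduced_seq_def seq_on_def)
    have wg: "walk t g p q = (t i ^^ q) p" for t unfolding g_def by (rule walk_const_seq)
    have qR: "q \<le> R" "L + q \<le> R" using q R by (auto simp: L_def N_def)
    show "(s' i ^^ q) p = p" if "(s i ^^ q) p = p"
      using closing_walk.closed_walk_persists[OF closing_walk g q(1) qR(1), of p] that
      by (simp only: wg s'_def[symmetric])
    have nc: "\<not> (\<forall>t. f t = c)" for c
    proof
      assume "\<forall>t. f t = c"
      hence "N dvd 1" using primitive_period[OF w(4,3), of 1] by (simp add: f_def N_def)
      thus False using assms(4) by (simp add: N_def)
    qed
    show "(s i ^^ q) p = p" if *: "(s' i ^^ q) p = p"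
    proof (rule ccontr)
      assume "(s i ^^ q) p \<noteq> p"
      hence "(\<exists>b. walk s' g p b = x \<and> (\<forall>t. g (b + t) = f t)) \<or>
          (\<exists>b. \<forall>t. reverse_seq q g (b + t) = f t)"
        using closing_walk.new_closed_walk[OF closing_walk g q(1) qR(2), of p] *
        by (simp only: wg s'_def[symmetric]) simp
      moreover have "reverse_seq q g t = InvGen i" for t by (simp add: g_def reverse_seq_def)
      ultimately have "(\<exists>b. \<forall>t. Gen i = f t) \<or> (\<exists>b. \<forall>t. InvGen i = f t)"
        by (auto simp: g_def)
      thus False using nc by metis
    qed
  qed
  have "card (orbit (s' i) p) = r \<longleftrightarrow> card (orbit (s i) p) = r" for p
    by (rule card_orbit_eq_cong[OF pi[OF s'_in] pi[OF s]]) (use iff assms in auto)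
  hence "points_of_period n r (s' i) = points_of_period n r (s i)"
    by (simp add: points_of_period_def)
  hence "r * num_cycles n r (s' i) = r * num_cycles n r (s i)"
    by (simp flip: card_points_of_period[OF pi[OF s]] card_points_of_period[OF pi[OF s'_in]])
  thus ?thesis using assms by (simp add: s'_def f_def L_def N_def)
qed

end

section \<open>Counting open and closed walks\<close>
lemma card_le_card_add:
  assumes "finite B" "A \<subseteq> B \<union> C" "finite C"
  shows "card A \<le> card B + card C"
  using card_mono[of "B \<union> C" A] card_Un_le[of B C] assms by simp

definition open_pairs ::
    "nat \<Rightarrow> nat \<Rightarrow> (nat \<Rightarrow> letter) \<Rightarrow> nat \<Rightarrow> ((nat \<Rightarrow> nat \<Rightarrow> nat) \<times> nat) set" where
  "open_pairs k n f L = {(s, x) \<in> perm_tuples k n \<times> {1..n}. inj_on (walk s f x) {..L}}"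

definition closed_pairs ::
    "nat \<Rightarrow> nat \<Rightarrow> (nat \<Rightarrow> letter) \<Rightarrow> nat \<Rightarrow> ((nat \<Rightarrow> nat \<Rightarrow> nat) \<times> nat) set" where
  "closed_pairs k n f L = {(s, x) \<in> perm_tuples k n \<times> {1..n}.
     inj_on (walk s f x) {..<L} \<and> walk s f x L = x}"

definition close_up :: "(nat \<Rightarrow> letter) \<Rightarrow> nat \<Rightarrow>
    (nat \<Rightarrow> nat \<Rightarrow> nat) \<times> nat \<Rightarrow> ((nat \<Rightarrow> nat \<Rightarrow> nat) \<times> nat) \<times> nat" where
  "close_up f L = (\<lambda>(s, x). ((reroute s (f (L - 1)) (walk s f x L) x, x), walk s f x L))"

lemma finite_pairs [simp]: "finite {(s, x) \<in> perm_tuples k n \<times> {1..n}. P s x}"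
  by (rule finite_subset[of _ "perm_tuples k n \<times> {1..n}"]) auto

lemma bij_betw_close_up:
  assumes f: "reduced_seq f" "seq_on k f" "\<And>t. f (t + L) = f t" and L: "0 < L"
  shows "bij_betw (close_up f L) (open_pairs k n f L)
    (SIGMA p:closed_pairs k n f L. {1..n} - walk (fst p) f (snd p) ` {..<L})"
proof (rule bij_betw_byWitness[where f' = "\<lambda>((s, x), y). (reroute s (f (L - 1)) y x, x)"])
  have gen: "gen_index (f (L - 1)) \<in> {1..k}" using f(2) by (auto simp: seq_on_def)
  have op: "walk s f x L \<in> {1..n}" "inj_on (walk s f x) {..<L}" "walk s f x L \<notin> walk s f x ` {..<L}"
    if "s \<in> perm_tuples k n" "x \<in> {1..n}" "inj_on (walk s f x) {..L}" for s x
  proof -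
    show "walk s f x L \<in> {1..n}" using walk_in[OF that(1)] that(2) by blast
    show "inj_on (walk s f x) {..<L}" by (rule inj_on_subset[OF that(3)]) auto
    show "walk s f x L \<notin> walk s f x ` {..<L}"
    proof
      assume "walk s f x L \<in> walk s f x ` {..<L}"
      then obtain t where "t < L" "walk s f x L = walk s f x t" by auto
      thus False using inj_onD[OF that(3), of L t] by auto
    qed
  qed
  show "\<forall>p\<in>open_pairs k n f L. (\<lambda>((s, x), y). (reroute s (f (L - 1)) y x, x)) (close_up f L p) = p"
    by (auto simp: close_up_def reroute_reroute)
  show "close_up f L ` open_pairs k n f L
      \<subseteq> (SIGMA p:closed_pairs k n f L. {1..n} - walk (fst p) f (snd p) ` {..<L})"
  proof (rule image_subsetI)
    fix p assume "p \<in> open_pairs k n f L"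
    then obtain s x where p: "p = (s, x)" and
      sx: "s \<in> perm_tuples k n" "x \<in> {1..n}" "inj_on (walk s f x) {..L}"
      by (auto simp: open_pairs_def)
    note o = op[OF sx]
    define s' where "s' = reroute s (f (L - 1)) (walk s f x L) x"
    have s': "s' \<in> perm_tuples k n"
      unfolding s'_def using sx o gen by (intro reroute_in_perm_tuples)
    have w: "walk s' f x t = walk s f x t" if "t < L" for t
      unfolding s'_def by (rule walk_reroute_closing(1)[OF sx(1) f(1,3) L o(2,3) that])
    have wL: "walk s' f x L = x"
      using walk_reroute_closing(2)[OF sx(1) f(1,3) L o(2,3)] by (simp add: s'_def)
    have "inj_on (walk s' f x) {..<L}" using o(2) w by (simp add: inj_on_def)
    moreover have "walk s' f x ` {..<L} = walk s f x ` {..<L}" using w by (intro image_cong) auto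
    ultimately show "close_up f L p
      \<in> (SIGMA p:closed_pairs k n f L. {1..n} - walk (fst p) f (snd p) ` {..<L})"
      using s' sx o wL by (auto simp: closed_pairs_def close_up_def p s'_def)
  qed
  have cl: "reroute s (f (L - 1)) y x \<in> perm_tuples k n \<and> walk (reroute s (f (L - 1)) y x) f x L = y
     \<and> inj_on (walk (reroute s (f (L - 1)) y x) f x) {..L}"
    if "s \<in> perm_tuples k n" "x \<in> {1..n}" "inj_on (walk s f x) {..<L}" "walk s f x L = x"
      "y \<in> {1..n}" "y \<notin> walk s f x ` {..<L}" for s x y
  proof -
    define s' where "s' = reroute s (f (L - 1)) y x"
    have s': "s' \<in> perm_tuples k n"
      unfolding s'_def using that gen by (intro reroute_in_perm_tuples)
    have w: "walk s' f x t = walk s f x t" if "t < L" for t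
      unfolding s'_def by (rule walk_reroute_closing(1)[OF \<open>s \<in> _\<close> f(1,3) L \<open>inj_on _ _\<close> \<open>y \<notin> _\<close> that])
    have wL: "walk s' f x L = y"
      using walk_reroute_closing(2)[OF that(1) f(1,3) L that(3,6)] that(4) by (simp add: s'_def)
    have "inj_on (walk s' f x) {..<L}" using that(3) w by (simp add: inj_on_def)
    moreover have "walk s' f x L \<notin> walk s' f x ` {..<L}"
      using that(6) w wL by (auto simp: image_iff)
    moreover have "{..L} = insert L {..<L}" by auto
    ultimately have "inj_on (walk s' f x) {..L}" by simp
    thus ?thesis using s' wL by (simp add: s'_def)
  qed
  show "\<forall>q\<in>SIGMA p:closed_pairs k n f L. {1..n} - walk (fst p) f (snd p) ` {..<L}.
      close_up f L ((\<lambda>((s, x), y). (reroute s (f (L - 1)) y x, x)) q) = q"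
    using cl by (auto simp: close_up_def closed_pairs_def reroute_reroute)
  show "(\<lambda>((s, x), y). (reroute s (f (L - 1)) y x, x)) `
      (SIGMA p:closed_pairs k n f L. {1..n} - walk (fst p) f (snd p) ` {..<L}) \<subseteq> open_pairs k n f L"
    using cl by (auto simp: open_pairs_def closed_pairs_def)
qed

text \<open>
  Each simple closed walk of length \<open>L\<close> arises from exactly \<open>n - L\<close> open ones. Being a bijection,
  closing also preserves counts under any condition \<open>Q\<close> on the closed pair.
\<close>
lemma card_close_up:
  assumes f: "reduced_seq f" "seq_on k f" "\<And>t. f (t + L) = f t" and L: "0 < L"
  shows "card {p \<in> open_pairs k n f L. Q (fst (close_up f L p))} =
    (n - L) * card {p \<in> closed_pairs k n f L. Q p}"
proof -
  define T where "T p = {1..n} - walk (fst p) f (snd p) ` {..<L}" for p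
  have bij: "bij_betw (close_up f L) (open_pairs k n f L) (SIGMA p:closed_pairs k n f L. T p)"
    unfolding T_def by (rule bij_betw_close_up[OF assms])
  have "bij_betw (close_up f L) {p \<in> open_pairs k n f L. Q (fst (close_up f L p))}
      (SIGMA p:{p \<in> closed_pairs k n f L. Q p}. T p)"
  proof (rule bij_betw_subset[OF bij])
    have "close_up f L ` {p \<in> open_pairs k n f L. Q (fst (close_up f L p))}
      = {q \<in> close_up f L ` open_pairs k n f L. Q (fst q)}" by auto
    also have "\<dots> = (SIGMA p:{p \<in> closed_pairs k n f L. Q p}. T p)"
      unfolding bij_betw_imp_surj_on[OF bij] by auto
    finally show "close_up f L ` {p \<in> open_pairs k n f L. Q (fst (close_up f L p))} =
      (SIGMA p:{p \<in> closed_pairs k n f L. Q p}. T p)" .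
  qed auto
  hence "card {p \<in> open_pairs k n f L. Q (fst (close_up f L p))} =
      card (SIGMA p:{p \<in> closed_pairs k n f L. Q p}. T p)" by (rule bij_betw_same_card)
  also have "\<dots> = (\<Sum>p\<in>{p \<in> closed_pairs k n f L. Q p}. card (T p))"
    by (rule card_SigmaI) (auto simp: closed_pairs_def T_def intro: finite_subset[OF _ finite_pairs])
  also have "\<dots> = (\<Sum>p\<in>{p \<in> closed_pairs k n f L. Q p}. n - L)"
  proof (rule sum.cong)
    fix p assume "p \<in> {p \<in> closed_pairs k n f L. Q p}"
    then obtain s x where p: "p = (s, x)" "s \<in> perm_tuples k n" "x \<in> {1..n}" "inj_on (walk s f x) {..<L}"
      by (auto simp: closed_pairs_def)
    have "walk s f x ` {..<L} \<subseteq> {1..n}" using walk_in[OF p(2)] p(3) by blast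
    moreover have "card (walk s f x ` {..<L}) = L" using p(4) by (simp add: card_image)
    ultimately show "card (T p) = n - L" by (simp add: T_def p(1) card_Diff_subset)
  qed simp
  finally show ?thesis by simp
qed

lemma card_period_not_simple:
  assumes w: "word_on k w" "cyclically_reduced w" "w \<noteq> []" "\<not> is_power w"
  shows "\<exists>C. \<forall>n. card {(s, x) \<in> perm_tuples k n \<times> {1..n}. card (orbit (word_perm s w) x) = j \<and>
       \<not> inj_on (walk s (word_seq w) x) {..<j * length w}} * n \<le> C * card (perm_tuples k n)"
proof -
  define L where "L = j * length w"
  define D where "D n = {(s, x) \<in> perm_tuples k n \<times> {1..n}. card (orbit (word_perm s w) x) = j \<and>
       \<not> inj_on (walk s (word_seq w) x) {..<j * length w}}" for n
  define g where "g a = (\<lambda>i. word_seq w (a + i))" for a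
  define E where "E n a c b = {(s, x) \<in> perm_tuples k n \<times> {1..n}. collision s (g a) x c \<and> collision s (g a) x b}"
    for n a c b
  define E' where "E' n a c b = {(s, x) \<in> perm_tuples k n \<times> {1..n}.
     (s, walk s (word_seq w) x a) \<in> E n a c b}" for n a c b
  define I where "I = {(a, c, b). a < L \<and> c < b \<and> b < 2 * L}"
  have finI: "finite I" 
    by (rule finite_subset[of _ "{..<L} \<times> {..<2 * L} \<times> {..<2 * L}"]) (auto simp: I_def)
  have "card (D n) * n \<le> (\<Sum>(a, c, b)\<in>I. 4 * Suc c * Suc b) * card (perm_tuples k n)" for n
  proof -
    have sub: "D n \<subseteq> (\<Union>(a, c, b)\<in>I. E' n a c b)"
    proof (clarsimp simp only: D_def)
      fix s x assume s: "s \<in> perm_tuples k n" "x \<in> {1..n}" "j = card (orbit (word_perm s w) x)"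
        "\<not> inj_on (walk s (word_seq w) x) {..<card (orbit (word_perm s w) x) * length w}"
      obtain a c b where "a < L" "c < b" "b < 2 * L"
        "collision s (g a) (walk s (word_seq w) x a) c" "collision s (g a) (walk s (word_seq w) x a) b"
        using two_collisions_of_not_simple[OF s(1) w(2-4) refl s(4)] s(3) unfolding L_def g_def by blast
      moreover have "walk s (word_seq w) x a \<in> {1..n}" using walk_in[OF s(1)] s(2) by blast
      ultimately have "(s, x) \<in> E' n a c b" "(a, c, b) \<in> I" using s by (auto simp: E_def E'_def I_def)
      thus "(s, x) \<in> (\<Union>(a, c, b)\<in>I. E' n a c b)" by blast
    qed
    have finE: "finite (E n a c b)" "finite (E' n a c b)" for a c b
      unfolding E_def E'_def by (rule finite_pairs)+
    have E'E: "card (E' n a c b) \<le> card (E n a c b)" for a c b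
    proof (rule card_inj_on_le[where f = "\<lambda>(s, x). (s, walk s (word_seq w) x a)"])
      show "inj_on (\<lambda>(s, x). (s, walk s (word_seq w) x a)) (E' n a c b)"
        by (rule inj_onI) (auto simp: E'_def dest: bij_is_inj[OF bij_walk, THEN injD])
    qed (use finE in \<open>auto simp: E'_def\<close>)
    have "card (D n) \<le> card (\<Union>(a, c, b)\<in>I. E' n a c b)"
      using sub finI finE by (intro card_mono) auto
    also have "\<dots> \<le> (\<Sum>(a, c, b)\<in>I. card (E' n a c b))"
      using card_UN_le[OF finI, of "\<lambda>(a, c, b). E' n a c b"] by (simp add: case_prod_unfold)
    also have "\<dots> \<le> (\<Sum>(a, c, b)\<in>I. card (E n a c b))"
      using E'E by (intro sum_mono) auto
    finally have "card (D n) * n \<le> (\<Sum>(a, c, b)\<in>I. card (E n a c b)) * n" by simp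
    also have "\<dots> = (\<Sum>(a, c, b)\<in>I. card (E n a c b) * n)"
      by (simp add: sum_distrib_right case_prod_unfold)
    also have "\<dots> \<le> (\<Sum>(a, c, b)\<in>I. 4 * Suc c * Suc b * card (perm_tuples k n))"
    proof (rule sum_mono, clarify)
      fix a c b assume "(a, c, b) \<in> I"
      thus "card (E n a c b) * n \<le> 4 * Suc c * Suc b * card (perm_tuples k n)"
        unfolding E_def using seq_on_word_seq[OF w(1,3)]
        by (intro card_two_collisions) (auto simp: I_def g_def seq_on_def)
    qed
    finally show ?thesis by (simp only: sum_distrib_right case_prod_unfold)
  qed
  thus ?thesis unfolding D_def by blast
qed

text \<open>
  A point on a short cycle of \<open>w(s)\<close> has no tree-like neighbourhood, so the expected number of such
  cycles is bounded.
\<close>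
lemma card_period_le:
  assumes w: "word_on k w" "cyclically_reduced w" "w \<noteq> []"
  shows "\<exists>C. \<forall>n. (\<Sum>s\<in>perm_tuples k n. num_cycles n j (word_perm s w)) \<le> C * card (perm_tuples k n)"
proof (cases "j = 0")
  case True
  have "num_cycles n 0 (word_perm s w) = 0" if "s \<in> perm_tuples k n" for n s
  proof -
    have "card c \<noteq> 0" if c: "c \<in> cycles n (word_perm s w)" for c
      using c card_orbit_eq_iff[OF word_perm_permutes[OF \<open>s \<in> _\<close>], of w _ 0] by (auto simp: cycles_def)
    hence "{c \<in> cycles n (word_perm s w). card c = 0} = {}" by blast
    thus ?thesis by (simp only: num_cycles_def card.empty)
  qed
  thus ?thesis using True by auto
next
  case False
  define L where "L = j * length w"
  obtain C where C: "\<And>n. card {(s, x) \<in> perm_tuples k n \<times> {1..n}. \<not> tree_like k L s x} \<le> C * card (perm_tuples k n)"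
    using card_not_tree_like[of k L] by blast
  have "(\<Sum>s\<in>perm_tuples k n. num_cycles n j (word_perm s w)) \<le> C * card (perm_tuples k n)" for n
  proof -
    have "(\<Sum>s\<in>perm_tuples k n. num_cycles n j (word_perm s w))
        \<le> (\<Sum>s\<in>perm_tuples k n. card (points_of_period n j (word_perm s w)))"
      using False by (intro sum_mono) (simp add: card_points_of_period[OF word_perm_permutes])
    also have "\<dots> = card (SIGMA s:perm_tuples k n. points_of_period n j (word_perm s w))"
      by (rule card_SigmaI[symmetric]) (auto simp: points_of_period_def)
    also have "\<dots> \<le> card {(s, x) \<in> perm_tuples k n \<times> {1..n}. \<not> tree_like k L s x}"
    proof (intro card_mono finite_pairs subsetI)
      fix p assume "p \<in> (SIGMA s:perm_tuples k n. points_of_period n j (word_perm s w))"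
      then obtain s x where p: "p = (s, x)" "s \<in> perm_tuples k n" "x \<in> {1..n}"
        "card (orbit (word_perm s w) x) = j" by (auto simp: points_of_period_def)
      have "walk s (word_seq w) x L = walk s (word_seq w) x 0"
        using p(4) unfolding L_def walk_word_seq card_orbit_eq_iff[OF word_perm_permutes[OF p(2)]] by simp
      moreover have "0 < L" using False w by (simp add: L_def)
      ultimately have "\<not> inj_on (walk s (word_seq w) x) {..L}" by (auto dest: inj_onD[where x = L and y = 0])
      hence "\<not> tree_like k L s x"
        using reduced_word_seq[OF w(2,3)] seq_on_word_seq[OF w(1,3)] by (auto simp: tree_like_def)
      thus "p \<in> {(s, x) \<in> perm_tuples k n \<times> {1..n}. \<not> tree_like k L s x}" using p by simp
    qed
    finally show ?thesis using C[of n] by linarith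
  qed
  thus ?thesis by blast
qed

lemma inj_on_funpow_iff_orbit:
  assumes "p permutes {1..n::nat}"
  shows "inj_on (\<lambda>m. (p ^^ m) x) {..r} \<longleftrightarrow> r < card (orbit p x)"
    and "inj_on (\<lambda>m. (p ^^ m) x) {..<r} \<and> (p ^^ r) x = x \<and> 0 < r \<longleftrightarrow> card (orbit p x) = r"
proof -
  define d where "d = card (orbit p x)"
  have d: "0 < d" "(p ^^ d) x = x" "\<And>i. 0 < i \<Longrightarrow> i < d \<Longrightarrow> (p ^^ i) x \<noteq> x"
    using card_orbit_eq_iff[OF assms, of x d] d_def by auto
  have ne: "(p ^^ a) x \<noteq> (p ^^ b) x" if "a < b" "b < d" for a b
  proof
    assume "(p ^^ a) x = (p ^^ b) x"
    also have "(p ^^ b) x = (p ^^ a) ((p ^^ (b - a)) x)"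
      using that by (metis add_diff_inverse_nat comp_apply funpow_add less_imp_not_less)
    finally have "(p ^^ (b - a)) x = x"
      using bij_is_inj[OF bij_fn[OF permutes_bij[OF assms]], of a] by (simp add: inj_eq)
    thus False using d(3)[of "b - a"] that by simp
  qed
  hence inj: "inj_on (\<lambda>m. (p ^^ m) x) {..<d}"
    by (intro linorder_inj_onI) auto
  show "inj_on (\<lambda>m. (p ^^ m) x) {..r} \<longleftrightarrow> r < card (orbit p x)"
  proof
    assume "inj_on (\<lambda>m. (p ^^ m) x) {..r}"
    from inj_onD[OF this, of d 0] d show "r < card (orbit p x)"
      unfolding d_def[symmetric] by (cases "d \<le> r") auto
  next
    assume "r < card (orbit p x)"
    thus "inj_on (\<lambda>m. (p ^^ m) x) {..r}" 
      by (intro inj_on_subset[OF inj]) (auto simp: d_def)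
  qed
  show "inj_on (\<lambda>m. (p ^^ m) x) {..<r} \<and> (p ^^ r) x = x \<and> 0 < r \<longleftrightarrow> card (orbit p x) = r"
  proof
    assume *: "inj_on (\<lambda>m. (p ^^ m) x) {..<r} \<and> (p ^^ r) x = x \<and> 0 < r"
    have "(p ^^ i) x \<noteq> x" if "0 < i" "i < r" for i
      using inj_onD[OF conjunct1[OF *], of i 0] that by auto
    thus "card (orbit p x) = r" using * by (simp add: card_orbit_eq_iff[OF assms])
  next
    assume "card (orbit p x) = r"
    thus "inj_on (\<lambda>m. (p ^^ m) x) {..<r} \<and> (p ^^ r) x = x \<and> 0 < r" using d inj by (simp add: d_def)
  qed
qed

text \<open>
  For the word with the single letter \<open>g\<^sub>i\<close> the closing bijection is exact. If \<open>H r\<close> and \<open>G r\<close> are the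
  sets of pairs in which \<open>x\<close> lies on a cycle of \<open>s i\<close> of length \<open>r\<close>, or larger than \<open>r\<close>, then
  \<open>|G r| = (n - r) * |H r|\<close> and \<open>|G (r - 1)| = |G r| + |H r|\<close>, which forces all \<open>|H r|\<close> with
  \<open>1 \<le> r \<le> n\<close> to be equal. The value is needed for \<open>r\<close> up to \<open>n\<close>, where the estimates
  for fixed length give nothing.
\<close>
lemma sum_num_cycles_generator:
  assumes i: "i \<in> {1..k}" and r: "0 < r" "r \<le> n"
  shows "r * (\<Sum>s\<in>perm_tuples k n. num_cycles n r (s i)) = card (perm_tuples k n)"
proof -
  define f where "f = (\<lambda>_::nat. Gen i)"
  have f: "reduced_seq f" "seq_on k f" "f (t + q) = f t" for t q
    using i by (auto simp: f_def reduced_seq_def seq_on_def)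
  have wf: "walk s f x = (\<lambda>q. (s i ^^ q) x)" for s x
    unfolding f_def by (rule ext) (rule walk_const_seq)
  define G where "G q = {(s, x) \<in> perm_tuples k n \<times> {1..n}. q < card (orbit (s i) x)}" for q
  define H where "H q = {(s, x) \<in> perm_tuples k n \<times> {1..n}. card (orbit (s i) x) = q}" for q
  have fin: "finite (G q)" "finite (H q)" for q unfolding G_def H_def by (rule finite_pairs)+
  have G: "G q = open_pairs k n f q" for q
    unfolding G_def open_pairs_def wf using inj_on_funpow_iff_orbit(1)[OF perm_tuples_permutes] by auto
  have H: "H q = closed_pairs k n f q" if "0 < q" for q
  proof -
    have "card (orbit (s i) x) = q \<longleftrightarrow> inj_on (\<lambda>m. (s i ^^ m) x) {..<q} \<and> (s i ^^ q) x = x"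
      if "s \<in> perm_tuples k n" for s x
      using inj_on_funpow_iff_orbit(2)[OF perm_tuples_permutes[OF that], of i x q] \<open>0 < q\<close> by blast
    thus ?thesis unfolding H_def closed_pairs_def wf by auto
  qed
  have GH: "card (G q) = (n - q) * card (H q)" if "0 < q" for q
    using card_close_up[OF f that, of n "\<lambda>_. True"] that by (simp add: G H)
  have step: "card (G q) = card (G (Suc q)) + card (H (Suc q))" for q
  proof -
    have "G q = G (Suc q) \<union> H (Suc q)" "G (Suc q) \<inter> H (Suc q) = {}" by (auto simp: G_def H_def)
    thus ?thesis using fin by (simp add: card_Un_disjoint)
  qed
  have cardG: "card (G q) = (n - q) * card (perm_tuples k n)" if "q \<le> n" for q
    using that
  proof (induction q)
    case 0
    have "0 < card (orbit (s i) x)" if "s \<in> perm_tuples k n" for s x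
      using card_orbit_eq_iff[OF perm_tuples_permutes[OF that], of i x 0] by auto
    hence "G 0 = perm_tuples k n \<times> {1..n}" unfolding G_def by auto
    thus ?case by simp
  next
    case (Suc q)
    have nq: "n - q = Suc (n - Suc q)" using Suc.prems by simp
    have "Suc (n - Suc q) * card (H (Suc q)) = Suc (n - Suc q) * card (perm_tuples k n)"
      using Suc step[of q] GH[of "Suc q"] nq by simp
    hence "card (H (Suc q)) = card (perm_tuples k n)" by (metis mult_cancel1 Zero_not_Suc)
    thus ?case using GH[of "Suc q"] by simp
  qed
  obtain q where q: "r = Suc q" using r by (cases r) auto
  have "n - q = Suc (n - r)" using r q by simp
  hence "card (H r) = card (perm_tuples k n)"
    using cardG[of q] cardG[of r] step[of q] r q by simp
  moreover have "card (H r) = (\<Sum>s\<in>perm_tuples k n. card (points_of_period n r (s i)))"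
  proof -
    have "H r = (SIGMA s:perm_tuples k n. points_of_period n r (s i))"
      by (auto simp: H_def points_of_period_def)
    thus ?thesis by (simp add: points_of_period_def)
  qed
  ultimately show ?thesis
    by (simp add: sum_distrib_left card_points_of_period[OF perm_tuples_permutes])
qed

section \<open>The recursion for the joint law of the cycle counts\<close>
definition avoids_short_cycles ::
    "nat \<Rightarrow> nat \<Rightarrow> (nat \<Rightarrow> nat set) \<Rightarrow> nat \<Rightarrow> (nat \<Rightarrow> nat \<Rightarrow> nat) \<Rightarrow> bool" where
  "avoids_short_cycles k M A n s \<longleftrightarrow>
     (\<forall>i\<in>{1..k}. \<forall>r\<in>{1..M}. r \<notin> A i \<longrightarrow> num_cycles n r (s i) = 0)"

definition joint_event :: "nat \<Rightarrow> nat \<Rightarrow> (nat \<Rightarrow> nat set) \<Rightarrow> letter list \<Rightarrow> nat \<Rightarrow> nat \<Rightarrow>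
    (nat \<Rightarrow> nat) \<Rightarrow> (nat \<Rightarrow> nat \<Rightarrow> nat) set" where
  "joint_event k M A w l n m =
     {s \<in> perm_tuples k n. cycle_counts n l (word_perm s w) = m \<and> avoids_short_cycles k M A n s}"

lemma finite_joint_event [simp]: "finite (joint_event k M A w l n m)"
  by (simp add: joint_event_def)

lemma abs_diff_card_le:
  assumes "finite A" "finite B" "finite C" "A \<subseteq> B \<union> C" "B \<subseteq> A \<union> C"
  shows "\<bar>real (card A) - real (card B)\<bar> \<le> real (card C)"
  using card_le_card_add[OF assms(2,4,3)] card_le_card_add[OF assms(1,5,3)] by linarith

text \<open>
  Both terms count pairs \<open>(s, x)\<close>, up to an error of the order of the number of tuples. The pairs with
  \<open>s\<close> in the event for \<open>m\<close> correspond under closing to the triples of a simple closed walk in the event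
  for \<open>m + 1\<^sub>j\<close> and an old end point. For each such \<open>s\<close> there are \<open>j * (m j + 1)\<close> points on cycles of
  length \<open>j\<close>, and nearly all of them lie on simple closed walks.
\<close>
lemma joint_event_recursion:
  assumes w: "word_on k w" "cyclically_reduced w" "w \<noteq> []" "\<not> is_power w"
    and M: "M = 0 \<or> length w \<ge> 2" and j: "j \<in> {1..l}"
  shows "\<exists>C. \<forall>n. real n * \<bar>real j * real (Suc (m j)) * real (card (joint_event k M A w l n (m(j := Suc (m j)))))
      - real (card (joint_event k M A w l n m))\<bar> \<le> C * real (card (perm_tuples k n))"
proof -
  define f where "f = word_seq w"
  define L where "L = j * length w"
  define R where "R = L + l * length w + M"
  define m' where "m' = m(j := Suc (m j))"
  have f: "reduced_seq f" "seq_on k f" "f (t + L) = f t" for t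
    using w by (auto simp: f_def L_def reduced_word_seq seq_on_word_seq word_seq_periodic_mult)
  have L: "0 < L" using j w by (simp add: L_def)
  obtain C1 where C1: "\<And>n. card {(s, x) \<in> perm_tuples k n \<times> {1..n}. \<not> tree_like k R s x}
      \<le> C1 * card (perm_tuples k n)"
    using card_not_tree_like[of k R] by blast
  obtain C2 where C2: "\<And>n. card {(s, x) \<in> perm_tuples k n \<times> {1..n}. card (orbit (word_perm s w) x) = j \<and>
       \<not> inj_on (walk s f x) {..<L}} * n \<le> C2 * card (perm_tuples k n)"
    using card_period_not_simple[OF w, of j] unfolding f_def L_def by blast
  define C where "C = C2 + L * (j * Suc (m j)) + 2 * C1"
  have "real n * \<bar>real j * real (Suc (m j)) * real (card (joint_event k M A w l n m'))
      - real (card (joint_event k M A w l n m))\<bar> \<le> real C * real (card (perm_tuples k n))" for n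
  proof -
    define \<Omega> where "\<Omega> = perm_tuples k n"
    define Ev where "Ev = joint_event k M A w l n"
    define T1 where "T1 = {(s, x) \<in> \<Omega> \<times> {1..n}. \<not> tree_like k R s x}"
    define T2 where "T2 = {(s, x) \<in> \<Omega> \<times> {1..n}. \<not> tree_like k R s (walk s f x L)}"
    have fin: "finite T1" "finite T2" unfolding T1_def T2_def \<Omega>_def by (rule finite_pairs)+
    have "card T2 \<le> card T1"
    proof (rule card_inj_on_le[where f = "\<lambda>(s, x). (s, walk s f x L)"])
      show "inj_on (\<lambda>(s, x). (s, walk s f x L)) T2"
        by (rule inj_onI) (auto simp: T2_def \<Omega>_def dest: bij_is_inj[OF bij_walk, THEN injD])
      show "(\<lambda>(s, x). (s, walk s f x L)) ` T2 \<subseteq> T1"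
      proof (rule image_subsetI)
        fix p assume "p \<in> T2"
        then obtain s x where p: "p = (s, x)" "s \<in> \<Omega>" "x \<in> {1..n}" "\<not> tree_like k R s (walk s f x L)"
          by (auto simp: T2_def)
        moreover have "walk s f x L \<in> {1..n}" using walk_in p unfolding \<Omega>_def by blast
        ultimately show "(\<lambda>(s, x). (s, walk s f x L)) p \<in> T1" by (simp add: T1_def)
      qed
    qed (rule fin)
    moreover have "card T1 \<le> C1 * card \<Omega>" unfolding T1_def \<Omega>_def by (rule C1)
    moreover have "card (T1 \<union> T2) \<le> card T1 + card T2" by (rule card_Un_le)
    ultimately have bad: "card (T1 \<union> T2) \<le> 2 * C1 * card \<Omega>" by simp
    \<comment> \<open>Pairs with an open walk whose closure realises the counts \<open>m'\<close> are, up to the exceptional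
      pairs, the pairs realising \<open>m\<close>.\<close>
    define X where "X = Ev m \<times> {1..n}"
    define Y where "Y = {p \<in> open_pairs k n f L. fst (fst (close_up f L p)) \<in> Ev m'}"
    have finXY: "finite X" "finite Y"
      unfolding X_def Y_def Ev_def open_pairs_def 
      by (auto intro: finite_subset[OF _ finite_pairs])
    have good: "(s, x) \<in> open_pairs k n f L \<and> (fst (fst (close_up f L (s, x))) \<in> Ev m' \<longleftrightarrow> s \<in> Ev m)"
      if "s \<in> \<Omega>" "x \<in> {1..n}" "(s, x) \<notin> T1 \<union> T2" for s x
    proof -
      have s: "s \<in> perm_tuples k n" using that by (simp add: \<Omega>_def)
      have tree: "tree_like k R s x" "tree_like k R s (walk s f x L)"
        using that by (auto simp: T1_def T2_def)
      have tree': "tree_like k R s x" "tree_like k R s (walk s (word_seq w) x (j * length w))"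
        using tree by (simp_all add: f_def L_def)
      define s' where "s' = reroute s (f (L - 1)) (walk s f x L) x"
      have inj: "inj_on (walk s f x) {..R}" using tree(1) f by (auto simp: tree_like_def)
      have op: "(s, x) \<in> open_pairs k n f L"
        using s that(2) inj_on_subset[OF inj, of "{..L}"] by (simp add: open_pairs_def R_def)
      have s'_in: "s' \<in> perm_tuples k n"
        unfolding s'_def using s that(2) f(2) walk_in[OF s, of f x L]
        by (intro reroute_in_perm_tuples) (blast | simp add: seq_on_def)+
      have R: "j * length w + l * length w \<le> R" "j * length w + M \<le> R" by (simp_all add: R_def L_def)
      have closing: "closing_word k n l M j R s x w"
        using s that(2) w j R tree' by unfold_locales auto
      have counts: "num_cycles n r (word_perm s' w) = num_cycles n r (word_perm s w) + (if r = j then 1 else 0)"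
        if "r \<in> {1..l}" for r
        using closing_word.num_cycles_closing[OF closing, of r] that j
        by (simp add: s'_def f_def L_def)
      have "cycle_counts n l (word_perm s' w) =
          (cycle_counts n l (word_perm s w))(j := Suc (cycle_counts n l (word_perm s w) j))"
        using counts j by (auto simp: cycle_counts_def fun_eq_iff)
      hence "cycle_counts n l (word_perm s' w) = m' \<longleftrightarrow> cycle_counts n l (word_perm s w) = m"
        unfolding m'_def by (simp add: fun_eq_iff) (metis nat.inject)
      moreover have "avoids_short_cycles k M A n s' \<longleftrightarrow> avoids_short_cycles k M A n s"
      proof (cases "M = 0")
        case False
        hence "num_cycles n r (s' i) = num_cycles n r (s i)" if "i \<in> {1..k}" "r \<in> {1..M}" for i r
          using closing_word.num_cycles_closing_generator[OF closing, of r i] that M j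
          by (simp add: s'_def f_def L_def)
        thus ?thesis by (simp add: avoids_short_cycles_def)
      qed (simp add: avoids_short_cycles_def)
      ultimately have "s' \<in> Ev m' \<longleftrightarrow> s \<in> Ev m"
        using s s'_in by (simp add: Ev_def joint_event_def)
      thus ?thesis using op by (simp add: close_up_def s'_def)
    qed
    have "\<bar>real (card X) - real (card Y)\<bar> \<le> real (card (T1 \<union> T2))"
    proof (rule abs_diff_card_le)
      show "X \<subseteq> Y \<union> (T1 \<union> T2)"
      proof
        fix p assume "p \<in> X"
        then obtain s x where p: "p = (s, x)" "s \<in> Ev m" "x \<in> {1..n}" by (auto simp: X_def)
        hence "s \<in> \<Omega>" by (simp add: Ev_def joint_event_def \<Omega>_def)
        thus "p \<in> Y \<union> (T1 \<union> T2)" using good[of s x] p by (auto simp: Y_def)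
      qed
      show "Y \<subseteq> X \<union> (T1 \<union> T2)"
      proof
        fix p assume "p \<in> Y"
        moreover then obtain s x where p: "p = (s, x)" "s \<in> \<Omega>" "x \<in> {1..n}"
          by (auto simp: Y_def open_pairs_def \<Omega>_def)
        ultimately show "p \<in> X \<union> (T1 \<union> T2)" using good[of s x] by (auto simp: X_def Y_def)
      qed
    qed (use finXY fin in auto)
    moreover have "real (card (T1 \<union> T2)) \<le> real (2 * C1 * card \<Omega>)"
      using bad by (rule of_nat_mono)
    ultimately have XY: "\<bar>real (card X) - real (card Y)\<bar> \<le> 2 * real C1 * real (card \<Omega>)"
      by simp
    have cardX: "card X = card (Ev m) * n"
      unfolding X_def card_cartesian_product by simp
    define Z where "Z = {p \<in> closed_pairs k n f L. fst p \<in> Ev m'}"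
    have cardY: "card Y = (n - L) * card Z"
      using card_close_up[OF f L, of n "\<lambda>p. fst p \<in> Ev m'"] by (simp add: Y_def Z_def)
    \<comment> \<open>Points on simple closed walks are, up to pairs with two collisions, the points on
      cycles of length \<open>j\<close>.\<close>
    define E where "E = {(s, x) \<in> \<Omega> \<times> {1..n}. s \<in> Ev m' \<and> card (orbit (word_perm s w) x) = j}"
    define B where "B = {(s, x) \<in> \<Omega> \<times> {1..n}. card (orbit (word_perm s w) x) = j \<and>
       \<not> inj_on (walk s f x) {..<L}}"
    have finE: "finite E" "finite B" "finite Z"
      unfolding E_def B_def Z_def \<Omega>_def closed_pairs_def
      by (auto intro: finite_subset[OF _ finite_pairs] simp del: mem_Collect_eq)
    have perm: "word_perm s w permutes {1..n}" if "s \<in> \<Omega>" for s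
      using that by (simp add: \<Omega>_def word_perm_permutes del: atLeastAtMost_iff One_nat_def)
    have ZE: "Z \<subseteq> E"
    proof
      fix p assume "p \<in> Z"
      then obtain s x where p: "p = (s, x)" "s \<in> \<Omega>" "x \<in> {1..n}" "s \<in> Ev m'" 
        "inj_on (walk s f x) {..<L}" "walk s f x L = x" by (auto simp: Z_def closed_pairs_def \<Omega>_def)
      have "(word_perm s w ^^ j) x = x" using p(6) by (simp add: f_def L_def walk_word_seq)
      moreover have "(word_perm s w ^^ i) x \<noteq> x" if "0 < i" "i < j" for i
      proof
        assume "(word_perm s w ^^ i) x = x"
        hence "walk s f x (i * length w) = walk s f x 0" by (simp add: f_def walk_word_seq)
        thus False using inj_onD[OF p(5), of "i * length w" 0] that w(3) by (simp add: L_def)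
      qed
      ultimately have "card (orbit (word_perm s w) x) = j"
        using j by (simp add: card_orbit_eq_iff[OF perm[OF p(2)]])
      thus "p \<in> E" using p by (simp add: E_def)
    qed
    have EZ: "E \<subseteq> Z \<union> B"
    proof
      fix p assume "p \<in> E"
      then obtain s x where p: "p = (s, x)" "s \<in> \<Omega>" "x \<in> {1..n}" "s \<in> Ev m'" 
        "card (orbit (word_perm s w) x) = j" by (auto simp: E_def)
      hence "walk s f x L = x" 
        unfolding f_def L_def walk_word_seq card_orbit_eq_iff[OF perm[OF p(2)]] by simp
      thus "p \<in> Z \<union> B" using p by (auto simp: Z_def B_def closed_pairs_def \<Omega>_def)
    qed
    have cardE: "card E = j * Suc (m j) * card (Ev m')"
    proof -
      have "E = (SIGMA s:Ev m'. points_of_period n j (word_perm s w))"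
        by (auto simp: E_def points_of_period_def Ev_def joint_event_def \<Omega>_def)
      hence "card E = (\<Sum>s\<in>Ev m'. card (points_of_period n j (word_perm s w)))"
        by (simp add: Ev_def points_of_period_def)
      also have "\<dots> = (\<Sum>s\<in>Ev m'. j * Suc (m j))"
      proof (rule sum.cong)
        fix s assume s: "s \<in> Ev m'"
        hence "cycle_counts n l (word_perm s w) j = m' j" by (simp add: Ev_def joint_event_def)
        hence "num_cycles n j (word_perm s w) = Suc (m j)" using j by (simp add: cycle_counts_def m'_def)
        moreover have "s \<in> \<Omega>" using s by (simp add: Ev_def joint_event_def \<Omega>_def)
        ultimately show "card (points_of_period n j (word_perm s w)) = j * Suc (m j)"
          by (simp add: card_points_of_period[OF perm])
      qed simp
      finally show ?thesis by simp
    qed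
    have c1: "card Z \<le> card E" using ZE finE by (intro card_mono)
    have c2: "card E \<le> card Z + card B" using card_le_card_add[OF finE(3) EZ finE(2)] .
    have c3: "card B * n \<le> C2 * card \<Omega>" unfolding B_def \<Omega>_def by (rule C2)
    have "card (Ev m') \<le> card \<Omega>" by (intro card_mono) (auto simp: Ev_def joint_event_def \<Omega>_def)
    hence c4: "card Z \<le> j * Suc (m j) * card \<Omega>" using c1 cardE by (metis le_trans mult_le_mono2)
    have d1: "\<bar>real n * real (card E) - real n * real (card Z)\<bar> \<le> real C2 * real (card \<Omega>)"
    proof -
      have "real n * real (card E) - real n * real (card Z) \<ge> 0"
        using c1 by (simp add: mult_left_mono)
      moreover have "real n * real (card E) \<le> real n * (real (card Z) + real (card B))"
        using c2 by (intro mult_left_mono) auto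
      moreover have "real (card B) * real n \<le> real C2 * real (card \<Omega>)"
        using c3 by (simp flip: of_nat_mult)
      ultimately show ?thesis by (simp add: algebra_simps)
    qed
    have d2: "\<bar>real n * real (card Z) - real (card Y)\<bar> \<le> real L * real (j * Suc (m j)) * real (card \<Omega>)"
    proof -
      have "\<bar>real n - real (n - L)\<bar> \<le> real L" by (cases "L \<le> n") auto
      hence "\<bar>real n - real (n - L)\<bar> * real (card Z) \<le> real L * real (j * Suc (m j) * card \<Omega>)"
        using c4 by (intro mult_mono) (simp_all only: of_nat_le_iff of_nat_0_le_iff)
      moreover have "\<bar>real n * real (card Z) - real (card Y)\<bar> = \<bar>real n - real (n - L)\<bar> * real (card Z)"
        unfolding cardY by (simp add: abs_mult flip: left_diff_distrib)
      ultimately show ?thesis by (simp add: mult.assoc)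
    qed
    have "\<bar>real n * real (card E) - real (card X)\<bar> \<le> real C * real (card \<Omega>)"
      using d1 d2 XY by (simp add: C_def algebra_simps)
    moreover have "real n * real (card E) - real (card X) =
        real n * (real j * real (Suc (m j)) * real (card (Ev m')) - real (card (Ev m)))"
      unfolding cardE cardX by (simp add: algebra_simps)
    ultimately show ?thesis by (simp add: abs_mult Ev_def \<Omega>_def)
  qed
  thus ?thesis unfolding m'_def by blast
qed

section \<open>From the recursion to the Poisson limit\<close>
lemma pmf_poisson_product_step:
  assumes "j \<in> {1..l}" "\<And>i. i \<notin> {1..l} \<Longrightarrow> m i = 0"
  shows "real j * real (Suc (m j)) * pmf (poisson_product l) (m(j := Suc (m j))) = pmf (poisson_product l) m"
proof -
  have P: "pmf (poisson_product l) g = (\<Prod>i\<in>{1..l}. pmf (poisson_pmf (1 / real i)) (g i))"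
    if "\<And>i. i \<notin> {1..l} \<Longrightarrow> g i = 0" for g
    unfolding poisson_product_def using that by (intro pmf_Pi') auto
  define Q where "Q = (\<Prod>i\<in>{1..l} - {j}. pmf (poisson_pmf (1 / real i)) (m i))"
  have "pmf (poisson_product l) m = (\<Prod>i\<in>{1..l}. pmf (poisson_pmf (1 / real i)) (m i))"
    using assms(2) by (rule P)
  also have "\<dots> = pmf (poisson_pmf (1 / real j)) (m j) * Q"
    unfolding Q_def using assms(1) by (intro prod.remove) auto
  finally have "pmf (poisson_product l) m = pmf (poisson_pmf (1 / real j)) (m j) * Q" .
  moreover have "pmf (poisson_product l) (m(j := Suc (m j))) = pmf (poisson_pmf (1 / real j)) (Suc (m j)) * Q"
  proof -
    have "pmf (poisson_product l) (m(j := Suc (m j))) =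
        (\<Prod>i\<in>{1..l}. pmf (poisson_pmf (1 / real i)) ((m(j := Suc (m j))) i))"
      using assms by (intro P) auto
    also have "\<dots> = pmf (poisson_pmf (1 / real j)) (Suc (m j)) * Q"
      using assms(1) by (simp add: prod.remove[of _ j] Q_def)
    finally show ?thesis .
  qed
  moreover have "real j * real (Suc (m j)) * pmf (poisson_pmf (1 / real j)) (Suc (m j)) =
      pmf (poisson_pmf (1 / real j)) (m j)"
  proof -
    define x where "x = 1 / real j"
    have x: "real j * x = 1" "0 < x" using assms(1) by (simp_all add: x_def)
    have "real j * real (Suc (m j)) * (x ^ Suc (m j) / fact (Suc (m j)) * exp (- x)) =
        (real j * x) * (real (Suc (m j)) / fact (Suc (m j))) * (x ^ m j * exp (- x))" by simp
    also have "real (Suc (m j)) / fact (Suc (m j)) = 1 / fact (m j)"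
      by (simp only: fact_Suc) simp
    finally show ?thesis
      unfolding x_def[symmetric] pmf_poisson[OF x(2)] x(1) by simp
  qed
  ultimately show ?thesis by (metis mult.assoc)
qed

lemma pmf_poisson_product_pos:
  assumes "\<And>i. i \<notin> {1..l} \<Longrightarrow> m i = 0"
  shows "0 < pmf (poisson_product l) m"
  unfolding poisson_product_def using assms by (subst pmf_Pi') (auto intro!: prod_pos)

text \<open>
  Finite sets of count vectors that exhaust the support of the Poisson product.
\<close>
definition count_box :: "nat \<Rightarrow> nat \<Rightarrow> (nat \<Rightarrow> nat) set" where
  "count_box l K = {m. (\<forall>i. i \<notin> {1..l} \<longrightarrow> m i = 0) \<and> (\<forall>i. m i \<le> K)}"

lemma finite_count_box: "finite (count_box l K)"
proof (rule finite_subset)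
  show "count_box l K \<subseteq> PiE_dflt {1..l} 0 (\<lambda>_. {..K})" by (auto simp: count_box_def PiE_dflt_def)
qed auto

lemma poisson_product_count_box: "(\<lambda>K. measure_pmf.prob (poisson_product l) (count_box l K)) \<longlonglongrightarrow> 1"
proof -
  have "(\<lambda>K. measure_pmf.prob (poisson_product l) (count_box l K))
      \<longlonglongrightarrow> measure_pmf.prob (poisson_product l) (\<Union>K. count_box l K)"
    by (rule measure_pmf.finite_Lim_measure_incseq) (auto simp: incseq_def count_box_def intro: order.trans)
  moreover have "measure_pmf.prob (poisson_product l) (\<Union>K. count_box l K) = 1"
  proof -
    have "set_pmf (poisson_product l) \<subseteq> (\<Union>K. count_box l K)"
    proof
      fix m assume "m \<in> set_pmf (poisson_product l)"
      hence m: "\<forall>i. i \<notin> {1..l} \<longrightarrow> m i = 0"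
        using set_Pi_pmf_subset[of "{1..l}" 0] by (auto simp: poisson_product_def)
      have "m i \<le> (\<Sum>i\<in>{1..l}. m i)" for i
        using m by (cases "i \<in> {1..l}") (auto intro: member_le_sum)
      hence "m \<in> count_box l (\<Sum>i\<in>{1..l}. m i)" using m by (simp add: count_box_def)
      thus "m \<in> (\<Union>K. count_box l K)" by blast
    qed
    hence "AE m in poisson_product l. m \<in> (\<Union>K. count_box l K)" by (auto simp: AE_measure_pmf_iff)
    thus ?thesis by (intro measure_pmf.prob_eq_1[THEN iffD2]) auto
  qed
  ultimately show ?thesis by simp
qed

text \<open>
  The recursion is that of the Poisson weights \<open>\<pi>\<close>, so \<open>p n m\<close> is asymptotically \<open>d n * \<pi> m\<close>, where
  \<open>d n\<close> is determined by the value at \<open>m = 0\<close>. Summing over a large box, which by tightness carries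
  nearly all the mass on both sides, identifies \<open>d n\<close> asymptotically with the total mass \<open>q n\<close>.
\<close>
lemma poisson_limit:
  fixes p :: "nat \<Rightarrow> (nat \<Rightarrow> nat) \<Rightarrow> real" and q :: "nat \<Rightarrow> real"
  assumes rec: "\<And>m j. j \<in> {1..l} \<Longrightarrow> (\<And>i. i \<notin> {1..l} \<Longrightarrow> m i = 0) \<Longrightarrow>
      (\<lambda>n. real j * real (Suc (m j)) * p n (m(j := Suc (m j))) - p n m) \<longlonglongrightarrow> 0"
    and bnd: "\<And>n m. 0 \<le> p n m" "\<And>n m. p n m \<le> 1"
    and tight: "\<And>n K. \<bar>q n - (\<Sum>m\<in>count_box l K. p n m)\<bar> \<le> C / real (Suc K)"
    and supp: "\<And>i. i \<notin> {1..l} \<Longrightarrow> m i = 0"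
  shows "(\<lambda>n. p n m - q n * pmf (poisson_product l) m) \<longlonglongrightarrow> 0"
proof -
  define \<pi> where "\<pi> = pmf (poisson_product l)"
  define z where "z = (\<lambda>_::nat. 0::nat)"
  define d where "d n = p n z / \<pi> z" for n
  have z: "\<pi> z > 0" unfolding \<pi>_def by (rule pmf_poisson_product_pos) (simp add: z_def)
  have lim: "(\<lambda>n. p n m - d n * \<pi> m) \<longlonglongrightarrow> 0" if "\<And>i. i \<notin> {1..l} \<Longrightarrow> m i = 0" for m
    using that
  proof (induction "\<Sum>i\<in>{1..l}. m i" arbitrary: m)
    case 0
    hence "m = z" by (fastforce simp: z_def fun_eq_iff)
    thus ?case using z by (simp add: d_def)
  next
    case (Suc N)
    then obtain j where j: "j \<in> {1..l}" "m j \<noteq> 0" by (metis nat.distinct(1) sum.neutral)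
    define m0 where "m0 = m(j := m j - 1)"
    have m: "m = m0(j := Suc (m0 j))" using j by (auto simp: m0_def)
    have m0: "m0 i = 0" if "i \<notin> {1..l}" for i using Suc.prems that j by (auto simp: m0_def)
    have "(\<Sum>i\<in>{1..l}. m i) = Suc (\<Sum>i\<in>{1..l}. m0 i)"
      unfolding m using j(1) by (simp add: sum.remove[of _ j])
    hence IH: "(\<lambda>n. p n m0 - d n * \<pi> m0) \<longlonglongrightarrow> 0" using Suc m0 by (intro Suc.hyps) auto
    define c where "c = real j * real (Suc (m0 j))"
    have c: "c > 0" using j by (simp add: c_def)
    have \<pi>: "c * \<pi> m = \<pi> m0"
      unfolding c_def \<pi>_def using pmf_poisson_product_step[OF j(1) m0] m by simp
    have "(\<lambda>n. c * p n m - p n m0) \<longlonglongrightarrow> 0" unfolding c_def using rec[OF j(1) m0] m by simp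
    from tendsto_add[OF this IH] have "(\<lambda>n. c * p n m - d n * \<pi> m0) \<longlonglongrightarrow> 0" by simp
    hence "(\<lambda>n. c * (p n m - d n * \<pi> m)) \<longlonglongrightarrow> 0" by (simp add: \<pi>[symmetric] algebra_simps)
    from tendsto_mult_left[OF this, of "1 / c"] show ?case using c by simp
  qed
  have d: "0 \<le> d n" "d n \<le> 1 / \<pi> z" for n
    using bnd[of n z] z by (auto simp: d_def divide_right_mono)
  have "(\<lambda>n. q n - d n) \<longlonglongrightarrow> 0"
  proof (rule LIMSEQ_I)
    fix \<epsilon> :: real assume \<epsilon>: "0 < \<epsilon>"
    have "(\<lambda>K. C / real (Suc K)) \<longlonglongrightarrow> 0" by real_asymp
    hence "\<forall>\<^sub>F K in sequentially. C / real (Suc K) < \<epsilon> / 3"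
      using \<epsilon> by (intro order_tendstoD) auto
    moreover have "\<forall>\<^sub>F K in sequentially. measure_pmf.prob (poisson_product l) (count_box l K) > 1 - \<epsilon> * \<pi> z / 3"
      using poisson_product_count_box[of l] \<epsilon> z by (intro order_tendstoD) auto
    ultimately have "\<forall>\<^sub>F K in sequentially. C / real (Suc K) < \<epsilon> / 3 \<and>
        measure_pmf.prob (poisson_product l) (count_box l K) > 1 - \<epsilon> * \<pi> z / 3" by (rule eventually_conj)
    from eventually_happens[OF this] obtain K where K: "C / real (Suc K) < \<epsilon> / 3"
      "measure_pmf.prob (poisson_product l) (count_box l K) > 1 - \<epsilon> * \<pi> z / 3"
      by auto
    define b where "b = (\<Sum>m\<in>count_box l K. \<pi> m)"
    have b: "b = measure_pmf.prob (poisson_product l) (count_box l K)"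
      unfolding b_def \<pi>_def by (rule measure_measure_pmf_finite[symmetric, OF finite_count_box])
    have "(\<lambda>n. \<Sum>m\<in>count_box l K. p n m - d n * \<pi> m) \<longlonglongrightarrow> 0"
      by (rule tendsto_null_sum, rule lim) (auto simp: count_box_def)
    hence "\<forall>\<^sub>F n in sequentially. \<bar>\<Sum>m\<in>count_box l K. p n m - d n * \<pi> m\<bar> < \<epsilon> / 3"
      using tendstoD[of "\<lambda>n. \<Sum>m\<in>count_box l K. p n m - d n * \<pi> m" 0 sequentially "\<epsilon> / 3"] \<epsilon>
      by (simp add: dist_real_def)
    hence "\<forall>\<^sub>F n in sequentially. norm (q n - d n - 0) < \<epsilon>"
    proof eventually_elim
      case (elim n)
      have "(\<Sum>m\<in>count_box l K. p n m - d n * \<pi> m) = (\<Sum>m\<in>count_box l K. p n m) - d n * b"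
        by (simp add: b_def sum_subtractf sum_distrib_left)
      moreover have "\<bar>d n * b - d n\<bar> \<le> \<epsilon> / 3"
      proof -
        have b1: "b \<le> 1" "1 - b \<le> \<epsilon> * \<pi> z / 3" using K b by auto
        have "d n * b - d n = - (d n * (1 - b))" "0 \<le> d n * (1 - b)"
          using d(1)[of n] b1(1) by (simp add: algebra_simps, intro mult_nonneg_nonneg) auto
        hence "\<bar>d n * b - d n\<bar> = d n * (1 - b)" by simp
        also have "\<dots> \<le> (1 / \<pi> z) * (\<epsilon> * \<pi> z / 3)" using d[of n] b1 z by (intro mult_mono) auto
        finally show ?thesis using z by simp
      qed
      ultimately show ?case using elim tight[of n K] K(1) unfolding real_norm_def by linarith
    qed
    thus "\<exists>no. \<forall>n\<ge>no. norm (q n - d n - 0) < \<epsilon>" by (simp add: eventually_sequentially)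
  qed
  have "(\<lambda>n. p n m - d n * \<pi> m) \<longlonglongrightarrow> 0" by (rule lim) (rule supp)
  from tendsto_diff[OF this tendsto_mult_right[OF \<open>(\<lambda>n. q n - d n) \<longlonglongrightarrow> 0\<close>, of "\<pi> m"]]
  show ?thesis by (simp add: \<pi>_def algebra_simps)
qed

text \<open>
  Tightness comes from Markov's inequality and the bounded expected number of cycles.
\<close>
lemma joint_event_limit:
  assumes w: "word_on k w" "cyclically_reduced w" "w \<noteq> []" "\<not> is_power w"
    and M: "M = 0 \<or> length w \<ge> 2" and m: "\<And>i. i \<notin> {1..l} \<Longrightarrow> m i = 0"
  shows "(\<lambda>n. card (joint_event k M A w l n m) / card (perm_tuples k n) -
     card {s \<in> perm_tuples k n. avoids_short_cycles k M A n s} / card (perm_tuples k n) * pmf (poisson_product l) m) \<longlonglongrightarrow> 0"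
proof -
  define c where "c n = real (card (perm_tuples k n))" for n
  have c: "c n > 0" for n unfolding c_def using card_perm_tuples_pos by simp
  define p where "p n m = card (joint_event k M A w l n m) / c n" for n m
  define q where "q n = card {s \<in> perm_tuples k n. avoids_short_cycles k M A n s} / c n" for n
  have "\<forall>j. \<exists>C. \<forall>n. (\<Sum>s\<in>perm_tuples k n. num_cycles n j (word_perm s w)) \<le> C * card (perm_tuples k n)"
    using card_period_le[OF w(1-3)] by blast
  then obtain B where B: "\<And>j n. (\<Sum>s\<in>perm_tuples k n. num_cycles n j (word_perm s w)) \<le> B j * card (perm_tuples k n)"
    by metis
  show ?thesis unfolding c_def[symmetric] p_def[symmetric] q_def[symmetric]
  proof (rule poisson_limit[OF _ _ _ _ m])
    fix m :: "nat \<Rightarrow> nat" and j assume j: "j \<in> {1..l}"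
    obtain C where C: "\<And>n. real n * \<bar>real j * real (Suc (m j)) * real (card (joint_event k M A w l n (m(j := Suc (m j)))))
      - real (card (joint_event k M A w l n m))\<bar> \<le> C * c n"
      using joint_event_recursion[OF w M j] unfolding c_def by blast
    show "(\<lambda>n. real j * real (Suc (m j)) * p n (m(j := Suc (m j))) - p n m) \<longlonglongrightarrow> 0"
    proof (rule Lim_null_comparison)
      show "(\<lambda>n. C / real n) \<longlonglongrightarrow> 0" by real_asymp
      show "\<forall>\<^sub>F n in sequentially. norm (real j * real (Suc (m j)) * p n (m(j := Suc (m j))) - p n m) \<le> C / real n"
        using eventually_gt_at_top[of 0]
      proof eventually_elim
        case (elim n)
        define a where "a = real j * real (Suc (m j)) * real (card (joint_event k M A w l n (m(j := Suc (m j)))))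
           - real (card (joint_event k M A w l n m))"
        have "real j * real (Suc (m j)) * p n (m(j := Suc (m j))) - p n m = a / c n"
          by (simp add: p_def a_def diff_divide_distrib)
        moreover have "\<bar>a\<bar> \<le> C * c n / real n" using C[of n] elim by (simp add: a_def field_simps)
        moreover have "\<bar>a / c n\<bar> \<le> C / real n"
          using \<open>\<bar>a\<bar> \<le> C * c n / real n\<close> c[of n] by (simp add: abs_divide pos_divide_le_eq mult.commute)
        ultimately show ?case by (simp only: real_norm_def)
      qed
    qed
  next
    fix n and m :: "nat \<Rightarrow> nat"
    show "0 \<le> p n m" using c[of n] by (simp add: p_def)
    have "card (joint_event k M A w l n m) \<le> card (perm_tuples k n)"
      by (intro card_mono) (auto simp: joint_event_def)
    thus "p n m \<le> 1" using c[of n] by (simp add: p_def c_def)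
  next
    fix n K
    define G where "G = {s \<in> perm_tuples k n. avoids_short_cycles k M A n s}"
    define H where "H = {s \<in> perm_tuples k n. cycle_counts n l (word_perm s w) \<notin> count_box l K}"
    define U where "U = (\<Union>m\<in>count_box l K. joint_event k M A w l n m)"
    have fin: "finite G" "finite H" "finite U" by (auto simp: G_def H_def U_def finite_count_box)
    have "card U = (\<Sum>m\<in>count_box l K. card (joint_event k M A w l n m))"
      unfolding U_def by (rule card_UN_disjoint) (auto simp: finite_count_box joint_event_def)
    hence sum: "(\<Sum>m\<in>count_box l K. p n m) = card U / c n" by (simp add: p_def sum_divide_distrib)
    have "\<bar>real (card G) - real (card U)\<bar> \<le> real (card H)"
      by (rule abs_diff_card_le) (use fin in \<open>auto simp: G_def U_def H_def joint_event_def\<close>)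
    moreover have "real (card H) * real (Suc K) \<le> (\<Sum>j\<in>{1..l}. real (B j)) * c n"
    proof -
      define H' where "H' j = {s \<in> perm_tuples k n. K < num_cycles n j (word_perm s w)}" for j
      have "H \<subseteq> (\<Union>j\<in>{1..l}. H' j)"
      proof
        fix s assume s: "s \<in> H"
        hence "\<not> (\<forall>i. cycle_counts n l (word_perm s w) i \<le> K)"
          unfolding H_def count_box_def mem_Collect_eq by (metis cycle_counts_def)
        then obtain i where i: "K < cycle_counts n l (word_perm s w) i" by (auto simp: not_le)
        hence "i \<in> {1..l}" by (metis cycle_counts_def not_less_zero)
        moreover from this i s have "s \<in> H' i" by (simp add: H'_def H_def cycle_counts_def)
        ultimately show "s \<in> (\<Union>j\<in>{1..l}. H' j)" by blast
      qed
      hence "card H \<le> card (\<Union>j\<in>{1..l}. H' j)" by (intro card_mono) (auto simp: H'_def)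
      also have "\<dots> \<le> (\<Sum>j\<in>{1..l}. card (H' j))" by (rule card_UN_le) auto
      finally have "card H * Suc K \<le> (\<Sum>j\<in>{1..l}. card (H' j) * Suc K)"
        by (simp only: mult_le_mono1 flip: sum_distrib_right)
      also have "\<dots> \<le> (\<Sum>j\<in>{1..l}. B j * card (perm_tuples k n))"
      proof (rule sum_mono)
        fix j
        have "card (H' j) * Suc K = (\<Sum>s\<in>H' j. Suc K)" by simp
        also have "\<dots> \<le> (\<Sum>s\<in>H' j. num_cycles n j (word_perm s w))"
          by (rule sum_mono) (auto simp: H'_def)
        also have "\<dots> \<le> (\<Sum>s\<in>perm_tuples k n. num_cycles n j (word_perm s w))"
          by (rule sum_mono2) (auto simp: H'_def)
        finally show "card (H' j) * Suc K \<le> B j * card (perm_tuples k n)" using B[of n j] by linarith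
      qed
      finally have "real (card H * Suc K) \<le> real (\<Sum>j\<in>{1..l}. B j * card (perm_tuples k n))"
        by (simp only: of_nat_le_iff)
      thus ?thesis unfolding of_nat_mult of_nat_sum sum_distrib_right c_def .
    qed
    ultimately have *: "\<bar>real (card G) - real (card U)\<bar> * real (Suc K) \<le> (\<Sum>j\<in>{1..l}. real (B j)) * c n"
      using mult_right_mono[of "\<bar>real (card G) - real (card U)\<bar>" "real (card H)" "real (Suc K)"] by linarith
    have "q n - (\<Sum>m\<in>count_box l K. p n m) = (real (card G) - real (card U)) / c n"
      by (simp add: sum q_def G_def diff_divide_distrib)
    moreover have "\<bar>(real (card G) - real (card U)) / c n\<bar> = \<bar>real (card G) - real (card U)\<bar> / c n"
      using c[of n] by (simp add: abs_divide)
    moreover have "\<dots> \<le> (\<Sum>j\<in>{1..l}. real (B j)) / real (Suc K)"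
      using * c[of n] by (simp add: pos_divide_le_eq pos_le_divide_eq del: of_nat_Suc)
    ultimately show "\<bar>q n - (\<Sum>m\<in>count_box l K. p n m)\<bar> \<le> (\<Sum>j\<in>{1..l}. real (B j)) / real (Suc K)"
      by (simp only:)
  qed
qed

section \<open>Weak convergence of discrete laws\<close>
lemma pmf_exists_finite_large:
  fixes \<nu> :: "'a pmf" assumes "0 < \<epsilon>"
  obtains K where "finite K" "K \<subseteq> set_pmf \<nu>" "measure_pmf.prob \<nu> K > 1 - \<epsilon>"
proof -
  define K where "K = (\<lambda>i. from_nat_into (set_pmf \<nu>) ` {..i::nat})"
  have "(\<Union>i. K i) = range (from_nat_into (set_pmf \<nu>))" by (auto simp: K_def)
  hence "(\<Union>i. K i) = set_pmf \<nu>"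
    using range_from_nat_into[OF set_pmf_not_empty countable_set_pmf, of \<nu>] by simp
  moreover have "(\<lambda>i. measure_pmf.prob \<nu> (K i)) \<longlonglongrightarrow> measure_pmf.prob \<nu> (\<Union>i. K i)"
    by (rule measure_pmf.finite_Lim_measure_incseq) (auto simp: incseq_def K_def)
  moreover have "measure_pmf.prob \<nu> (set_pmf \<nu>) = 1"
    by (rule measure_pmf.prob_eq_1[THEN iffD2]) (auto simp: AE_measure_pmf)
  ultimately have "(\<lambda>i. measure_pmf.prob \<nu> (K i)) \<longlonglongrightarrow> 1" by simp
  hence "\<forall>\<^sub>F i in sequentially. measure_pmf.prob \<nu> (K i) > 1 - \<epsilon>"
    using assms by (intro order_tendstoD) auto
  from eventually_happens[OF this] obtain i where "measure_pmf.prob \<nu> (K i) > 1 - \<epsilon>" by auto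
  moreover have "finite (K i)" "K i \<subseteq> set_pmf \<nu>"
    by (auto simp: K_def from_nat_into set_pmf_not_empty)
  ultimately show ?thesis using that by blast
qed

lemma pmf_expectation_split:
  fixes f :: "'a \<Rightarrow> real" and \<mu> :: "'a pmf"
  assumes "finite K" "\<And>x. \<bar>f x\<bar> \<le> B"
  shows "\<bar>measure_pmf.expectation \<mu> f - (\<Sum>x\<in>K. pmf \<mu> x * f x)\<bar> \<le> B * (1 - measure_pmf.prob \<mu> K)"
proof -
  have int: "integrable (measure_pmf \<mu>) (\<lambda>x. f x * indicator S x)" for S
    by (rule measure_pmf.integrable_const_bound[of _ B])
       (use assms(2) in \<open>auto simp: abs_mult indicator_def split: if_splits intro: order.trans[OF abs_ge_zero]\<close>)
  have "measure_pmf.expectation \<mu> f =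
      measure_pmf.expectation \<mu> (\<lambda>x. f x * indicator K x + f x * indicator (-K) x)"
    by (rule Bochner_Integration.integral_cong) (auto simp: indicator_def)
  also have "\<dots> = measure_pmf.expectation \<mu> (\<lambda>x. f x * indicator K x)
      + measure_pmf.expectation \<mu> (\<lambda>x. f x * indicator (-K) x)"
    by (rule Bochner_Integration.integral_add) (rule int)+
  also have "measure_pmf.expectation \<mu> (\<lambda>x. f x * indicator K x) = (\<Sum>x\<in>K. pmf \<mu> x * (f x * indicator K x))"
    by (subst integral_measure_pmf[OF assms(1)]) (auto simp: indicator_def split: if_splits)
  also have "\<dots> = (\<Sum>x\<in>K. pmf \<mu> x * f x)" by (intro sum.cong) auto
  finally have "measure_pmf.expectation \<mu> f - (\<Sum>x\<in>K. pmf \<mu> x * f x)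
      = measure_pmf.expectation \<mu> (\<lambda>x. f x * indicator (-K) x)" by simp
  also have "\<bar>\<dots>\<bar> \<le> measure_pmf.expectation \<mu> (\<lambda>x. \<bar>f x * indicator (-K) x\<bar>)"
    by (rule integral_abs_bound)
  also have "\<dots> \<le> measure_pmf.expectation \<mu> (\<lambda>x. B * indicator (-K) x)"
  proof (intro integral_mono integrable_abs int)
    show "integrable (measure_pmf \<mu>) (\<lambda>x. B * indicator (- K) x)"
      by (rule measure_pmf.integrable_const_bound[of _ "\<bar>B\<bar>"]) (auto simp: indicator_def)
  qed (use assms(2) in \<open>auto simp: indicator_def\<close>)
  also have "\<dots> = B * measure_pmf.prob \<mu> (-K)" by simp
  also have "measure_pmf.prob \<mu> (-K) = 1 - measure_pmf.prob \<mu> K"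
    using measure_pmf.prob_compl[of K \<mu>] by (simp add: Compl_eq_Diff_UNIV)
  finally show ?thesis .
qed

text \<open>
  No mass can escape from a finite set that carries nearly all of the limit law.
\<close>
lemma pmf_pointwise_imp_expectation:
  fixes f :: "'a \<Rightarrow> real" and \<mu> :: "nat \<Rightarrow> 'a pmf"
  assumes lim: "\<And>x. x \<in> set_pmf \<nu> \<Longrightarrow> (\<lambda>n. pmf (\<mu> n) x) \<longlonglongrightarrow> pmf \<nu> x"
    and f: "bounded (range f)"
  shows "(\<lambda>n. measure_pmf.expectation (\<mu> n) f) \<longlonglongrightarrow> measure_pmf.expectation \<nu> f"
proof (rule LIMSEQ_I)
  fix \<epsilon> :: real assume \<epsilon>: "0 < \<epsilon>"
  obtain B where B: "0 < B" "\<And>x. \<bar>f x\<bar> \<le> B"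
    using f by (auto simp: bounded_pos)
  define \<delta> where "\<delta> = \<epsilon> / (4 * B)"
  have \<delta>: "0 < \<delta>" using \<epsilon> B by (simp add: \<delta>_def)
  obtain K where K: "finite K" "K \<subseteq> set_pmf \<nu>" "measure_pmf.prob \<nu> K > 1 - \<delta>"
    using pmf_exists_finite_large[OF \<delta>] by blast
  have prob: "measure_pmf.prob \<tau> K = (\<Sum>x\<in>K. pmf \<tau> x)" for \<tau> :: "'a pmf"
    by (rule measure_measure_pmf_finite[OF K(1)])
  have "(\<lambda>n. measure_pmf.prob (\<mu> n) K) \<longlonglongrightarrow> measure_pmf.prob \<nu> K"
    unfolding prob using K by (intro tendsto_sum lim) auto
  hence "\<forall>\<^sub>F n in sequentially. measure_pmf.prob (\<mu> n) K > 1 - \<delta>"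
    using K(3) by (rule order_tendstoD)
  moreover have "(\<lambda>n. \<Sum>x\<in>K. pmf (\<mu> n) x * f x) \<longlonglongrightarrow> (\<Sum>x\<in>K. pmf \<nu> x * f x)"
    using K by (intro tendsto_sum tendsto_mult lim tendsto_const) auto
  hence "\<forall>\<^sub>F n in sequentially. dist (\<Sum>x\<in>K. pmf (\<mu> n) x * f x) (\<Sum>x\<in>K. pmf \<nu> x * f x) < \<epsilon> / 2"
    using \<epsilon> by (intro tendstoD) auto
  ultimately have "\<forall>\<^sub>F n in sequentially. norm (measure_pmf.expectation (\<mu> n) f - measure_pmf.expectation \<nu> f) < \<epsilon>"
  proof eventually_elim
    case (elim n)
    have b: "\<bar>measure_pmf.expectation \<tau> f - (\<Sum>x\<in>K. pmf \<tau> x * f x)\<bar> \<le> \<epsilon> / 4"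
      if "measure_pmf.prob \<tau> K > 1 - \<delta>" for \<tau> :: "'a pmf"
    proof -
      have "\<bar>measure_pmf.expectation \<tau> f - (\<Sum>x\<in>K. pmf \<tau> x * f x)\<bar> \<le> B * (1 - measure_pmf.prob \<tau> K)"
        using K B by (intro pmf_expectation_split) auto
      also have "\<dots> \<le> B * \<delta>" using that B by (intro mult_left_mono) auto
      also have "\<dots> = \<epsilon> / 4" using B by (simp add: \<delta>_def)
      finally show ?thesis .
    qed
    show ?case using b[OF elim(1)] b[OF K(3)] elim(2) unfolding real_norm_def dist_real_def by linarith
  qed
  thus "\<exists>no. \<forall>n\<ge>no. norm (measure_pmf.expectation (\<mu> n) f - measure_pmf.expectation \<nu> f) < \<epsilon>"
    by (simp add: eventually_sequentially)
qed

section \<open>Uniform tuples without short forbidden cycles\<close>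
lemma poisson_product_support:
  "m \<in> set_pmf (poisson_product l) \<Longrightarrow> i \<notin> {1..l} \<Longrightarrow> m i = 0"
  using set_Pi_pmf_subset[of "{1..l}" 0] by (auto simp: poisson_product_def)

lemma measure_pmf_of_set_perm_tuples:
  "measure_pmf.prob (pmf_of_set (perm_tuples k n)) S =
     real (card {s \<in> perm_tuples k n. s \<in> S}) / real (card (perm_tuples k n))"
  by (subst measure_pmf_of_set) (auto simp: perm_tuples_nonempty Int_def)

lemma cyclically_reduced_Gen: "cyclically_reduced [Gen i]"
  by (simp add: cyclically_reduced_def reduced_def)

lemma not_is_power_Gen: "\<not> is_power [Gen i]"
proof
  assume "is_power [Gen i]"
  then obtain d v where dv: "2 \<le> d" "[Gen i] = concat (replicate d v)" by (auto simp: is_power_def)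
  hence "length [Gen i] = length (concat (replicate d v))" by simp
  hence "1 = d * length v" by (simp add: length_concat sum_list_replicate)
  thus False using dv(1) by simp
qed

text \<open>
  The cycle counts of a single permutation are those of the word with one letter, so
  \<open>joint_event_limit\<close> applies with \<open>M = 0\<close>.
\<close>
lemma avoids_short_cycles_generator_limit:
  assumes i: "i \<in> {1..k}"
  shows "(\<lambda>n. measure_pmf.prob (pmf_of_set (perm_tuples k n))
       {s. \<forall>r\<in>{1..M}. r \<notin> B \<longrightarrow> num_cycles n r (s i) = 0})
     \<longlonglongrightarrow> exp (- (\<Sum>r\<in>{1..M} - B. 1 / real r))"
proof -
  define \<mu> where "\<mu> n = map_pmf (\<lambda>s. cycle_counts n M (word_perm s [Gen i])) (pmf_of_set (perm_tuples k n))" for n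
  define T where "T = {m :: nat \<Rightarrow> nat. \<forall>r\<in>{1..M}. r \<notin> B \<longrightarrow> m r = 0}"
  have wp: "word_perm s [Gen i] = s i" for s by (simp add: word_perm_def)
  have pmf_\<mu>: "pmf (\<mu> n) m = card (joint_event k 0 (\<lambda>_. {}) [Gen i] M n m) / card (perm_tuples k n)" for n m
    unfolding \<mu>_def pmf_map measure_pmf_of_set_perm_tuples joint_event_def
    by (simp add: avoids_short_cycles_def)
  have "(\<lambda>n. pmf (\<mu> n) m) \<longlonglongrightarrow> pmf (poisson_product M) m" if "m \<in> set_pmf (poisson_product M)" for m
  proof -
    have "word_on k [Gen i]" using i by (simp add: word_on_def)
    from joint_event_limit[OF this cyclically_reduced_Gen _ not_is_power_Gen, of 0 M m "\<lambda>_. {}"]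
    have "(\<lambda>n. pmf (\<mu> n) m - pmf (poisson_product M) m) \<longlonglongrightarrow> 0"
      using poisson_product_support[OF that] perm_tuples_nonempty[of k]
      by (simp add: pmf_\<mu> avoids_short_cycles_def)
    thus ?thesis by (simp add: LIM_zero_iff)
  qed
  moreover have "bounded (range (indicator T :: _ \<Rightarrow> real))"
    by (rule boundedI[of _ 1]) (auto simp: indicator_def)
  ultimately have "(\<lambda>n. measure_pmf.expectation (\<mu> n) (indicator T))
      \<longlonglongrightarrow> measure_pmf.expectation (poisson_product M) (indicator T :: _ \<Rightarrow> real)"
    by (rule pmf_pointwise_imp_expectation)
  hence "(\<lambda>n. measure_pmf.prob (\<mu> n) T) \<longlonglongrightarrow> measure_pmf.prob (poisson_product M) T"
    by simp
  moreover have "measure_pmf.prob (\<mu> n) T = measure_pmf.prob (pmf_of_set (perm_tuples k n))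
       {s. \<forall>r\<in>{1..M}. r \<notin> B \<longrightarrow> num_cycles n r (s i) = 0}" for n
    unfolding \<mu>_def measure_map_pmf by (simp add: T_def vimage_def wp cycle_counts_def)
  moreover have "measure_pmf.prob (poisson_product M) T = exp (- (\<Sum>r\<in>{1..M} - B. 1 / real r))"
  proof -
    have "T = Pi {1..M} (\<lambda>r. if r \<in> B then UNIV else {0})" by (auto simp: T_def Pi_def)
    hence "measure_pmf.prob (poisson_product M) T =
        (\<Prod>r\<in>{1..M}. measure_pmf.prob (poisson_pmf (1 / real r)) (if r \<in> B then UNIV else {0}))"
      unfolding poisson_product_def by (simp only: measure_Pi_pmf_Pi finite_atLeastAtMost)
    also have "\<dots> = (\<Prod>r\<in>{1..M} - B. measure_pmf.prob (poisson_pmf (1 / real r)) (if r \<in> B then UNIV else {0}))"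
      by (intro prod.mono_neutral_right) auto
    also have "\<dots> = (\<Prod>r\<in>{1..M} - B. exp (- (1 / real r)))"
      by (intro prod.cong) (auto simp: measure_pmf_single)
    also have "\<dots> = exp (- (\<Sum>r\<in>{1..M} - B. 1 / real r))"
      by (simp add: exp_sum sum_negf[symmetric])
    finally show ?thesis .
  qed
  ultimately show ?thesis by simp
qed

lemma avoids_short_cycles_limit:
  "(\<lambda>n. measure_pmf.prob (pmf_of_set (perm_tuples k n)) {s. avoids_short_cycles k M A n s})
     \<longlonglongrightarrow> (\<Prod>i\<in>{1..k}. exp (- (\<Sum>r\<in>{1..M} - A i. 1 / real r)))"
proof -
  define T where "T n i = {p. \<forall>r\<in>{1..M}. r \<notin> A i \<longrightarrow> num_cycles n r p = 0}" for n i
  define P where "P n = {p. p permutes {1..n::nat}}" for n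
  have P: "finite (P n)" "P n \<noteq> {}" for n
    unfolding P_def using permutes_id[of "{1..n}"] by (blast intro: finite_permutations)+
  have Pi: "pmf_of_set (perm_tuples k n) = Pi_pmf {1..k} id (\<lambda>_. pmf_of_set (P n))" for n
    unfolding perm_tuples_def using P by (subst Pi_pmf_of_set) (auto simp: P_def)
  have eq: "measure_pmf.prob (pmf_of_set (perm_tuples k n)) {s. avoids_short_cycles k M A n s} =
      (\<Prod>i\<in>{1..k}. measure_pmf.prob (pmf_of_set (perm_tuples k n)) {s. s i \<in> T n i})" for n
  proof -
    have "{s. avoids_short_cycles k M A n s} = Pi {1..k} (T n)"
      by (auto simp: avoids_short_cycles_def T_def Pi_def)
    hence "measure_pmf.prob (pmf_of_set (perm_tuples k n)) {s. avoids_short_cycles k M A n s} =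
        (\<Prod>i\<in>{1..k}. measure_pmf.prob (pmf_of_set (P n)) (T n i))"
      unfolding Pi by (simp only: measure_Pi_pmf_Pi finite_atLeastAtMost)
    also have "\<dots> = (\<Prod>i\<in>{1..k}. measure_pmf.prob (pmf_of_set (perm_tuples k n)) {s. s i \<in> T n i})"
    proof (rule prod.cong)
      fix i assume i: "i \<in> {1..k}"
      have "pmf_of_set (P n) = map_pmf (\<lambda>s. s i) (pmf_of_set (perm_tuples k n))"
        unfolding Pi using i by (subst Pi_pmf_component) auto
      thus "measure_pmf.prob (pmf_of_set (P n)) (T n i) =
          measure_pmf.prob (pmf_of_set (perm_tuples k n)) {s. s i \<in> T n i}"
        by (simp add: vimage_def)
    qed simp
    finally show ?thesis .
  qed
  show ?thesis unfolding eq
  proof (rule tendsto_prod)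
    fix i assume "i \<in> {1..k}"
    from avoids_short_cycles_generator_limit[OF this, of M "A i"]
    show "(\<lambda>n. measure_pmf.prob (pmf_of_set (perm_tuples k n)) {s. s i \<in> T n i})
       \<longlonglongrightarrow> exp (- (\<Sum>r\<in>{1..M} - A i. 1 / real r))" by (simp add: T_def)
  qed
qed

section \<open>Conditioning on the allowed cycle lengths\<close>
definition restricted_tuples :: "nat \<Rightarrow> (nat \<Rightarrow> nat set) \<Rightarrow> nat \<Rightarrow> (nat \<Rightarrow> nat \<Rightarrow> nat) set" where
  "restricted_tuples k A n = PiE_dflt {1..k} id (\<lambda>i. perms_with_cycle_lengths n (A i))"

lemma restricted_tuples_iff:
  "s \<in> restricted_tuples k A n \<longleftrightarrow> s \<in> perm_tuples k n \<and> (\<forall>i\<in>{1..k}. \<forall>c\<in>cycles n (s i). card c \<in> A i)"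
  by (auto simp: restricted_tuples_def perm_tuples_def PiE_dflt_def perms_with_cycle_lengths_def)

lemma restricted_tuples_avoid: "s \<in> restricted_tuples k A n \<Longrightarrow> avoids_short_cycles k M A n s"
proof -
  assume s: "s \<in> restricted_tuples k A n"
  have "num_cycles n r (s i) = 0" if "i \<in> {1..k}" "r \<notin> A i" for i r
  proof -
    have "\<forall>c\<in>cycles n (s i). card c \<in> A i" using s that(1) unfolding restricted_tuples_iff by blast
    hence "{c \<in> cycles n (s i). card c = r} = {}" using that(2) by auto
    thus ?thesis by (simp only: num_cycles_def card.empty)
  qed
  thus ?thesis by (simp add: avoids_short_cycles_def)
qed

text \<open>
  A tuple that avoids the forbidden lengths up to \<open>M\<close> but is not a restricted one has a forbidden cycle of
  some length \<open>r > M\<close>; by Markov's inequality this has probability at most \<open>1/r\<close> for each \<open>i\<close> and \<open>r\<close>.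
\<close>
lemma card_only_long_forbidden_cycles:
  "real (card {s \<in> perm_tuples k n. avoids_short_cycles k M A n s \<and> s \<notin> restricted_tuples k A n}) \<le>
     (\<Sum>i\<in>{1..k}. \<Sum>r\<in>{M<..n} - A i. 1 / real r) * real (card (perm_tuples k n))"
proof -
  define D where "D i r = {s \<in> perm_tuples k n. 0 < num_cycles n r (s i)}" for i r
  have finD: "finite (D i r)" for i r by (simp add: D_def)
  have "{s \<in> perm_tuples k n. avoids_short_cycles k M A n s \<and> s \<notin> restricted_tuples k A n}
      \<subseteq> (\<Union>i\<in>{1..k}. \<Union>r\<in>{M<..n} - A i. D i r)"
  proof
    fix s assume "s \<in> {s \<in> perm_tuples k n. avoids_short_cycles k M A n s \<and> s \<notin> restricted_tuples k A n}"
    hence s: "s \<in> perm_tuples k n" "avoids_short_cycles k M A n s" "s \<notin> restricted_tuples k A n" by auto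
    then obtain i c where i: "i \<in> {1..k}" "c \<in> cycles n (s i)" "card c \<notin> A i"
      by (auto simp: restricted_tuples_iff)
    have perm: "s i permutes {1..n}" by (rule perm_tuples_permutes[OF s(1)])
    obtain x where x: "x \<in> {1..n}" "c = orbit (s i) x" using i(2) by (auto simp only: cycles_def image_iff)
    have "c \<subseteq> {1..n}" unfolding x(2) by (rule permutes_orbit_subset[OF perm x(1)])
    hence "card c \<le> n" using card_mono[of "{1..n}" c] by simp
    have c0: "0 < card c" using card_orbit_eq_iff[OF perm, of x "card c"] x by simp
    have "finite {c' \<in> cycles n (s i). card c' = card c}" by (simp add: cycles_def)
    moreover have "c \<in> {c' \<in> cycles n (s i). card c' = card c}" using i by simp
    ultimately have pos: "0 < num_cycles n (card c) (s i)"
      unfolding num_cycles_def by (metis card_gt_0_iff empty_iff)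
    have "\<not> card c \<le> M" using s(2) i(1,3) c0 pos by (auto simp: avoids_short_cycles_def)
    hence "s \<in> D i (card c)" "card c \<in> {M<..n} - A i"
      using s pos i \<open>card c \<le> n\<close> by (auto simp: D_def)
    thus "s \<in> (\<Union>i\<in>{1..k}. \<Union>r\<in>{M<..n} - A i. D i r)" using i(1) by blast
  qed
  hence "card {s \<in> perm_tuples k n. avoids_short_cycles k M A n s \<and> s \<notin> restricted_tuples k A n}
      \<le> card (\<Union>i\<in>{1..k}. \<Union>r\<in>{M<..n} - A i. D i r)"
    using finD by (intro card_mono) auto
  also have "\<dots> \<le> (\<Sum>i\<in>{1..k}. card (\<Union>r\<in>{M<..n} - A i. D i r))" by (rule card_UN_le) auto
  also have "\<dots> \<le> (\<Sum>i\<in>{1..k}. \<Sum>r\<in>{M<..n} - A i. card (D i r))" by (intro sum_mono card_UN_le) auto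
  finally have "real (card {s \<in> perm_tuples k n. avoids_short_cycles k M A n s \<and> s \<notin> restricted_tuples k A n})
      \<le> (\<Sum>i\<in>{1..k}. \<Sum>r\<in>{M<..n} - A i. real (card (D i r)))"
    by (simp only: of_nat_le_iff flip: of_nat_sum)
  also have "\<dots> \<le> (\<Sum>i\<in>{1..k}. \<Sum>r\<in>{M<..n} - A i. 1 / real r * real (card (perm_tuples k n)))"
  proof (intro sum_mono)
    fix i r assume ir: "i \<in> {1..k}" "r \<in> {M<..n} - A i"
    have "card (D i r) = (\<Sum>s\<in>D i r. 1)" by simp
    also have "\<dots> \<le> (\<Sum>s\<in>D i r. num_cycles n r (s i))" by (rule sum_mono) (auto simp: D_def)
    also have "\<dots> \<le> (\<Sum>s\<in>perm_tuples k n. num_cycles n r (s i))" by (rule sum_mono2) (auto simp: D_def)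
    finally have "r * card (D i r) \<le> r * (\<Sum>s\<in>perm_tuples k n. num_cycles n r (s i))" by simp
    also have "\<dots> = card (perm_tuples k n)" using ir by (intro sum_num_cycles_generator) auto
    finally have "real r * real (card (D i r)) \<le> real (card (perm_tuples k n))"
      by (simp only: of_nat_le_iff flip: of_nat_mult)
    thus "real (card (D i r)) \<le> 1 / real r * real (card (perm_tuples k n))"
      using ir by (simp add: field_simps)
  qed
  finally show ?thesis by (simp only: sum_distrib_right)
qed

lemma summable_tail:
  fixes f :: "nat \<Rightarrow> real"
  assumes "f summable_on B" "\<And>x. 0 \<le> f x" "0 < \<epsilon>"
  shows "\<exists>M. \<forall>n. sum f ({M<..n} \<inter> B) \<le> \<epsilon>"
proof -
  obtain X where X: "finite X" "X \<subseteq> B" "dist (sum f X) (infsum f B) \<le> \<epsilon>"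
    using has_sum_finite_approximation[OF has_sum_infsum[OF assms(1)] assms(3)] by blast
  have "sum f ({Max (insert 0 X)<..n} \<inter> B) \<le> \<epsilon>" for n
  proof -
    define Z where "Z = {Max (insert 0 X)<..n} \<inter> B"
    have disj: "X \<inter> Z = {}"
    proof (rule ccontr)
      assume "X \<inter> Z \<noteq> {}"
      then obtain z where "z \<in> X" "Max (insert 0 X) < z" by (auto simp: Z_def)
      thus False using Max_ge[of "insert 0 X" z] X(1) by auto
    qed
    have "finite Z" by (simp add: Z_def)
    hence "sum f X + sum f Z = sum f (X \<union> Z)" using disj X by (simp add: sum.union_disjoint)
    also have "\<dots> \<le> infsum f B"
      using X \<open>finite Z\<close> assms by (intro finite_sum_le_infsum) (auto simp: Z_def)
    finally show ?thesis using X(3) by (simp add: dist_real_def Z_def)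
  qed
  thus ?thesis by blast
qed

text \<open>
  Replacing the restricted tuples by the tuples avoiding forbidden lengths up to \<open>M\<close> changes
  all probabilities by at most a tail of convergent series, uniformly in \<open>n\<close>. By the same comparison
  for large \<open>n\<close> the probability of the conditioning event is at least a quarter of \<open>b\<close>, the product of
  \<open>exp (- \<Sum>1/r)\<close> over the forbidden lengths, so that dividing by it is harmless.
\<close>
lemma cycle_counts_restricted_limit:
  assumes w: "word_on k w" "cyclically_reduced w" "length w > 1" "\<not> is_power w"
    and A: "\<And>i. i \<in> {1..k} \<Longrightarrow> (\<lambda>j. 1 / real j) summable_on ({1..} - A i)"
    and m: "\<And>i. i \<notin> {1..l} \<Longrightarrow> m i = 0"
  shows "(\<lambda>n. card {s \<in> restricted_tuples k A n. cycle_counts n l (word_perm s w) = m} / card (restricted_tuples k A n))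
      \<longlonglongrightarrow> pmf (poisson_product l) m"
    and "\<forall>\<^sub>F n in sequentially. restricted_tuples k A n \<noteq> {}"
proof -
  define c where "c n = real (card (perm_tuples k n))" for n
  have c: "c n > 0" for n unfolding c_def using card_perm_tuples_pos by simp
  define \<pi> where "\<pi> = pmf (poisson_product l) m"
  have \<pi>: "0 \<le> \<pi>" "\<pi> \<le> 1" by (simp_all add: \<pi>_def pmf_le_1)
  define F where "F M n = {s \<in> perm_tuples k n. avoids_short_cycles k M A n s}" for M n
  define a where "a n = card {s \<in> restricted_tuples k A n. cycle_counts n l (word_perm s w) = m} / c n" for n
  define e where "e n = card (restricted_tuples k A n) / c n" for n
  define p where "p M n = card (joint_event k M A w l n m) / c n" for M n
  define q where "q M n = card (F M n) / c n" for M n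
  have lim: "(\<lambda>n. p M n - q M n * \<pi>) \<longlonglongrightarrow> 0" for M
    unfolding p_def q_def c_def F_def \<pi>_def
    by (rule joint_event_limit) (use w m in auto)
  define tail where "tail M n = (\<Sum>i\<in>{1..k}. \<Sum>r\<in>{M<..n} - A i. 1 / real r)" for M n
  have tail: "\<exists>M. \<forall>n. tail M n \<le> \<epsilon>" if \<epsilon>: "0 < \<epsilon>" for \<epsilon>
  proof -
    have "\<forall>i\<in>{1..k}. \<exists>M. \<forall>n. (\<Sum>r\<in>{M<..n} \<inter> ({1..} - A i). 1 / real r) \<le> \<epsilon> / real (Suc k)"
      using A \<epsilon> by (intro ballI summable_tail) auto
    then obtain M where M: "\<And>i n. i \<in> {1..k} \<Longrightarrow>
        (\<Sum>r\<in>{M i<..n} \<inter> ({1..} - A i). 1 / real r) \<le> \<epsilon> / real (Suc k)" by metis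
    define M' where "M' = (\<Sum>i\<in>{1..k}. M i)"
    have "tail M' n \<le> \<epsilon>" for n
    proof -
      have "tail M' n \<le> (\<Sum>i\<in>{1..k}. \<epsilon> / real (Suc k))" unfolding tail_def
      proof (rule sum_mono)
        fix i assume i: "i \<in> {1..k}"
        hence "M i \<le> M'" unfolding M'_def by (intro member_le_sum) auto
        hence "(\<Sum>r\<in>{M'<..n} - A i. 1 / real r) \<le> (\<Sum>r\<in>{M i<..n} \<inter> ({1..} - A i). 1 / real r)"
          by (intro sum_mono2) auto
        also have "\<dots> \<le> \<epsilon> / real (Suc k)" by (rule M[OF i])
        finally show "(\<Sum>r\<in>{M'<..n} - A i. 1 / real r) \<le> \<epsilon> / real (Suc k)" .
      qed
      also have "\<dots> = real k * \<epsilon> / real (Suc k)" by simp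
      also have "\<dots> \<le> \<epsilon>" using \<epsilon> by (simp add: divide_simps)
      finally show ?thesis .
    qed
    thus ?thesis by blast
  qed
  have diff: "q M n - tail M n \<le> e n" "e n \<le> q M n" "p M n - tail M n \<le> a n" "a n \<le> p M n" for M n
  proof -
    define D where "D = {s \<in> perm_tuples k n. avoids_short_cycles k M A n s \<and> s \<notin> restricted_tuples k A n}"
    have D: "real (card D) \<le> tail M n * c n" unfolding D_def tail_def c_def by (rule card_only_long_forbidden_cycles)
    have good: "restricted_tuples k A n \<subseteq> perm_tuples k n" by (auto simp: restricted_tuples_iff)
    hence fing: "finite (restricted_tuples k A n)" by (rule finite_subset) simp
    have finD: "finite D" "finite (F M n)" by (simp_all add: D_def F_def)
    have 1: "card (F M n) \<le> card (restricted_tuples k A n) + card D"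
      by (rule card_le_card_add[OF fing _ finD(1)]) (auto simp: F_def D_def)
    have 2: "card (restricted_tuples k A n) \<le> card (F M n)"
      using good restricted_tuples_avoid by (intro card_mono finD) (auto simp: F_def)
    have 3: "card (joint_event k M A w l n m) \<le>
        card {s \<in> restricted_tuples k A n. cycle_counts n l (word_perm s w) = m} + card D"
      by (rule card_le_card_add[OF _ _ finD(1)]) (use fing in \<open>auto simp: joint_event_def D_def\<close>)
    have 4: "card {s \<in> restricted_tuples k A n. cycle_counts n l (word_perm s w) = m} \<le>
        card (joint_event k M A w l n m)"
      using good restricted_tuples_avoid by (intro card_mono) (auto simp: joint_event_def)
    have D': "real (card D) / c n \<le> tail M n" using D c[of n] by (simp add: pos_divide_le_eq)
    show "e n \<le> q M n" "a n \<le> p M n"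
      using 2 4 c[of n] by (simp_all add: e_def q_def a_def p_def divide_right_mono)
    have "q M n \<le> (real (card (restricted_tuples k A n)) + real (card D)) / c n"
      unfolding q_def using 1 c[of n] by (intro divide_right_mono) auto
    thus "q M n - tail M n \<le> e n" using D' by (simp add: e_def add_divide_distrib)
    have "p M n \<le> (real (card {s \<in> restricted_tuples k A n. cycle_counts n l (word_perm s w) = m}) + real (card D)) / c n"
      unfolding p_def using 3 c[of n] by (intro divide_right_mono) auto
    thus "p M n - tail M n \<le> a n" using D' by (simp add: a_def add_divide_distrib)
  qed
  have lim_a: "(\<lambda>n. a n - e n * \<pi>) \<longlonglongrightarrow> 0"
  proof (rule LIMSEQ_I)
    fix \<epsilon> :: real assume \<epsilon>: "0 < \<epsilon>"
    obtain M where M: "\<And>n. tail M n \<le> \<epsilon> / 3" using tail[of "\<epsilon> / 3"] \<epsilon> by auto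
    have "\<forall>\<^sub>F n in sequentially. dist (p M n - q M n * \<pi>) 0 < \<epsilon> / 3"
      using tendstoD[OF lim[of M], of "\<epsilon> / 3"] \<epsilon> by simp
    hence "\<forall>\<^sub>F n in sequentially. norm (a n - e n * \<pi> - 0) < \<epsilon>"
    proof eventually_elim
      case (elim n)
      have "\<bar>q M n - e n\<bar> * \<pi> \<le> \<epsilon> / 3 * 1"
        using diff(1,2)[where M = M and n = n] M[of n] \<pi> \<epsilon> by (intro mult_mono) auto
      hence "\<bar>q M n * \<pi> - e n * \<pi>\<bar> \<le> \<epsilon> / 3" using \<pi> by (simp add: abs_mult flip: left_diff_distrib)
      thus ?case using elim diff(3,4)[where M = M and n = n] M[of n]
        unfolding real_norm_def dist_real_def by linarith
    qed
    thus "\<exists>no. \<forall>n\<ge>no. norm (a n - e n * \<pi> - 0) < \<epsilon>" by (simp add: eventually_sequentially)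
  qed
  define b where "b = (\<Prod>i\<in>{1..k}. exp (- infsum (\<lambda>r. 1 / real r) ({1..} - A i)))"
  have b: "0 < b" unfolding b_def by (intro prod_pos) auto
  have ev: "\<forall>\<^sub>F n in sequentially. b / 4 \<le> e n"
  proof -
    obtain M where M: "\<And>n. tail M n \<le> b / 4" using tail[of "b / 4"] b by auto
    have q_eq: "q M n = measure_pmf.prob (pmf_of_set (perm_tuples k n)) {s. avoids_short_cycles k M A n s}" for n
      by (simp add: q_def F_def c_def measure_pmf_of_set_perm_tuples)
    have "b \<le> (\<Prod>i\<in>{1..k}. exp (- (\<Sum>r\<in>{1..M} - A i. 1 / real r)))"
      unfolding b_def
    proof (rule prod_mono)
      fix i assume i: "i \<in> {1..k}"
      have "(\<Sum>r\<in>{1..M} - A i. 1 / real r) \<le> infsum (\<lambda>r. 1 / real r) ({1..} - A i)"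
        using A[OF i] by (intro finite_sum_le_infsum) auto
      thus "0 \<le> exp (- infsum (\<lambda>r. 1 / real r) ({1..} - A i)) \<and>
          exp (- infsum (\<lambda>r. 1 / real r) ({1..} - A i)) \<le> exp (- (\<Sum>r\<in>{1..M} - A i. 1 / real r))" by simp
    qed
    hence "b / 2 < (\<Prod>i\<in>{1..k}. exp (- (\<Sum>r\<in>{1..M} - A i. 1 / real r)))" using b by linarith
    from order_tendstoD(1)[OF avoids_short_cycles_limit this]
    show ?thesis
    proof eventually_elim
      case (elim n)
      thus ?case using diff(1)[where M = M and n = n] M[of n] q_eq[of n] by linarith
    qed
  qed
  show "\<forall>\<^sub>F n in sequentially. restricted_tuples k A n \<noteq> {}"
    using ev
  proof eventually_elim
    case (elim n)
    thus ?case using b by (auto simp: e_def)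
  qed
  have "(\<lambda>n. a n / e n - \<pi>) \<longlonglongrightarrow> 0"
  proof (rule Lim_null_comparison)
    show "\<forall>\<^sub>F n in sequentially. norm (a n / e n - \<pi>) \<le> \<bar>a n - e n * \<pi>\<bar> * (4 / b)"
      using ev
    proof eventually_elim
      case (elim n)
      hence e: "0 < e n" using b by linarith
      have "a n / e n - \<pi> = (a n - e n * \<pi>) / e n" using e by (simp add: diff_divide_distrib)
      hence "norm (a n / e n - \<pi>) = \<bar>a n - e n * \<pi>\<bar> * (1 / e n)" using e by (simp add: abs_divide)
      also have "1 / e n \<le> 4 / b" using elim b e by (simp add: field_simps)
      hence "\<bar>a n - e n * \<pi>\<bar> * (1 / e n) \<le> \<bar>a n - e n * \<pi>\<bar> * (4 / b)" by (intro mult_left_mono) auto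
      finally show ?case .
    qed
    show "(\<lambda>n. \<bar>a n - e n * \<pi>\<bar> * (4 / b)) \<longlonglongrightarrow> 0"
      using tendsto_mult_right[OF tendsto_rabs_zero[OF lim_a], of "4 / b"] by simp
  qed
  hence "(\<lambda>n. a n / e n) \<longlonglongrightarrow> \<pi>" by (simp add: LIM_zero_iff)
  moreover have "a n / e n = card {s \<in> restricted_tuples k A n. cycle_counts n l (word_perm s w) = m} / card (restricted_tuples k A n)" for n
    using c[of n] by (simp add: a_def e_def)
  ultimately show "(\<lambda>n. card {s \<in> restricted_tuples k A n. cycle_counts n l (word_perm s w) = m} / card (restricted_tuples k A n))
      \<longlonglongrightarrow> pmf (poisson_product l) m" by (simp add: \<pi>_def)
qed

theorem theorem3p7:
  fixes k :: nat and A :: "nat \<Rightarrow> nat set" and w :: "letter list"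
  assumes "k \<ge> 1"
    and "\<And>i. i \<in> {1..k} \<Longrightarrow> A i \<subseteq> {1..}"
    and "\<And>i. i \<in> {1..k} \<Longrightarrow> A i \<noteq> {}"
    and "\<And>i. i \<in> {1..k} \<Longrightarrow> A i \<noteq> {1}"
    and "\<And>i. i \<in> {1..k} \<Longrightarrow>
           finite (A i) \<or> (\<lambda>j. 1 / real j) summable_on ({1..} - A i)"
    and "\<And>i. i \<in> {1..k} \<Longrightarrow> infinite (A i)"
    and "word_on k w"
    and "cyclically_reduced w"
    and "length w > 1"
    and "\<not> is_power w"
  shows "\<forall>l\<ge>1. converges_weakly
           (\<lambda>n. measure_pmf (map_pmf (cycle_counts n l) (random_word_perm k A w n)))
           (measure_pmf (poisson_product l))
           (inf sequentially (principal (admissible_sizes k A)))"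
  unfolding converges_weakly_def
proof (intro allI impI)
  fix l :: nat and f :: "(nat \<Rightarrow> nat) \<Rightarrow> real"
  assume f: "continuous_on UNIV f \<and> bounded (range f)"
  have A: "(\<lambda>j. 1 / real j) summable_on ({1..} - A i)" if "i \<in> {1..k}" for i
    using assms(5,6)[OF that] by blast
  have pmf_eq: "pmf (map_pmf (cycle_counts n l) (random_word_perm k A w n)) m =
      card {s \<in> restricted_tuples k A n. cycle_counts n l (word_perm s w) = m} / card (restricted_tuples k A n)"
    if ne: "restricted_tuples k A n \<noteq> {}" for n m
  proof -
    have "finite (perms_with_cycle_lengths n (A i))" for i
      by (rule finite_subset[of _ "{p. p permutes {1..n}}"])
         (auto simp: perms_with_cycle_lengths_def finite_permutations)
    moreover have "perms_with_cycle_lengths n (A i) \<noteq> {}" if "i \<in> {1..k}" for i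
      using ne that by (auto simp: restricted_tuples_def)
    ultimately have rp: "random_perms k A n = pmf_of_set (restricted_tuples k A n)"
      unfolding random_perms_def restricted_tuples_def by (intro Pi_pmf_of_set) auto
    have "finite (restricted_tuples k A n)"
      by (rule finite_subset[of _ "perm_tuples k n"]) (auto simp: restricted_tuples_iff)
    thus ?thesis
      unfolding random_word_perm_def rp map_pmf_comp pmf_map
      using ne by (simp add: measure_pmf_of_set vimage_def Int_def)
  qed
  have "(\<lambda>n. measure_pmf.expectation (map_pmf (cycle_counts n l) (random_word_perm k A w n)) f)
      \<longlonglongrightarrow> measure_pmf.expectation (poisson_product l) f"
  proof (rule pmf_pointwise_imp_expectation)
    fix m assume "m \<in> set_pmf (poisson_product l)"
    hence "\<And>i. i \<notin> {1..l} \<Longrightarrow> m i = 0" by (rule poisson_product_support)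
    hence lim': "(\<lambda>n. card {s \<in> restricted_tuples k A n. cycle_counts n l (word_perm s w) = m}
          / card (restricted_tuples k A n)) \<longlonglongrightarrow> pmf (poisson_product l) m"
        "\<forall>\<^sub>F n in sequentially. restricted_tuples k A n \<noteq> {}"
      using cycle_counts_restricted_limit[OF assms(7-10), of A l m] A by blast+
    show "(\<lambda>n. pmf (map_pmf (cycle_counts n l) (random_word_perm k A w n)) m) \<longlonglongrightarrow> pmf (poisson_product l) m"
    proof (rule Lim_transform_eventually[OF lim'(1)])
      show "\<forall>\<^sub>F n in sequentially. card {s \<in> restricted_tuples k A n. cycle_counts n l (word_perm s w) = m}
          / card (restricted_tuples k A n) = pmf (map_pmf (cycle_counts n l) (random_word_perm k A w n)) m"
        using lim'(2) by eventually_elim (simp add: pmf_eq)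
    qed
  qed (use f in blast)
  thus "((\<lambda>n. measure_pmf.expectation (map_pmf (cycle_counts n l) (random_word_perm k A w n)) f)
      \<longlongrightarrow> measure_pmf.expectation (poisson_product l) f)
      (inf sequentially (principal (admissible_sizes k A)))"
    by (rule tendsto_mono[OF inf_le1])
qed

end
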